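(* Let $x>0$ be a fixed real number. For every sufficiently large prime $p$ (in terms of $x$), with $q:=\lfloor\sqrt{p/3}\rfloor$, the number of even Dirichlet characters $\chi$ modulo $p$ such that $\vartheta(x;\chi)\neq 0$ is $$\gg \frac{p}{\mathcal E_q}\gg\frac{p}{(\log p)^{\delta}(\log\log p)^6},$$ where the implied constants depend at most on $x$.
   Context: A Dirichlet character $\chi$ is even if $\chi(-1)=1$. For an even Dirichlet character $\chi$ modulo a prime $p$ and $x>0$, $$\vartheta(x;\chi):=\sum_{n\geqslant 1}\chi(n)\mathrm e^{-\pi n^2x/p}.$$ For an integer $N\geqslant 1$, $$\mathcal E_N:=\inf_{\boldsymbol c\in(\mathbb R^+)^N,\ \|\boldsymbol c\|_1=1}N^2\sum_{1\leqslant n\leqslant N^2}\Bigg(\sum_{\substack{d\leqslant N,\ t\leqslant N\\ dt=n}}c_dc_t\Bigg)^2,$$ where $\mathbb R^+=[0,\infty)$ and $\|\boldsymbol c\|_1=\sum_{n\leqslant N}|c_n|$. The exponent is $\delta:=1-\dfrac{1+\log\log 2}{\log 2}\approx 0.08607$. The notation $A\gg B$ means $A\geqslant KB$ for some constant $K>0$. *)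

theory Defs
  imports Complex_Main "HOL-Computational_Algebra.Primes"
begin

definition dirichlet_character :: "nat \<Rightarrow> (int \<Rightarrow> complex) \<Rightarrow> bool" where
  "dirichlet_character m \<chi> \<longleftrightarrow>
     (\<forall>a b. \<chi> (a * b) = \<chi> a * \<chi> b) \<and>
     (\<forall>a. \<chi> (a + int m) = \<chi> a) \<and>
     (\<forall>a. \<chi> a \<noteq> 0 \<longleftrightarrow> coprime a (int m))"

definition even_characters :: "nat \<Rightarrow> (int \<Rightarrow> complex) set" where
  "even_characters m = {\<chi>. dirichlet_character m \<chi> \<and> \<chi> (-1) = 1}"

text \<open>The sum over \<open>n \<ge> 1\<close> is indexed by \<open>Suc n\<close>.\<close>

definition theta :: "nat \<Rightarrow> real \<Rightarrow> (int \<Rightarrow> complex) \<Rightarrow> complex" where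
  "theta p x \<chi> =
     (\<Sum>n. \<chi> (int (Suc n)) * of_real (exp (- pi * real (Suc n) ^ 2 * x / real p)))"

text \<open>Vectors in \<open>[0,\<infinity>)\<^sup>N\<close> are functions on \<open>nat\<close> constrained only on \<open>{1..N}\<close>; values outside
  that range are not used.\<close>

definition unit_weights :: "nat \<Rightarrow> (nat \<Rightarrow> real) set" where
  "unit_weights N = {c. (\<forall>n\<in>{1..N}. 0 \<le> c n) \<and> (\<Sum>n=1..N. \<bar>c n\<bar>) = 1}"

definition mult_energy :: "nat \<Rightarrow> real" where
  "mult_energy N = (INF c\<in>unit_weights N. real N ^ 2 *
     (\<Sum>n=1..N^2. (\<Sum>(d, t)\<in>{(d, t). d \<in> {1..N} \<and> t \<in> {1..N} \<and> d * t = n}. c d * c t) ^ 2))"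

definition delta :: real where
  "delta = 1 - (1 + ln (ln 2)) / ln 2"

end

theory Submission
  imports Defs "HOL-Number_Theory.Number_Theory" "HOL-Analysis.Convex" "HOL-Library.Multiset"
begin

text \<open>
  Write \<open>q\<close> for the integer part of \<open>sqrt (p / 3)\<close> and \<open>E\<close> for the energy of length \<open>q\<close>.

  \<^bold>\<open>Nonvanishing from small energy.\<close>  For nonnegative weights \<open>c\<close> of total mass 1 on \<open>{1..q}\<close> put
  \<open>M(\<chi>) = (\<Sum>d. c d * \<chi> d)\<close>.  By orthogonality the sum of \<open>theta(\<chi>)\<close> times the conjugate of \<open>M(\<chi>)\<close>
  over the even characters only sees the pairs with \<open>n = d\<close> or \<open>n = - d\<close> modulo \<open>p\<close>.  All terms
  are nonnegative, and the diagonal \<open>n = d\<close> alone gives at least a constant times \<open>p\<close>, because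
  \<open>d\<^sup>2 \<le> p / 3\<close> keeps the Gaussian bounded below.  Only characters with \<open>theta(\<chi>) \<noteq> 0\<close> contribute, so
  two applications of Cauchy-Schwarz bound the fourth power of this sum by the number of such
  characters, times the fourth moment of \<open>M\<close>, times the square of the second moment of \<open>theta\<close>.  The
  second moment is \<open>O(p powr (3/2))\<close>.  In the fourth moment the products \<open>d * t\<close> are at most \<open>p / 3\<close>,
  so a congruence up to sign between two of them is an equality, and the moment is exactly
  \<open>(p - 1) / 2\<close> times the quadratic form that defines the energy.  Hence the count times \<open>E\<close> is at
  least a constant times \<open>p\<close> (\<open>theta_nonvanishing_count_energy\<close>).

  \<^bold>\<open>Small energy.\<close>  It remains to exhibit a set \<open>A\<close> of integers up to \<open>N\<close> with few solutions of
  \<open>d1 * d2 = d3 * d4\<close> compared with its size (\<open>mult_energy_le_set\<close>).  Up to powers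
  of \<open>ln (ln N)\<close>, there are \<open>N / (ln N) powr (delta / 2)\<close> integers with \<open>k = ln (ln N) / ln 4\<close> prime
  factors, and a product of two of them has \<open>4 ^ k = ln N\<close> splittings into two factors with \<open>k\<close>
  primes each.  Typically the sizes of these factors spread over a logarithmic scale of length
  \<open>ln N\<close>, so that only boundedly many splittings have both factors of size about \<open>N\<close>; this would give
  an energy of order \<open>(ln N) powr delta\<close>, up to powers of \<open>ln (ln N)\<close>.  Integers whose prime factors cluster at small scales destroy this count,
  and they are excluded by a ballot condition.  Measure a prime by
  \<open>U p = (\<Sum> of 1 / r over primes r \<le> p) / ln 4\<close>, so that \<open>ln p\<close> has order \<open>4 powr (U p)\<close> by Mertens'
  theorem; the condition is that at most \<open>i\<close> of the prime factors have \<open>U p < i + 1\<close>, for every \<open>i\<close>.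
  The integers in \<open>A\<close> are \<open>m * P\<close> where \<open>m\<close> runs over products of \<open>k\<close> primes subject to the ballot
  condition and \<open>P\<close> is a prime exceeding all of them, with \<open>m * P \<le> N\<close>.

  Summing out the large primes reduces the energy of \<open>A\<close> to the sum of
  \<open>1 / (max m1 m3 * max m2 m4)\<close> over \<open>m1 * m2 = m3 * m4\<close>.  Write \<open>m1 = a b\<close>, \<open>m3 = a c\<close>, \<open>m2 = c e\<close>,
  \<open>m4 = b e\<close> with \<open>b\<close>, \<open>c\<close> coprime, and let \<open>P\<close> be the largest prime of \<open>b * c\<close>, say with
  \<open>i \<le> U P < i + 1\<close>.  Since \<open>b\<close> and \<open>c\<close> must have comparable size, the sum over \<open>P\<close> saves a factor of
  order \<open>4 ^ i\<close>; the ballot condition leaves at most \<open>2 ^ (2 * i - 1)\<close> choices for the remaining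
  primes of \<open>b\<close> and for \<open>c\<close>, and the two effects cancel.  So the sum is \<open>O(k * W\<^sup>2)\<close>, where \<open>W\<close> is the
  sum of \<open>1 / m\<close> (\<open>ballot_quadruples_sum_le\<close>).  The sum \<open>W\<close> is at least \<open>(ln 4) ^ k\<close> times the
  volume of the region \<open>j \<le> u_j\<close>, \<open>u_1 \<le> \<dots> \<le> u_k \<le> k + 1\<close>, which has a closed form
  (\<open>ballot_sum_lower\<close>).  Stirling's bound then yields \<open>(ln N) powr delta\<close> times a power of
  \<open>ln (ln N)\<close> of exponent at most 6 (\<open>mult_energy_upper_bound\<close>); the bound \<open>m \<le> sqrt N\<close>, which is
  enforced prime by prime, costs \<open>2 - delta\<close> of these factors.
\<close>

section \<open>Even characters modulo a prime\<close>

lemma prime_primitive_root_int: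
  fixes p :: nat
  assumes "prime p"
  obtains g where "coprime p g" "ord p g = p - 1"
    "\<And>a::int. \<not> int p dvd a \<Longrightarrow> \<exists>i. [a = int g ^ i] (mod int p)"
proof -
  have p1: "p > 1" using assms prime_gt_1_nat by blast
  obtain g where g: "residue_primroot p g"
    using prime_primitive_root_exists[of p] assms p1 by auto
  have 1: "coprime p g" "ord p g = p - 1"
    using g assms by (auto simp: residue_primroot_def totient_prime)
  have 2: "\<exists>i. [a = int g ^ i] (mod int p)" if a: "\<not> int p dvd a" for a :: int
  proof -
    define r where "r = nat (a mod int p)"
    have r: "int r = a mod int p" using p1 by (simp add: r_def)
    have "r \<noteq> 0"
    proof
      assume "r = 0"
      then have "a mod int p = 0" using r by simp
      then show False using a by (simp add: dvd_eq_mod_eq_0)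
    qed
    moreover have "int r < int p" using r p1 by simp
    ultimately have "r \<in> totatives p" using assms
      by (auto simp: totatives_prime)
    then obtain i where "r = g ^ i mod p"
      using residue_primroot_is_generator[OF p1 g] unfolding bij_betw_def by blast
    then have "int r = int g ^ i mod int p" by (simp add: zmod_int)
    then have "[a = int g ^ i] (mod int p)" using r by (simp add: cong_def)
    then show ?thesis by blast
  qed
  show ?thesis using that 1 2 by blast
qed

lemma dirichlet_character_cong:
  assumes "dirichlet_character m \<chi>" "[a = b] (mod int m)"
  shows "\<chi> a = \<chi> b"
proof -
  have per: "\<chi> (a + int m) = \<chi> a" for a using assms by (auto simp: dirichlet_character_def)
  have pern: "\<chi> (a + int n * int m) = \<chi> a" for a n
  proof (induction n)
    case (Suc n)
    have "\<chi> (a + int (Suc n) * int m) = \<chi> ((a + int n * int m) + int m)" by (simp add: algebra_simps)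
    then show ?case using per Suc by simp
  qed simp
  obtain k where k: "b = a + int m * k" using assms(2) by (metis cong_iff_lin)
  show ?thesis
  proof (cases "k \<ge> 0")
    case True then show ?thesis using pern[of a "nat k"] k by (simp add: mult.commute)
  next
    case False
    then have "a = b + int (nat (-k)) * int m" using k by (simp add: algebra_simps)
    then show ?thesis using pern by metis
  qed
qed

lemma dirichlet_character_1:
  assumes "dirichlet_character m \<chi>" shows "\<chi> 1 = 1"
proof -
  have "\<chi> 1 = \<chi> 1 * \<chi> 1" using assms unfolding dirichlet_character_def by (metis mult.right_neutral)
  moreover have "\<chi> 1 \<noteq> 0" using assms by (simp add: dirichlet_character_def)
  ultimately show ?thesis by simp
qed

lemma dirichlet_character_power:
  assumes "dirichlet_character m \<chi>" shows "\<chi> (a ^ n) = \<chi> a ^ n"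
  using assms by (induction n) (auto simp: dirichlet_character_1[OF assms] dirichlet_character_def)

lemma coprime_prime_int_iff:
  fixes p :: nat
  assumes "prime p"
  shows "coprime a (int p) \<longleftrightarrow> \<not> int p dvd a"
proof -
  have "prime (int p)" using assms by simp
  then show ?thesis
    by (metis coprime_absorb_left coprime_commute not_prime_unit prime_imp_coprime)
qed

lemma dirichlet_character_prime_zero:
  assumes "prime p" "dirichlet_character p \<chi>"
  shows "\<chi> a = 0 \<longleftrightarrow> int p dvd a"
  using assms coprime_prime_int_iff[OF assms(1), of a] unfolding dirichlet_character_def by blast

text \<open>
  The half power of a primitive root squares to 1 but is not 1, so it is \<open>-1\<close>.  This turns evenness
  of a character into an equation for its value at the primitive root.
\<close>

lemma primitive_root_half:
  fixes p g :: nat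
  assumes "prime p" "p > 2" "coprime p g" "ord p g = p - 1"
  shows "[int g ^ ((p - 1) div 2) = - 1] (mod int p)"
proof -
  let ?h = "(p - 1) div 2"
  have "odd p" using assms prime_odd_nat by blast
  then have h2: "?h * 2 = p - 1" by presburger
  have pp: "prime (int p)" using assms by simp
  have "[g ^ (p - 1) = 1] (mod p)" using assms ord[of g p] by simp
  then have "[int g ^ (p - 1) = 1] (mod int p)" by (metis cong_int_iff of_nat_1 of_nat_power)
  then have "int p dvd (int g ^ ?h)^2 - 1"
    by (metis cong_iff_dvd_diff h2 power_mult)
  also have "(int g ^ ?h)^2 - 1 = (int g ^ ?h - 1) * (int g ^ ?h + 1)"
    by (simp add: power2_eq_square algebra_simps)
  finally have "int p dvd (int g ^ ?h - 1) \<or> int p dvd (int g ^ ?h + 1)"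
    using pp prime_dvd_mult_iff by blast
  moreover have "\<not> int p dvd (int g ^ ?h - 1)"
  proof
    assume "int p dvd (int g ^ ?h - 1)"
    then have "[int g ^ ?h = 1] (mod int p)" by (simp add: cong_iff_dvd_diff)
    then have "[g ^ ?h = 1] (mod p)" by (metis cong_int_iff of_nat_1 of_nat_power)
    then have "p - 1 dvd ?h" using assms ord_divides by metis
    then have "p - 1 \<le> ?h" using h2 assms(2) by (intro dvd_imp_le) auto
    then show False using h2 assms(2) by linarith
  qed
  ultimately show ?thesis by (simp add: cong_iff_dvd_diff)
qed

text \<open>
  A character is determined by its value \<open>w\<close> at a primitive root \<open>g\<close>, and \<open>g\<close> raised to half the group
  order is \<open>-1\<close>; so evenness says exactly that \<open>w\<close> is a root of unity of order dividing
  \<open>(p - 1) / 2\<close>.  Sums over even characters thereby become sums over roots of unity.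
\<close>

lemma bij_betw_even_characters:
  fixes p g :: nat
  assumes "prime p" "p > 2" "coprime p g" "ord p g = p - 1"
    and gen: "\<And>a::int. \<not> int p dvd a \<Longrightarrow> \<exists>i. [a = int g ^ i] (mod int p)"
  shows "bij_betw (\<lambda>\<chi>. \<chi> (int g)) (even_characters p) {w. w ^ ((p - 1) div 2) = 1}"
proof -
  let ?h = "(p - 1) div 2"
  have "odd p" using assms prime_odd_nat by blast
  then have h2: "?h * 2 = p - 1" by presburger
  have pp: "prime (int p)" using assms by simp
  have ndg: "\<not> int p dvd int g ^ i" for i
    using assms pp by (metis coprime_absorb_left int_dvd_int_iff not_prime_unit prime_dvd_power)
  have half: "[int g ^ ?h = - 1] (mod int p)" using primitive_root_half assms by blast
  have pow: "[i = j] (mod (p - 1))" if "[int g ^ i = int g ^ j] (mod int p)" for i j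
    using that order_divides_expdiff[of p g i j] assms(3,4)
    by (metis cong_int_iff of_nat_power)
  show ?thesis
  proof (rule bij_betw_imageI)
    show "inj_on (\<lambda>\<chi>. \<chi> (int g)) (even_characters p)"
    proof (rule inj_onI, rule ext)
      fix \<chi> \<psi> a assume *: "\<chi> \<in> even_characters p" "\<psi> \<in> even_characters p" "\<chi> (int g) = \<psi> (int g)"
      then have d: "dirichlet_character p \<chi>" "dirichlet_character p \<psi>" by (auto simp: even_characters_def)
      show "\<chi> a = \<psi> a"
      proof (cases "int p dvd a")
        case True then show ?thesis using dirichlet_character_prime_zero assms(1) d by metis
      next
        case False
        then obtain i where "[a = int g ^ i] (mod int p)" using gen by blast
        then show ?thesis using d * by (metis dirichlet_character_cong dirichlet_character_power)
      qed
    qed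
  next
    show "(\<lambda>\<chi>. \<chi> (int g)) ` even_characters p = {w. w ^ ?h = 1}"
    proof (intro equalityI subsetI)
      fix w assume "w \<in> (\<lambda>\<chi>. \<chi> (int g)) ` even_characters p"
      then obtain \<chi> where *: "w = \<chi> (int g)" "dirichlet_character p \<chi>" "\<chi> (-1) = 1"
        by (auto simp: even_characters_def)
      then have "w ^ ?h = 1"
        by (metis dirichlet_character_cong dirichlet_character_power half)
      then show "w \<in> {w. w ^ ?h = 1}" by simp
    next
      fix w :: complex assume "w \<in> {w. w ^ ?h = 1}"
      then have w: "w ^ ?h = 1" by simp
      have wc: "w ^ i = w ^ j" if "[i = j] (mod (p - 1))" for i j
      proof -
        have "[i = j] (mod ?h)" using that h2 by (metis cong_modulus_mult_nat)
        have r: "w ^ n = w ^ (n mod ?h)" for n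
          using w power_add[of w "?h * (n div ?h)" "n mod ?h"] by (simp add: power_mult)
        show ?thesis using r[of i] r[of j] \<open>[i = j] (mod ?h)\<close> by (simp add: cong_def)
      qed
      have w0: "w \<noteq> 0" using w assms(2) by (auto simp: power_0_left split: if_splits)
      define ind where "ind = (\<lambda>a. SOME i. [a = int g ^ i] (mod int p))"
      have ind: "[a = int g ^ ind a] (mod int p)" if "\<not> int p dvd a" for a
        using gen[OF that] unfolding ind_def by (rule someI_ex)
      have ind_eq: "w ^ ind a = w ^ i" if "[a = int g ^ i] (mod int p)" for a i
      proof -
        have "\<not> int p dvd a" using that ndg cong_dvd_iff by blast
        then have "[int g ^ ind a = int g ^ i] (mod int p)" using ind that cong_sym cong_trans by blast
        then show ?thesis using pow wc by blast
      qed
      define \<chi> where "\<chi> = (\<lambda>a. if int p dvd a then 0 else w ^ ind a)"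
      have "\<chi> (a * b) = \<chi> a * \<chi> b" for a b
      proof (cases "int p dvd a * b")
        case True then show ?thesis using pp by (auto simp: \<chi>_def prime_dvd_mult_iff)
      next
        case False
        then have n: "\<not> int p dvd a" "\<not> int p dvd b" by auto
        have "[a * b = int g ^ (ind a + ind b)] (mod int p)"
          unfolding power_add using n ind by (intro cong_mult) auto
        then have "w ^ ind (a * b) = w ^ (ind a + ind b)" by (rule ind_eq)
        then show ?thesis using n False by (simp add: \<chi>_def power_add)
      qed
      moreover have "\<chi> (a + int p) = \<chi> a" for a
      proof (cases "int p dvd a")
        case False
        have "[a + int p = int g ^ ind a] (mod int p)" using ind[OF False] by (simp add: cong_def)
        then have "w ^ ind (a + int p) = w ^ ind a" by (rule ind_eq)
        then show ?thesis by (simp add: \<chi>_def)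
      qed (simp add: \<chi>_def)
      moreover have "\<chi> a \<noteq> 0 \<longleftrightarrow> coprime a (int p)" for a
        using w0 coprime_prime_int_iff[OF assms(1), of a] by (simp add: \<chi>_def)
      moreover have "\<chi> (-1) = 1"
      proof -
        have "w ^ ind (-1) = w ^ ?h" by (rule ind_eq) (use half cong_sym in blast)
        moreover have "\<not> int p dvd -1" using pp not_prime_unit by auto
        ultimately show ?thesis using w by (simp add: \<chi>_def)
      qed
      ultimately have "\<chi> \<in> even_characters p"
        by (simp add: even_characters_def dirichlet_character_def)
      moreover have "\<chi> (int g) = w" using ind_eq[of "int g" 1] ndg[of 1] by (simp add: \<chi>_def)
      ultimately show "w \<in> (\<lambda>\<chi>. \<chi> (int g)) ` even_characters p" by force
    qed
  qed
qed

lemma finite_even_characters: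
  assumes "prime p" "p > 2" shows "finite (even_characters p)"
proof -
  obtain g where g: "coprime p g" "ord p g = p - 1"
    "\<And>a::int. \<not> int p dvd a \<Longrightarrow> \<exists>i. [a = int g ^ i] (mod int p)"
    using prime_primitive_root_int[OF assms(1)] by blast
  have "(p - 1) div 2 \<ge> 1" using assms(2) by linarith
  then have "finite {w::complex. w ^ ((p - 1) div 2) = 1}" by (intro finite_roots_unity)
  then show ?thesis using bij_betw_finite[OF bij_betw_even_characters[OF assms g]] by simp
qed

text \<open>
  Replacing \<open>w\<close> by \<open>om * w\<close> for a primitive root of unity \<open>om\<close> permutes the index set and multiplies
  the sum by \<open>om ^ (i - j)\<close>, which differs from 1 unless \<open>i\<close> and \<open>j\<close> are congruent.
\<close>

lemma sum_roots_unity_twisted: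
  fixes h i j :: nat
  assumes "h > 0"
  shows "(\<Sum>w | w ^ h = 1. (w::complex) ^ i * cnj w ^ j) = (if [i = j] (mod h) then of_nat h else 0)"
proof -
  have unit: "w * cnj w = 1" if "w ^ h = 1" for w :: complex
  proof -
    have "norm w = 1" using power_eq_1_iff[OF that] assms by auto
    then show ?thesis by (simp add: complex_norm_square[symmetric])
  qed
  define om where "om = cis (2 * pi / real h)"
  have om: "om ^ h = 1" using assms by (simp add: om_def DeMoivre)
  define S where "S = (\<Sum>w | w ^ h = 1. (w::complex) ^ i * cnj w ^ j)"
  have red: "w ^ n = w ^ (n mod h)" if "w ^ h = 1" for w :: complex and n
    using that power_add[of w "h * (n div h)" "n mod h"] by (simp add: power_mult)
  show ?thesis
  proof (cases "[i = j] (mod h)")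
    case True
    have "w ^ i * cnj w ^ j = 1" if "w ^ h = 1" for w :: complex
    proof -
      have "w ^ i = w ^ j" using red[OF that] True by (metis cong_def)
      then have "w ^ i * cnj w ^ j = (w * cnj w) ^ j" by (simp add: power_mult_distrib)
      then show ?thesis using unit[OF that] by simp
    qed
    then have "S = of_nat (card {w::complex. w ^ h = 1})" by (simp add: S_def)
    then show ?thesis using True card_roots_unity_eq[OF assms] by (simp add: S_def)
  next
    case False
    have "S = (\<Sum>w | w ^ h = 1. (om * w) ^ i * cnj (om * w) ^ j)"
      unfolding S_def
    proof (rule sum.reindex_bij_witness[of _ "\<lambda>w. om * w" "\<lambda>w. cnj om * w"])
      fix w :: complex assume "w \<in> {w. w ^ h = 1}"
      then have w: "w ^ h = 1" by simp
      have oo: "om * (cnj om * w) = w"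
        using unit[OF om] by (metis mult.assoc mult_1)
      then show "om * (cnj om * w) = w" "cnj om * (om * w) = w" by (auto simp: mult_ac)
      show "(om * (cnj om * w)) ^ i * cnj (om * (cnj om * w)) ^ j = w ^ i * cnj w ^ j"
        unfolding oo ..
      show "cnj om * w \<in> {w. w ^ h = 1}" "om * w \<in> {w. w ^ h = 1}"
        using om w by (auto simp: power_mult_distrib simp flip: complex_cnj_power)
    qed
    also have "\<dots> = (om ^ i * cnj om ^ j) * S"
      by (simp add: S_def sum_distrib_left power_mult_distrib mult_ac)
    finally have "S = (om ^ i * cnj om ^ j) * S" .
    moreover have "om ^ i * cnj om ^ j \<noteq> 1"
    proof
      assume "om ^ i * cnj om ^ j = 1"
      then have "om ^ i * (cnj om * om) ^ j = om ^ j" by (simp add: power_mult_distrib mult_ac)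
      then have "om ^ i = om ^ j" using unit[OF om] by (simp add: mult.commute)
      then have "om ^ (i mod h) = om ^ (j mod h)" using red[OF om] by metis
      then have "cis (2 * pi * real (i mod h) / real h) = cis (2 * pi * real (j mod h) / real h)"
        by (simp add: om_def DeMoivre mult_ac)
      moreover have "inj_on (\<lambda>k. cis (2 * pi * real k / real h)) {..<h}"
        using bij_betw_roots_unity[OF assms] bij_betw_def by blast
      ultimately have "i mod h = j mod h" using assms by (auto simp: inj_on_def)
      then show False using False by (simp add: cong_def)
    qed
    ultimately have "S = 0" by (metis mult_cancel_right1)
    then show ?thesis using False by (simp add: S_def)
  qed
qed

text \<open>
  Being congruent up to sign means having congruent squares; for exponents of the primitive root this is
  congruence modulo half the group order.
\<close>

lemma even_characters_orthogonality:
  fixes m n :: int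
  assumes "prime p" "p > 2"
  shows "(\<Sum>\<chi>\<in>even_characters p. \<chi> m * cnj (\<chi> n)) =
    (if \<not> int p dvd m \<and> ([m = n] (mod int p) \<or> [m = - n] (mod int p)) then of_nat ((p - 1) div 2) else 0)"
proof -
  let ?h = "(p - 1) div 2"
  obtain g where g: "coprime p g" "ord p g = p - 1"
    "\<And>a::int. \<not> int p dvd a \<Longrightarrow> \<exists>i. [a = int g ^ i] (mod int p)"
    using prime_primitive_root_int[OF assms(1)] by blast
  have h: "?h > 0" using assms(2) by linarith
  have "odd p" using assms prime_odd_nat by blast
  then have h2: "?h * 2 = p - 1" by presburger
  have dc: "dirichlet_character p \<chi>" if "\<chi> \<in> even_characters p" for \<chi>
    using that by (simp add: even_characters_def)
  have z: "\<chi> a = 0 \<longleftrightarrow> int p dvd a" if "\<chi> \<in> even_characters p" for \<chi> a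
    using dirichlet_character_prime_zero[OF assms(1) dc[OF that]] .
  show ?thesis
  proof (cases "int p dvd m \<or> int p dvd n")
    case True
    then have "(\<Sum>\<chi>\<in>even_characters p. \<chi> m * cnj (\<chi> n)) = 0"
      using z by (intro sum.neutral) auto
    moreover have "int p dvd m" if "[m = n] (mod int p) \<or> [m = - n] (mod int p)"
      using that True cong_dvd_iff dvd_minus_iff by metis
    ultimately show ?thesis by auto
  next
    case False
    obtain i where i: "[m = int g ^ i] (mod int p)" using g(3) False by blast
    obtain j where j: "[n = int g ^ j] (mod int p)" using g(3) False by blast
    have "(\<Sum>\<chi>\<in>even_characters p. \<chi> m * cnj (\<chi> n)) =
      (\<Sum>\<chi>\<in>even_characters p. \<chi> (int g) ^ i * cnj (\<chi> (int g)) ^ j)"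
      using i j dc by (intro sum.cong refl)
        (metis complex_cnj_power dirichlet_character_cong dirichlet_character_power)
    also have "\<dots> = (\<Sum>w | w ^ ?h = 1. w ^ i * cnj w ^ j)"
      by (rule sum.reindex_bij_betw[OF bij_betw_even_characters[OF assms g]])
    also have "\<dots> = (if [i = j] (mod ?h) then of_nat ?h else 0)"
      by (rule sum_roots_unity_twisted[OF h])
    finally have eq: "(\<Sum>\<chi>\<in>even_characters p. \<chi> m * cnj (\<chi> n)) =
      (if [i = j] (mod ?h) then of_nat ?h else 0)" .
    have ex: "[int g ^ a = int g ^ b] (mod int p) \<longleftrightarrow> [a = b] (mod (p - 1))" for a b
      using order_divides_expdiff[of p g a b] g(1,2) by (metis cong_int_iff of_nat_power)
    have "m\<^sup>2 - n\<^sup>2 = (m - n) * (m - (- n))" by (simp add: power2_eq_square algebra_simps)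
    then have "[m = n] (mod int p) \<or> [m = - n] (mod int p) \<longleftrightarrow> [m\<^sup>2 = n\<^sup>2] (mod int p)"
      using assms(1) by (simp only: cong_iff_dvd_diff prime_dvd_mult_iff prime_nat_int_transfer)
    also have "\<dots> \<longleftrightarrow> [int g ^ (2 * i) = int g ^ (2 * j)] (mod int p)"
      using cong_pow[OF i, of 2] cong_pow[OF j, of 2] unfolding power_mult[symmetric] mult.commute[of _ 2]
      by (meson cong_sym cong_trans)
    also have "\<dots> \<longleftrightarrow> [2 * i = 2 * j] (mod (2 * ?h))" using ex h2 by (simp add: mult.commute)
    also have "\<dots> \<longleftrightarrow> [i = j] (mod ?h)" by (simp add: cong_def mult_mod_right[symmetric])
    finally show ?thesis using eq False by auto
  qed
qed

section \<open>Moments of theta values and the nonvanishing count\<close>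

text \<open>
  By Fermat's little theorem a nonzero value of a character is a root of unity.
\<close>

lemma norm_dirichlet_character_le_1:
  assumes "prime p" "dirichlet_character p \<chi>"
  shows "norm (\<chi> a) \<le> 1"
proof (cases "int p dvd a")
  case True then show ?thesis using dirichlet_character_prime_zero[OF assms, of a] by simp
next
  case False
  define b where "b = nat (a mod int p)"
  have b: "[a = int b] (mod int p)"
    using prime_gt_0_nat[OF assms(1)] by (simp add: b_def cong_def)
  then have "\<not> p dvd b" using False by (metis cong_dvd_iff int_dvd_int_iff)
  then have "[b ^ (p - 1) = 1] (mod p)" by (rule fermat_theorem[OF assms(1)])
  then have "[int b ^ (p - 1) = 1] (mod int p)" by (metis cong_int_iff of_nat_1 of_nat_power)
  then have "[a ^ (p - 1) = 1] (mod int p)" using cong_pow[OF b] cong_trans by blast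
  then have "\<chi> a ^ (p - 1) = 1"
    using assms(2) by (metis dirichlet_character_1 dirichlet_character_cong dirichlet_character_power)
  moreover have "p - 1 \<noteq> 0" using prime_gt_1_nat[OF assms(1)] by simp
  ultimately show ?thesis using power_eq_1_iff by (metis order_refl)
qed

abbreviation sign_congruent :: "nat \<Rightarrow> nat \<Rightarrow> nat \<Rightarrow> bool" where
  "sign_congruent p m n \<equiv> \<not> p dvd m \<and> ([int m = int n] (mod int p) \<or> [int m = - int n] (mod int p))"

lemma even_characters_mean_product:
  fixes f g :: "nat \<Rightarrow> real" and p :: nat
  assumes "prime p" "p > 2" "finite I" "finite J"
  shows "(\<Sum>\<chi>\<in>even_characters p. (\<Sum>m\<in>I. \<chi> (int m) * of_real (f m)) * cnj (\<Sum>n\<in>J. \<chi> (int n) * of_real (g n)))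
    = of_real (real ((p - 1) div 2) * (\<Sum>m\<in>I. \<Sum>n\<in>J. if sign_congruent p m n then f m * g n else 0))"
proof -
  let ?G = "even_characters p"
  have "(\<Sum>\<chi>\<in>?G. (\<Sum>m\<in>I. \<chi> (int m) * of_real (f m)) * cnj (\<Sum>n\<in>J. \<chi> (int n) * of_real (g n)))
    = (\<Sum>\<chi>\<in>?G. \<Sum>m\<in>I. \<Sum>n\<in>J. of_real (f m * g n) * (\<chi> (int m) * cnj (\<chi> (int n))))"
    by (simp add: sum_product mult_ac cnj_sum)
  also have "\<dots> = (\<Sum>m\<in>I. \<Sum>\<chi>\<in>?G. \<Sum>n\<in>J. of_real (f m * g n) * (\<chi> (int m) * cnj (\<chi> (int n))))"
    by (rule sum.swap)
  also have "\<dots> = (\<Sum>m\<in>I. \<Sum>n\<in>J. of_real (f m * g n) * (\<Sum>\<chi>\<in>?G. \<chi> (int m) * cnj (\<chi> (int n))))"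
    unfolding sum_distrib_left by (intro sum.cong refl sum.swap)
  also have "\<dots> = (\<Sum>m\<in>I. \<Sum>n\<in>J. of_real (real ((p - 1) div 2) * (if sign_congruent p m n then f m * g n else 0)))"
    unfolding even_characters_orthogonality[OF assms(1,2)] by (intro sum.cong refl) simp
  finally show ?thesis by (simp add: sum_distrib_left of_real_sum)
qed

text \<open>
  The sum over even characters only retains pairs that are congruent up to sign; this is used with
  Gaussian coefficients for theta and with convolution coefficients for the mollifier.
\<close>

lemma even_characters_mean_square:
  fixes f :: "nat \<Rightarrow> real" and p :: nat
  assumes "prime p" "p > 2" "finite I"
  shows "(\<Sum>\<chi>\<in>even_characters p. (norm (\<Sum>m\<in>I. \<chi> (int m) * of_real (f m)))\<^sup>2)
    = real ((p - 1) div 2) * (\<Sum>m\<in>I. \<Sum>n\<in>I. if sign_congruent p m n then f m * f n else 0)"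
proof -
  have "complex_of_real (\<Sum>\<chi>\<in>even_characters p. (norm (\<Sum>m\<in>I. \<chi> (int m) * of_real (f m)))\<^sup>2) = 
     (\<Sum>\<chi>\<in>even_characters p. (\<Sum>m\<in>I. \<chi> (int m) * of_real (f m)) * cnj (\<Sum>m\<in>I. \<chi> (int m) * of_real (f m)))"
    by (simp only: of_real_sum complex_norm_square)
  also note even_characters_mean_product[OF assms assms(3)]
  finally show ?thesis by (simp only: of_real_eq_iff)
qed

abbreviation gaussian :: "nat \<Rightarrow> real \<Rightarrow> nat \<Rightarrow> real" where
  "gaussian p x n \<equiv> exp (- pi * real n ^ 2 * x / real p)"

text \<open>
  The quotients \<open>n div s\<close> are distinct along a residue class modulo \<open>s\<close>, and
  \<open>n\<^sup>2 \<ge> s\<^sup>2 * (n div s)\<^sup>2 \<ge> p * (n div s)\<close>, so the terms are dominated by those of a geometric series.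
  It is applied with \<open>s = p\<close> to a class modulo \<open>p\<close>, and with \<open>s\<close> near \<open>sqrt p\<close> to control complete
  sums.
\<close>

lemma gauss_sum_residue_class:
  fixes x :: real
  assumes "x > 0" "p > 0" "s > 0" "p \<le> s ^ 2" "finite F"
  shows "(\<Sum>n | n \<in> F \<and> n mod s = r. gaussian p x n) \<le> 1 / (1 - exp (- pi * x))"
proof -
  let ?F = "{n. n \<in> F \<and> n mod s = r}" and ?rho = "exp (- pi * x)"
  have rho: "0 < ?rho" "?rho < 1" using assms(1) by auto
  have inj: "inj_on (\<lambda>n. n div s) ?F"
    by (rule inj_onI) (metis (mono_tags) div_mult_mod_eq mem_Collect_eq)
  have le: "gaussian p x n \<le> ?rho ^ (n div s)" for n
  proof -
    let ?j = "n div s"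
    have "p * ?j \<le> s ^ 2 * ?j ^ 2"
      using assms(4) by (intro mult_mono) (auto simp: power2_eq_square)
    also have "\<dots> = (s * ?j) ^ 2" by (simp add: power_mult_distrib)
    also have "\<dots> \<le> n ^ 2" by (intro power_mono) auto
    finally have "p * ?j \<le> n ^ 2" .
    then have "real p * real ?j \<le> real n ^ 2" by (metis of_nat_le_iff of_nat_mult of_nat_power)
    then have "pi * x * real ?j \<le> pi * x * (real n ^ 2 / real p)"
      using assms(1,2) by (intro mult_left_mono) (auto simp: field_simps)
    then have "gaussian p x n \<le> exp (real ?j * (- pi * x))"
      by (simp add: mult_ac)
    then show ?thesis by (simp only: exp_of_nat_mult)
  qed
  have "(\<Sum>n\<in>?F. gaussian p x n) \<le> (\<Sum>n\<in>?F. ?rho ^ (n div s))"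
    by (intro sum_mono le)
  also have "\<dots> = (\<Sum>j\<in>(\<lambda>n. n div s) ` ?F. ?rho ^ j)" by (simp add: sum.reindex[OF inj])
  also have "\<dots> \<le> (\<Sum>j. ?rho ^ j)"
    using assms(5) rho by (intro sum_le_suminf summable_geometric) auto
  also have "\<dots> = 1 / (1 - ?rho)" using rho by (intro suminf_geometric) auto
  finally show ?thesis .
qed

lemma gauss_sum_finite:
  fixes x :: real
  assumes "x > 0" "p > 0" "s > 0" "p \<le> s ^ 2" "finite F"
  shows "(\<Sum>n\<in>F. gaussian p x n) \<le> real s / (1 - exp (- pi * x))"
proof -
  have "(\<Sum>n\<in>F. gaussian p x n) =
     (\<Sum>r\<in>{..<s}. \<Sum>n | n \<in> F \<and> n mod s = r. gaussian p x n)"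
    using assms by (intro sum.group[symmetric]) auto
  also have "\<dots> \<le> (\<Sum>r\<in>{..<s}. 1 / (1 - exp (- pi * x)))"
    by (intro sum_mono gauss_sum_residue_class assms)
  finally show ?thesis by simp
qed

lemma theta_partial_sums:
  fixes x :: real
  assumes "x > 0" "prime p" "dirichlet_character p \<chi>"
  shows "(\<lambda>N. \<Sum>n\<in>{1..N}. \<chi> (int n) * of_real (gaussian p x n)) \<longlonglongrightarrow> theta p x \<chi>"
proof -
  let ?e = "gaussian p x"
  have p: "p > 0" using prime_gt_0_nat[OF assms(2)] .
  have "summable (\<lambda>n. ?e (Suc n))"
  proof (rule summableI_nonneg_bounded)
    fix N
    have "(\<Sum>n<N. ?e (Suc n)) = (\<Sum>n\<in>Suc ` {..<N}. ?e n)" by (simp add: sum.reindex)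
    also have "\<dots> \<le> real p / (1 - exp (- pi * x))"
      by (rule gauss_sum_finite) (use assms p in \<open>auto simp: power2_eq_square\<close>)
    finally show "(\<Sum>n<N. ?e (Suc n)) \<le> real p / (1 - exp (- pi * x))" .
  qed auto
  then have "summable (\<lambda>n. \<chi> (int (Suc n)) * complex_of_real (?e (Suc n)))"
  proof (rule summable_comparison_test')
    show "norm (\<chi> (int (Suc n)) * complex_of_real (?e (Suc n))) \<le> ?e (Suc n)" if "n \<ge> 0" for n
      using norm_dirichlet_character_le_1[OF assms(2,3), of "int (Suc n)"]
      by (simp add: norm_mult mult_left_le_one_le del: of_nat_Suc)
  qed
  then have "(\<lambda>N. \<Sum>n<N. \<chi> (int (Suc n)) * complex_of_real (?e (Suc n))) \<longlonglongrightarrow> theta p x \<chi>"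
    unfolding theta_def by (rule summable_LIMSEQ)
  moreover have "(\<Sum>n<N. \<chi> (int (Suc n)) * complex_of_real (?e (Suc n))) =
     (\<Sum>n\<in>{1..N}. \<chi> (int n) * complex_of_real (?e n))" for N
    by (rule sum.reindex_bij_witness[of _ "\<lambda>n. n - 1" Suc]) auto
  ultimately show ?thesis by simp
qed

text \<open>
  For each \<open>m\<close> the \<open>n\<close> congruent to \<open>m\<close> or to \<open>- m\<close> lie in two residue classes modulo \<open>p\<close>, which
  contribute a bounded amount; the outer sum over \<open>m\<close> has size about \<open>s\<close>.  The estimate is proved for
  partial sums, uniformly in their length, and passes to the limit.
\<close>

lemma theta_mean_square_le:
  fixes x :: real
  assumes "x > 0" "prime p" "p > 2" "p \<le> s ^ 2"
  shows "(\<Sum>\<chi>\<in>even_characters p. (norm (theta p x \<chi>))\<^sup>2)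
    \<le> real ((p - 1) div 2) * (2 * real s / (1 - exp (- pi * x)) ^ 2)"
proof -
  let ?e = "gaussian p x" and ?h = "real ((p - 1) div 2)"
  define B where "B = 1 / (1 - exp (- pi * x))"
  have B: "B > 0" using assms(1) by (simp add: B_def)
  have s: "s > 0" using assms by (auto intro!: Nat.gr0I)
  let ?T = "\<lambda>N \<chi>. \<Sum>n\<in>{1..N}. \<chi> (int n) * complex_of_real (?e n)"
  have bound: "(\<Sum>\<chi>\<in>even_characters p. (norm (?T N \<chi>))\<^sup>2) \<le> ?h * (2 * real s * B\<^sup>2)" for N
  proof -
    let ?rel = "sign_congruent p"
    have inner: "(\<Sum>n\<in>{1..N}. if ?rel m n then ?e m * ?e n else 0) \<le> ?e m * (2 * B)" for m
    proof -
      let ?A = "{n. n \<in> {1..N} \<and> n mod p = m mod p}"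
      let ?A' = "{n. n \<in> {1..N} \<and> n mod p = nat ((- int m) mod int p)}"
      have sub: "n \<in> ?A \<union> ?A'" if "n \<in> {1..N}" "?rel m n" for n
        using that(2)
      proof (elim conjE disjE)
        assume "[int m = int n] (mod int p)"
        then have "[m = n] (mod p)" using cong_int_iff by blast
        then show ?thesis using that(1) by (simp add: cong_def)
      next
        assume "[int m = - int n] (mod int p)"
        then have "[- int m = int n] (mod int p)" by (metis cong_minus_minus_iff minus_minus)
        then have "(- int m) mod int p = int (n mod p)" by (simp add: cong_def zmod_int)
        then show ?thesis using that(1) by simp
      qed
      have "(\<Sum>n\<in>{1..N}. if ?rel m n then ?e m * ?e n else 0) = (\<Sum>n\<in>{n\<in>{1..N}. ?rel m n}. ?e m * ?e n)"
        by (rule sum.inter_filter[symmetric]) simp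
      also have "\<dots> \<le> (\<Sum>n\<in>?A \<union> ?A'. ?e m * ?e n)"
        using sub by (intro sum_mono2) auto
      also have "\<dots> \<le> (\<Sum>n\<in>?A. ?e m * ?e n) + (\<Sum>n\<in>?A'. ?e m * ?e n)"
        by (subst sum_Un) (auto intro!: sum_nonneg)
      also have "\<dots> = ?e m * ((\<Sum>n\<in>?A. ?e n) + (\<Sum>n\<in>?A'. ?e n))"
        by (simp add: sum_distrib_left distrib_left)
      also have "\<dots> \<le> ?e m * (B + B)" unfolding B_def
        using assms by (intro mult_left_mono add_mono gauss_sum_residue_class) (auto simp: power2_eq_square)
      finally show ?thesis by simp
    qed
    have "(\<Sum>\<chi>\<in>even_characters p. (norm (?T N \<chi>))\<^sup>2) =
       ?h * (\<Sum>m\<in>{1..N}. \<Sum>n\<in>{1..N}. if ?rel m n then ?e m * ?e n else 0)"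
      by (rule even_characters_mean_square) (use assms in auto)
    also have "\<dots> \<le> ?h * (\<Sum>m\<in>{1..N}. ?e m * (2 * B))"
      by (intro mult_left_mono sum_mono inner) auto
    also have "\<dots> = ?h * ((\<Sum>m\<in>{1..N}. ?e m) * (2 * B))" by (simp only: sum_distrib_right)
    also have "\<dots> \<le> ?h * ((real s / (1 - exp (- pi * x))) * (2 * B))"
      using assms B s by (intro mult_left_mono mult_right_mono gauss_sum_finite) auto
    also have "\<dots> = ?h * (2 * real s * B\<^sup>2)" by (simp add: B_def power2_eq_square)
    finally show ?thesis .
  qed
  have "(\<lambda>N. \<Sum>\<chi>\<in>even_characters p. (norm (?T N \<chi>))\<^sup>2) \<longlonglongrightarrow> (\<Sum>\<chi>\<in>even_characters p. (norm (theta p x \<chi>))\<^sup>2)"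
    by (intro tendsto_sum tendsto_power tendsto_norm theta_partial_sums)
       (use assms in \<open>auto simp: even_characters_def\<close>)
  then have "(\<Sum>\<chi>\<in>even_characters p. (norm (theta p x \<chi>))\<^sup>2) \<le> ?h * (2 * real s * B\<^sup>2)"
    by (rule LIMSEQ_le_const2) (use bound in auto)
  then show ?thesis by (simp add: B_def power_divide)
qed

text \<open>
  All off-diagonal terms are nonnegative and may be dropped, while \<open>3 * d\<^sup>2 \<le> p\<close> bounds each Gaussian
  factor on the diagonal below by \<open>exp (- pi * x / 3)\<close>.
\<close>

lemma theta_mollified_first_moment:
  fixes x :: real and c :: "nat \<Rightarrow> real"
  assumes "x > 0" "prime p" "p > 2" "3 * q ^ 2 \<le> p" "c \<in> unit_weights q"
  shows "real ((p - 1) div 2) * exp (- pi * x / 3) \<le>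
    norm (\<Sum>\<chi>\<in>even_characters p. theta p x \<chi> * cnj (\<Sum>d\<in>{1..q}. \<chi> (int d) * of_real (c d)))"
proof -
  let ?e = "gaussian p x" and ?h = "real ((p - 1) div 2)"
  let ?T = "\<lambda>N \<chi>. \<Sum>n\<in>{1..N}. \<chi> (int n) * complex_of_real (?e n)"
  let ?M = "\<lambda>\<chi>. \<Sum>d\<in>{1..q}. \<chi> (int d) * complex_of_real (c d)"
  let ?rel = "sign_congruent p"
  have c: "c d \<ge> 0" if "d \<in> {1..q}" for d using assms(5) that by (auto simp: unit_weights_def)
  have c1: "(\<Sum>d\<in>{1..q}. c d) = 1"
    using assms(5) c by (simp add: unit_weights_def)
  have p0: "p > 0" using assms by simp
  have bound: "?h * exp (- pi * x / 3) \<le> Re (\<Sum>\<chi>\<in>even_characters p. ?T N \<chi> * cnj (?M \<chi>))" if "N \<ge> q" for N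
  proof -
    have "?h * exp (- pi * x / 3) = ?h * (\<Sum>d\<in>{1..q}. exp (- pi * x / 3) * c d)"
      using c1 by (simp flip: sum_distrib_left)
    also have "\<dots> \<le> ?h * (\<Sum>d\<in>{1..q}. \<Sum>m\<in>{1..N}. if ?rel m d then ?e m * c d else 0)"
    proof (intro mult_left_mono sum_mono)
      fix d assume d: "d \<in> {1..q}"
      have "3 * d ^ 2 \<le> 3 * q ^ 2" using d by (intro mult_left_mono power_mono) auto
      then have d2: "3 * d ^ 2 \<le> p" using assms(4) by linarith
      have "d < p"
      proof -
        have "1 \<le> d" using d by simp
        moreover have "d \<le> d ^ 2" by (simp add: power2_nat_le_imp_le power2_eq_square)
        ultimately show ?thesis using d2 by linarith
      qed
      then have "\<not> p dvd d" using d by (auto dest: dvd_imp_le)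
      have "3 * real d ^ 2 \<le> real p" using d2 by (metis of_nat_le_iff of_nat_mult of_nat_numeral of_nat_power)
      then have "real d ^ 2 / real p \<le> 1 / 3" using p0 by (simp add: field_simps)
      then have "pi * x * (real d ^ 2 / real p) \<le> pi * x * (1 / 3)" using assms(1) by (intro mult_left_mono) auto
      then have "exp (- pi * x / 3) \<le> ?e d" by (simp add: mult_ac)
      then have "exp (- pi * x / 3) * c d \<le> ?e d * c d" using c[OF d] by (rule mult_right_mono)
      also have "\<dots> = (if ?rel d d then ?e d * c d else 0)" using \<open>\<not> p dvd d\<close> by simp
      also have "\<dots> \<le> (\<Sum>m\<in>{1..N}. if ?rel m d then ?e m * c d else 0)"
        using d that c[OF d] by (intro member_le_sum) auto
      finally show "exp (- pi * x / 3) * c d \<le> (\<Sum>m\<in>{1..N}. if ?rel m d then ?e m * c d else 0)" .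
    qed auto
    also have "(\<Sum>d\<in>{1..q}. \<Sum>m\<in>{1..N}. if ?rel m d then ?e m * c d else 0) =
        (\<Sum>m\<in>{1..N}. \<Sum>d\<in>{1..q}. if ?rel m d then ?e m * c d else 0)" by (rule sum.swap)
    also have "?h * \<dots> = Re (\<Sum>\<chi>\<in>even_characters p. ?T N \<chi> * cnj (?M \<chi>))"
      by (subst even_characters_mean_product) (use assms in auto)
    finally show ?thesis .
  qed
  have "(\<lambda>N. \<Sum>\<chi>\<in>even_characters p. ?T N \<chi> * cnj (?M \<chi>)) \<longlonglongrightarrow> (\<Sum>\<chi>\<in>even_characters p. theta p x \<chi> * cnj (?M \<chi>))"
    by (intro tendsto_sum tendsto_mult theta_partial_sums tendsto_const)
       (use assms in \<open>auto simp: even_characters_def\<close>)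
  then have "(\<lambda>N. Re (\<Sum>\<chi>\<in>even_characters p. ?T N \<chi> * cnj (?M \<chi>))) \<longlonglongrightarrow> Re (\<Sum>\<chi>\<in>even_characters p. theta p x \<chi> * cnj (?M \<chi>))"
    by (rule tendsto_Re)
  then have "?h * exp (- pi * x / 3) \<le> Re (\<Sum>\<chi>\<in>even_characters p. theta p x \<chi> * cnj (?M \<chi>))"
    by (rule LIMSEQ_le_const) (use bound in auto)
  also have "\<dots> \<le> norm (\<Sum>\<chi>\<in>even_characters p. theta p x \<chi> * cnj (?M \<chi>))" by (rule complex_Re_le_cmod)
  finally show ?thesis .
qed

text \<open>
  The multiplicative convolution square of the weights; the energy is the infimum of \<open>N\<^sup>2\<close> times its squared
  \<open>L\<^sup>2\<close> norm.
\<close>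

definition product_weights :: "nat \<Rightarrow> (nat \<Rightarrow> real) \<Rightarrow> nat \<Rightarrow> real" where
  "product_weights N c n = (\<Sum>(d, t)\<in>{(d, t). d \<in> {1..N} \<and> t \<in> {1..N} \<and> d * t = n}. c d * c t)"

text \<open>
  The square of the mollifier is a character sum of length \<open>q\<^sup>2 \<le> p / 3\<close>.  Two numbers in this range have
  sum and difference smaller than \<open>p\<close>, so being congruent up to sign means being equal, and no
  off-diagonal terms occur.
\<close>

lemma mollifier_fourth_moment:
  fixes c :: "nat \<Rightarrow> real"
  assumes "prime p" "p > 2" "3 * q ^ 2 \<le> p"
  shows "(\<Sum>\<chi>\<in>even_characters p. (norm (\<Sum>d\<in>{1..q}. \<chi> (int d) * of_real (c d))) ^ 4)
    = real ((p - 1) div 2) * (\<Sum>n=1..q^2. (product_weights q c n)\<^sup>2)"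
proof -
  let ?M = "\<lambda>\<chi>. \<Sum>d\<in>{1..q}. \<chi> (int d) * complex_of_real (c d)"
  let ?r = "product_weights q c"
  have sq: "(?M \<chi>)\<^sup>2 = (\<Sum>n\<in>{1..q^2}. \<chi> (int n) * complex_of_real (?r n))" if "\<chi> \<in> even_characters p" for \<chi>
  proof -
    have mult: "\<chi> (a * b) = \<chi> a * \<chi> b" for a b
      using that by (simp add: even_characters_def dirichlet_character_def)
    let ?S = "{1..q} \<times> {1..q}"
    have set: "{z. z \<in> ?S \<and> fst z * snd z = n} = {(d, t). d \<in> {1..q} \<and> t \<in> {1..q} \<and> d * t = n}" for n by auto
    have "(?M \<chi>)\<^sup>2 = (\<Sum>(d, t)\<in>?S. \<chi> (int (d * t)) * complex_of_real (c d * c t))"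
      by (simp add: power2_eq_square sum_product sum.cartesian_product mult mult_ac)
    also have "\<dots> = (\<Sum>n\<in>{1..q^2}. \<Sum>z | z \<in> ?S \<and> fst z * snd z = n. \<chi> (int (fst z * snd z)) * complex_of_real (c (fst z) * c (snd z)))"
    proof (subst sum.group)
      show "(\<lambda>z. fst z * snd z) ` ?S \<subseteq> {1..q^2}"
        by (auto simp: power2_eq_square intro: mult_le_mono)
    qed (auto simp: case_prod_beta)
    also have "\<dots> = (\<Sum>n\<in>{1..q^2}. \<chi> (int n) * complex_of_real (?r n))"
      by (intro sum.cong refl) (auto simp: product_weights_def set[symmetric] case_prod_beta sum_distrib_left intro!: sum.cong)
    finally show ?thesis .
  qed
  have "(\<Sum>\<chi>\<in>even_characters p. (norm (?M \<chi>)) ^ 4) =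
     (\<Sum>\<chi>\<in>even_characters p. (norm (\<Sum>n\<in>{1..q^2}. \<chi> (int n) * complex_of_real (?r n)))\<^sup>2)"
    by (intro sum.cong refl) (simp only: sq[symmetric] norm_power power_mult[symmetric], simp)
  also have "\<dots> = real ((p - 1) div 2) * (\<Sum>m\<in>{1..q^2}. \<Sum>n\<in>{1..q^2}. if sign_congruent p m n then ?r m * ?r n else 0)"
    by (rule even_characters_mean_square) (use assms in auto)
  also have "(\<Sum>m\<in>{1..q^2}. \<Sum>n\<in>{1..q^2}. if sign_congruent p m n then ?r m * ?r n else 0) =
     (\<Sum>m\<in>{1..q^2}. \<Sum>n\<in>{1..q^2}. if n = m then ?r m * ?r n else 0)"
  proof (intro sum.cong refl if_cong)
    fix m n assume mn: "m \<in> {1..q^2}" "n \<in> {1..q^2}"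
    have "m < p" "n < p" "m + n < p" "m > 0" using mn assms(2,3) by auto
    show "(sign_congruent p m n) = (n = m)"
    proof
      assume *: "sign_congruent p m n"
      have "\<not> [int m = - int n] (mod int p)"
      proof
        assume "[int m = - int n] (mod int p)"
        then have "int p dvd int (m + n)" by (simp add: cong_iff_dvd_diff)
        then have "p dvd m + n" by (simp only: int_dvd_int_iff)
        then show False using \<open>m + n < p\<close> \<open>m > 0\<close> by (auto dest: dvd_imp_le)
      qed
      then have "[m = n] (mod p)" using * cong_int_iff by blast
      then show "n = m" using \<open>m < p\<close> \<open>n < p\<close> by (simp add: cong_def)
    next
      assume "n = m"
      then show "sign_congruent p m n"
        using \<open>m < p\<close> \<open>m > 0\<close> by (auto dest: dvd_imp_le)
    qed
  qed
  also have "\<dots> = (\<Sum>m\<in>{1..q^2}. (?r m)\<^sup>2)" by (simp add: power2_eq_square)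
  finally show ?thesis .
qed

text \<open>
  The first moment is supported on characters with nonzero theta value.  The Cauchy-Schwarz inequality
  separates theta from the mollifier, and a second application separates the square of the mollifier
  from the indicator of the support.  The powers of \<open>p\<close> balance because the length \<open>s\<close> of the Gaussian
  is of order \<open>sqrt p\<close>.
\<close>

lemma theta_nonvanishing_count_weights:
  fixes x :: real
  assumes "x > 0" "prime p" "p > 2" "3 * q ^ 2 \<le> p" "c \<in> unit_weights q"
  shows "exp (- 4 * pi * x / 3) * (1 - exp (- pi * x)) ^ 4 / 48 \<le>
    real (card {\<chi> \<in> even_characters p. theta p x \<chi> \<noteq> 0}) * (\<Sum>n=1..q^2. (product_weights q c n)\<^sup>2)"
proof -
  let ?G = "even_characters p" and ?h = "real ((p - 1) div 2)"
  let ?G' = "{\<chi> \<in> ?G. theta p x \<chi> \<noteq> 0}"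
  let ?M = "\<lambda>\<chi>. \<Sum>d\<in>{1..q}. \<chi> (int d) * complex_of_real (c d)"
  let ?R = "\<Sum>n=1..q^2. (product_weights q c n)\<^sup>2"
  let ?N = "real (card ?G')"
  define b where "b = 1 - exp (- pi * x)"
  have b: "b > 0" using assms(1) by (simp add: b_def)
  \<comment> \<open>The range where the Gaussian is not yet small has length of order \<open>sqrt p\<close>.\<close>
  define s where "s = nat \<lceil>sqrt (real p)\<rceil>"
  have fin: "finite ?G" by (rule finite_even_characters[OF assms(2,3)])
  have sp: "sqrt (real p) \<le> real s" unfolding s_def by linarith
  have p1: "1 \<le> sqrt (real p)" using assms(3) by simp
  have s2: "real s \<le> 2 * sqrt (real p)" using p1 unfolding s_def by linarith
  have "real p = sqrt (real p) ^ 2" by simp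
  also have "\<dots> \<le> real s ^ 2" using sp by (intro power_mono) auto
  finally have "real p \<le> real (s ^ 2)" by simp
  then have ps: "p \<le> s ^ 2" by linarith
  have "odd p" using assms prime_odd_nat by blast
  then have "3 * ((p - 1) div 2) \<ge> p" using assms(3) by presburger
  then have hp: "3 * ?h \<ge> real p" by (metis of_nat_le_iff of_nat_mult of_nat_numeral)
  then have h0: "?h > 0" using assms(3) by linarith
  have R0: "?R \<ge> 0" by (intro sum_nonneg) auto
  have "?h * exp (- pi * x / 3) \<le> norm (\<Sum>\<chi>\<in>?G. theta p x \<chi> * cnj (?M \<chi>))"
    by (rule theta_mollified_first_moment) fact+
  also have "(\<Sum>\<chi>\<in>?G. theta p x \<chi> * cnj (?M \<chi>)) = (\<Sum>\<chi>\<in>?G'. theta p x \<chi> * cnj (?M \<chi>))"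
    using fin by (intro sum.mono_neutral_right) auto
  also have "norm \<dots> \<le> (\<Sum>\<chi>\<in>?G'. norm (theta p x \<chi>) * norm (?M \<chi>))"
    by (rule order_trans[OF norm_sum]) (simp only: norm_mult complex_mod_cnj order_refl)
  finally have 1: "?h * exp (- pi * x / 3) \<le> (\<Sum>\<chi>\<in>?G'. norm (theta p x \<chi>) * norm (?M \<chi>))" .
  have 2: "(\<Sum>\<chi>\<in>?G'. norm (theta p x \<chi>) * norm (?M \<chi>))\<^sup>2 \<le>
     (\<Sum>\<chi>\<in>?G'. (norm (theta p x \<chi>))\<^sup>2) * (\<Sum>\<chi>\<in>?G'. (norm (?M \<chi>))\<^sup>2)"
    by (rule Cauchy_Schwarz_ineq_sum)
  \<comment> \<open>The factor 1 is the indicator of the support, whose square sum is the count.\<close>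
  have 3: "(\<Sum>\<chi>\<in>?G'. 1 * (norm (?M \<chi>))\<^sup>2)\<^sup>2 \<le> (\<Sum>\<chi>\<in>?G'. 1\<^sup>2) * (\<Sum>\<chi>\<in>?G'. ((norm (?M \<chi>))\<^sup>2)\<^sup>2)"
    by (rule Cauchy_Schwarz_ineq_sum)
  have "(\<Sum>\<chi>\<in>?G'. ((norm (?M \<chi>))\<^sup>2)\<^sup>2) = (\<Sum>\<chi>\<in>?G'. (norm (?M \<chi>)) ^ 4)"
    by (simp flip: power_mult)
  also have "\<dots> \<le> (\<Sum>\<chi>\<in>?G. (norm (?M \<chi>)) ^ 4)"
    using fin by (intro sum_mono2) auto
  also have "\<dots> = ?h * ?R" by (rule mollifier_fourth_moment) fact+
  finally have 4: "(\<Sum>\<chi>\<in>?G'. ((norm (?M \<chi>))\<^sup>2)\<^sup>2) \<le> ?h * ?R" .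
  have 5: "(\<Sum>\<chi>\<in>?G'. (norm (theta p x \<chi>))\<^sup>2) \<le> ?h * (2 * real s / b ^ 2)"
    unfolding b_def using fin
    by (intro order_trans[OF _ theta_mean_square_le[OF assms(1-3) ps]] sum_mono2) auto
  have "(?h * exp (- pi * x / 3)) ^ 4 = ((?h * exp (- pi * x / 3))\<^sup>2)\<^sup>2" by (simp flip: power_mult)
  also have "\<dots> \<le> ((\<Sum>\<chi>\<in>?G'. norm (theta p x \<chi>) * norm (?M \<chi>))\<^sup>2)\<^sup>2"
    using 1 by (intro power_mono) auto
  also have "\<dots> \<le> ((\<Sum>\<chi>\<in>?G'. (norm (theta p x \<chi>))\<^sup>2) * (\<Sum>\<chi>\<in>?G'. (norm (?M \<chi>))\<^sup>2))\<^sup>2"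
    using 2 by (intro power_mono) auto
  also have "\<dots> = (\<Sum>\<chi>\<in>?G'. (norm (theta p x \<chi>))\<^sup>2)\<^sup>2 * (\<Sum>\<chi>\<in>?G'. 1 * (norm (?M \<chi>))\<^sup>2)\<^sup>2"
    by (simp add: power_mult_distrib)
  also have "\<dots> \<le> (?h * (2 * real s / b ^ 2))\<^sup>2 * (?N * (?h * ?R))"
  proof (intro mult_mono power_mono 5)
    have "(\<Sum>\<chi>\<in>?G'. 1\<^sup>2) * (\<Sum>\<chi>\<in>?G'. ((norm (?M \<chi>))\<^sup>2)\<^sup>2) \<le> ?N * (?h * ?R)"
      using mult_left_mono[OF 4, of ?N] by simp
    then show "(\<Sum>\<chi>\<in>?G'. 1 * (norm (?M \<chi>))\<^sup>2)\<^sup>2 \<le> ?N * (?h * ?R)" using 3 by (rule order_trans[rotated])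
  qed (auto intro!: sum_nonneg)
  also have "\<dots> = ?h ^ 3 * (4 * (real s)\<^sup>2 / b ^ 4 * (?N * ?R))"
    by (simp add: power_mult_distrib power_divide power3_eq_cube power2_eq_square algebra_simps power4_eq_xxxx)
  finally have "?h ^ 3 * (?h * exp (- pi * x / 3) ^ 4) \<le> ?h ^ 3 * (4 * (real s)\<^sup>2 / b ^ 4 * (?N * ?R))"
    by (simp add: power_mult_distrib power3_eq_cube power4_eq_xxxx mult_ac)
  then have "?h * exp (- pi * x / 3) ^ 4 \<le> 4 * (real s)\<^sup>2 / b ^ 4 * (?N * ?R)"
    by (rule mult_left_le_imp_le) (use h0 in simp)
  also have "\<dots> \<le> 4 * (2 * sqrt (real p))\<^sup>2 / b ^ 4 * (?N * ?R)"
    using s2 b R0 by (intro mult_right_mono divide_right_mono mult_left_mono power_mono) auto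
  also have "\<dots> = real p * (16 / b ^ 4 * (?N * ?R))" by (simp add: power_mult_distrib)
  finally have "3 * (?h * exp (- pi * x / 3) ^ 4) \<le> 3 * (real p * (16 / b ^ 4 * (?N * ?R)))"
    by (rule mult_left_mono) simp
  also have "\<dots> = real p * (48 / b ^ 4 * (?N * ?R))" by simp
  finally have "3 * ?h * exp (- pi * x / 3) ^ 4 \<le> real p * (48 / b ^ 4 * (?N * ?R))"
    by (simp only: mult.assoc)
  moreover have "real p * exp (- pi * x / 3) ^ 4 \<le> 3 * ?h * exp (- pi * x / 3) ^ 4"
    using hp by (intro mult_right_mono) auto
  ultimately have "real p * exp (- pi * x / 3) ^ 4 \<le> real p * (48 / b ^ 4 * (?N * ?R))"
    by linarith
  then have "exp (- pi * x / 3) ^ 4 \<le> 48 / b ^ 4 * (?N * ?R)"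
    by (rule mult_left_le_imp_le) (use assms(3) in simp)
  moreover have "exp (- pi * x / 3) ^ 4 = exp (- 4 * pi * x / 3)" by (simp flip: exp_of_nat_mult)
  ultimately have "exp (- 4 * pi * x / 3) \<le> 48 / b ^ 4 * (?N * ?R)" by simp
  then have "exp (- 4 * pi * x / 3) * b ^ 4 \<le> 48 * (?N * ?R)" using b by (simp add: field_simps)
  then show ?thesis unfolding b_def by simp
qed

lemma unit_weights_nonempty: "q \<ge> 1 \<Longrightarrow> unit_weights q \<noteq> {}"
proof -
  assume "q \<ge> 1"
  then have "(\<lambda>n. if n = 1 then 1 else 0) \<in> unit_weights q"
    by (simp add: unit_weights_def if_distrib[of abs] cong: if_cong)
  then show ?thesis by blast
qed

text \<open>
  As \<open>q\<^sup>2\<close> is comparable with \<open>p\<close>, multiplying the inequality for a single weight vector by \<open>q\<^sup>2\<close> gives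
  the quantity whose infimum is the energy.
\<close>

lemma theta_nonvanishing_count_energy:
  fixes x :: real
  assumes "x > 0" "prime p" "p > 2" "3 * q ^ 2 \<le> p" "p \<le> 12 * q ^ 2"
  shows "exp (- 4 * pi * x / 3) * (1 - exp (- pi * x)) ^ 4 / 576 * real p \<le>
    real (card {\<chi> \<in> even_characters p. theta p x \<chi> \<noteq> 0}) * mult_energy q"
proof -
  let ?N = "real (card {\<chi> \<in> even_characters p. theta p x \<chi> \<noteq> 0})"
  define k where "k = exp (- 4 * pi * x / 3) * (1 - exp (- pi * x)) ^ 4"
  have k: "k > 0" using assms(1) by (simp add: k_def)
  have q: "q \<ge> 1" using assms(3,5) by (auto intro!: Nat.gr0I simp: Suc_le_eq)
  obtain c0 where c0: "c0 \<in> unit_weights q" using unit_weights_nonempty[OF q] by blast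
  have pq: "real p \<le> 12 * (real q)\<^sup>2" using assms(5) by (metis of_nat_le_iff of_nat_mult of_nat_numeral of_nat_power)
  have w: "k / 48 \<le> ?N * (\<Sum>n=1..q^2. (product_weights q c n)\<^sup>2)" if "c \<in> unit_weights q" for c
    unfolding k_def using theta_nonvanishing_count_weights[OF assms(1-4) that] .
  have N: "?N > 0" 
  proof (rule ccontr)
    assume "\<not> ?N > 0" then have "?N = 0" by simp
    then show False using w[OF c0] k by simp
  qed
  have "k / 576 * real p / ?N \<le> mult_energy q"
    unfolding mult_energy_def
  proof (rule cINF_greatest)
    show "unit_weights q \<noteq> {}" using c0 by blast
    fix c assume "c \<in> unit_weights q"
    from w[OF this] have "k / 48 / ?N \<le> (\<Sum>n=1..q^2. (product_weights q c n)\<^sup>2)"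
      using N by (simp add: field_simps)
    then have "(real q)\<^sup>2 * (k / 48 / ?N) \<le> (real q)\<^sup>2 * (\<Sum>n=1..q^2. (product_weights q c n)\<^sup>2)"
      by (intro mult_left_mono) auto
    moreover have "real p / 12 * (k / 48 / ?N) \<le> (real q)\<^sup>2 * (k / 48 / ?N)"
      using pq k N by (intro mult_right_mono) auto
    ultimately have "k / 576 * real p / ?N \<le> (real q)\<^sup>2 * (\<Sum>n=1..q^2. (product_weights q c n)\<^sup>2)"
      by (simp add: field_simps)
    then show "k / 576 * real p / ?N \<le> real q ^ 2 *
     (\<Sum>n=1..q^2. (\<Sum>(d, t)\<in>{(d, t). d \<in> {1..q} \<and> t \<in> {1..q} \<and> d * t = n}. c d * c t) ^ 2)"
      by (simp only: product_weights_def)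
  qed
  then show ?thesis using N unfolding k_def[symmetric] by (simp add: field_simps)
qed

section \<open>Estimates of Chebyshev and Mertens\<close>

lemma prod_coprime_dvd_nat:
  fixes n :: nat
  assumes "finite A" "\<And>p. p \<in> A \<Longrightarrow> p dvd n"
    "\<And>p q. p \<in> A \<Longrightarrow> q \<in> A \<Longrightarrow> p \<noteq> q \<Longrightarrow> coprime p q"
  shows "(\<Prod>p\<in>A. p) dvd n"
  using assms
proof (induction A rule: finite_induct)
  case (insert p A)
  have "coprime p (\<Prod>p\<in>A. p)" using insert by (intro prod_coprime_right) (metis insertCI)
  then show ?case using insert by (simp add: divides_mult)
qed simp

text \<open>
  Erdos's induction: the primes in \<open>{m + 2..2 * m + 1}\<close> all divide the binomial coefficient
  \<open>2 * m + 1\<close> over \<open>m\<close>, which is at most \<open>4 ^ m\<close>.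
\<close>

lemma primorial_le:
  "(\<Prod>p | prime p \<and> p \<le> n. p) \<le> (4::nat) ^ n"
proof (induction n rule: less_induct)
  case (less n)
  have fin: "finite {p. prime p \<and> p \<le> m}" for m :: nat by simp
  consider "n \<le> 1" | "n = 2" | "n > 2" "even n" | m where "n = 2 * m + 1" "m \<ge> 1"
  proof (cases "even n")
    case True then show ?thesis using that(1-3) by linarith
  next
    case False
    then have "n = 2 * (n div 2) + 1" by presburger
    then show ?thesis using that(1) that(4)[of "n div 2"] by linarith
  qed
  then show ?case
  proof cases
    case 1
    have "{p. prime p \<and> p \<le> n} = {}" using 1 by (auto dest: prime_ge_2_nat)
    then show ?thesis by (simp only: prod.empty one_le_power)
  next
    case 2
    have "{p. prime p \<and> p \<le> n} = {2}" using 2 by (auto dest: prime_ge_2_nat)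
    then show ?thesis using 2 by simp
  next
    case 3
    have "{p. prime p \<and> p \<le> n} = {p. prime p \<and> p \<le> n - 1}"
    proof (intro Collect_cong conj_cong refl)
      fix p :: nat assume "prime p"
      then have "p \<noteq> n" using 3 by (metis prime_odd_nat)
      then show "(p \<le> n) = (p \<le> n - 1)" by linarith
    qed
    moreover have "(\<Prod>p | prime p \<and> p \<le> n - 1. p) \<le> 4 ^ (n - 1)" using less[of "n - 1"] 3 by simp
    moreover have "(4::nat) ^ (n - 1) \<le> 4 ^ n" by (intro power_increasing) auto
    ultimately show ?thesis by (metis order_trans)
  next
    case (4 m)
    let ?A = "{p. prime p \<and> m + 1 < p \<and> p \<le> n}"
    have split: "{p. prime p \<and> p \<le> n} = {p. prime p \<and> p \<le> m + 1} \<union> ?A" using 4 by auto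
    have "(\<Prod>p\<in>?A. p) dvd (n choose m)"
    proof (rule prod_coprime_dvd_nat)
      fix p assume p: "p \<in> ?A"
      have "fact m * fact (n - m) * (n choose m) = (fact n :: nat)"
        using 4 by (intro binomial_fact_lemma) simp
      moreover have "p dvd (fact n :: nat)" using p by (simp add: prime_dvd_fact_iff)
      ultimately have "p dvd fact m * fact (n - m) * (n choose m)" by simp
      moreover have "\<not> p \<le> m" "\<not> p \<le> n - m" using p 4 by auto
      then have "\<not> p dvd (fact m :: nat)" "\<not> p dvd (fact (n - m) :: nat)"
        using p by (simp_all only: prime_dvd_fact_iff mem_Collect_eq not_False_eq_True)
      ultimately show "p dvd (n choose m)" using p by (simp add: prime_dvd_mult_iff)
    qed (auto intro: primes_coprime)
    then have "(\<Prod>p\<in>?A. p) \<le> (n choose m)" using 4 by (intro dvd_imp_le) auto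
    moreover have "(n choose m) \<le> 4 ^ m"
    proof -
      have "(n choose m) + (n choose (m + 1)) \<le> (\<Sum>k\<le>n. n choose k)"
      proof -
        have "(n choose m) + (n choose (m + 1)) = (\<Sum>k\<in>{m, m + 1}. n choose k)" by simp
        also have "\<dots> \<le> (\<Sum>k\<le>n. n choose k)" using 4 by (intro sum_mono2) auto
        finally show ?thesis .
      qed
      also have "\<dots> = 2 ^ n" by (rule choose_row_sum)
      also have "\<dots> = 2 * 4 ^ m" using 4 by (simp add: power_mult)
      finally have "(n choose m) + (n choose (m + 1)) \<le> 2 * 4 ^ m" .
      moreover have "(n choose (m + 1)) = (n choose m)"
        using binomial_symmetric[of "m + 1" n] 4 by simp
      ultimately show ?thesis by simp
    qed
    ultimately have "(\<Prod>p\<in>?A. p) \<le> 4 ^ m" by linarith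
    moreover have "(\<Prod>p | prime p \<and> p \<le> m + 1. p) \<le> 4 ^ (m + 1)" using less[of "m + 1"] 4 by simp
    ultimately have "(\<Prod>p | prime p \<and> p \<le> m + 1. p) * (\<Prod>p\<in>?A. p) \<le> 4 ^ (m + 1) * 4 ^ m"
      by (intro mult_mono) auto
    also have "4 ^ (m + 1) * 4 ^ m = (4::nat) ^ n" using 4 by (simp flip: power_add)
    also have "(\<Prod>p | prime p \<and> p \<le> m + 1. p) * (\<Prod>p\<in>?A. p) = (\<Prod>p | prime p \<and> p \<le> n. p)"
      unfolding split by (rule prod.union_disjoint[symmetric]) auto
    finally show ?thesis .
  qed
qed

lemma chebyshev_theta_le:
  "(\<Sum>p | prime p \<and> p \<le> n. ln (real p)) \<le> real n * ln 4"
proof -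
  have "(\<Sum>p | prime p \<and> p \<le> n. ln (real p)) = ln (\<Prod>p | prime p \<and> p \<le> n. real p)"
    by (rule ln_prod[symmetric]) (auto dest: prime_gt_0_nat)
  also have "(\<Prod>p | prime p \<and> p \<le> n. real p) = real (\<Prod>p | prime p \<and> p \<le> n. p)" by simp
  also have "ln \<dots> \<le> ln (real (4 ^ n))"
    by (intro ln_mono) (use primorial_le[of n] in \<open>auto intro!: prod_pos dest: prime_gt_0_nat simp del: of_nat_prod of_nat_power\<close>)
  also have "\<dots> = real n * ln 4" by (simp add: ln_realpow)
  finally show ?thesis .
qed

lemma ln_le_2_sqrt: "x > 0 \<Longrightarrow> ln x \<le> 2 * sqrt x"
  using ln_le_minus_one[of "sqrt x"] by (simp add: ln_sqrt)

text \<open>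
  Primes above \<open>sqrt y\<close> weigh at least \<open>ln y / 2\<close> each in Chebyshev's theta function, and there are at
  most \<open>sqrt y\<close> others.
\<close>

lemma prime_counting_upper:
  fixes y :: real
  assumes "y \<ge> 1"
  shows "real (card {p. prime p \<and> real p \<le> y}) * ln y \<le> 7 * y"
proof -
  let ?P = "{p. prime p \<and> real p \<le> y}" and ?Q = "{p. prime p \<and> real p \<le> sqrt y}"
  have P: "?P = {p. prime p \<and> p \<le> nat \<lfloor>y\<rfloor>}" using assms by (auto simp: le_nat_floor le_floor_iff nat_le_iff) linarith
  have Q: "?Q \<subseteq> {1..nat \<lfloor>sqrt y\<rfloor>}" by (auto simp: le_nat_floor dest: prime_gt_0_nat Suc_leI)
  have fin: "finite ?P" unfolding P by simp
  have "real (card ?Q) \<le> real (card {1..nat \<lfloor>sqrt y\<rfloor>})" using card_mono[OF _ Q] by simp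
  also have "\<dots> \<le> sqrt y" using assms by simp
  finally have cQ: "real (card ?Q) \<le> sqrt y" .
  have sub: "?Q \<subseteq> ?P" 
  proof -
    have "sqrt y \<le> y" using assms by (intro real_le_lsqrt) (auto simp: power2_eq_square)
    then show ?thesis by auto
  qed
  have "real (card (?P - ?Q)) * (ln y / 2) \<le> (\<Sum>p\<in>?P - ?Q. ln (real p))"
  proof -
    have "(\<Sum>p\<in>?P - ?Q. ln y / 2) \<le> (\<Sum>p\<in>?P - ?Q. ln (real p))"
    proof (rule sum_mono)
      fix p assume "p \<in> ?P - ?Q"
      then have "sqrt y < real p" by auto
      moreover have "0 < sqrt y" using assms by simp
      ultimately have "ln (sqrt y) \<le> ln (real p)" by (intro ln_mono) auto
      then show "ln y / 2 \<le> ln (real p)" using assms by (simp add: ln_sqrt)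
    qed
    then show ?thesis by simp
  qed
  also have "\<dots> \<le> (\<Sum>p\<in>?P. ln (real p))"
    using fin by (intro sum_mono2) (auto dest: prime_ge_1_nat)
  also have "\<dots> \<le> real (nat \<lfloor>y\<rfloor>) * ln 4" unfolding P by (rule chebyshev_theta_le)
  also have "\<dots> \<le> y * ln 4" using assms by (intro mult_right_mono) auto
  finally have 1: "real (card (?P - ?Q)) * ln y \<le> y * (2 * ln 4)" by simp
  have "ln (4::real) \<le> 2" using ln_realpow[of 2 2] ln_2_less_1 by simp
  then have "y * (2 * ln 4) \<le> y * 4" using assms by (intro mult_left_mono) auto
  with 1 have 1: "real (card (?P - ?Q)) * ln y \<le> 4 * y" by simp
  have "real (card ?Q) * ln y \<le> sqrt y * (2 * sqrt y)"
    using cQ assms by (intro mult_mono ln_le_2_sqrt) auto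
  also have "\<dots> = 2 * y" using assms by simp
  finally have 2: "real (card ?Q) * ln y \<le> 2 * y" .
  have "card ?P = card (?P - ?Q) + card ?Q"
    using card_Diff_subset[OF finite_subset[OF sub fin] sub] card_mono[OF fin sub] by simp
  then have "real (card ?P) * ln y = real (card (?P - ?Q)) * ln y + real (card ?Q) * ln y"
    by (simp add: distrib_right)
  then show ?thesis using 1 2 assms by linarith
qed

lemma ln_fact_lower: "n \<ge> 1 \<Longrightarrow> real n * ln (real n) - real n \<le> ln (fact n)"
proof (induction n rule: nat_induct_at_least)
  case (Suc n)
  have "ln (real (Suc n)) - ln (real n) = ln (1 + 1 / real n)"
    using Suc ln_div[of "real (Suc n)" "real n"] by (simp add: add_divide_distrib add.commute)
  also have "\<dots> \<le> 1 / real n" using Suc by (intro ln_add_one_self_le_self) auto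
  finally have "real n * (ln (real (Suc n)) - ln (real n)) \<le> 1"
    using Suc by (simp add: field_simps)
  moreover have "ln (fact (Suc n) :: real) = ln (real (Suc n)) + ln (fact n)"
    by (simp add: ln_mult del: of_nat_Suc)
  ultimately show ?case using Suc by (simp add: algebra_simps)
qed simp

lemma ln_fact_upper: "n \<ge> 1 \<Longrightarrow> ln (fact n) \<le> real n * ln (real n)"
proof -
  assume "n \<ge> 1"
  have "(fact n :: real) \<le> real n ^ n" using fact_le_power[of n, where 'a = real] by simp
  then have "ln (fact n :: real) \<le> ln (real n ^ n)" by (intro ln_mono) auto
  then show ?thesis using \<open>n \<ge> 1\<close> by (simp add: ln_realpow)
qed

lemma ln_fact_prime_multiplicity:
  "ln (fact n :: real) = (\<Sum>p | prime p \<and> p \<le> n. real (multiplicity p (fact n :: nat)) * ln (real p))"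
proof -
  have pf: "prime_factors (fact n :: nat) = {p. prime p \<and> p \<le> n}"
    by (auto simp: in_prime_factors_iff prime_dvd_fact_iff)
  have "(fact n :: nat) = (\<Prod>p\<in>prime_factors (fact n). p ^ multiplicity p (fact n))"
    by (rule prime_factorization_nat) simp
  then have "(fact n :: real) = (\<Prod>p | prime p \<and> p \<le> n. real p ^ multiplicity p (fact n :: nat))"
    unfolding pf by (metis (no_types, lifting) of_nat_fact of_nat_power of_nat_prod prod.cong)
  also have "ln \<dots> = (\<Sum>p | prime p \<and> p \<le> n. ln (real p ^ multiplicity p (fact n :: nat)))"
    by (rule ln_prod) (auto dest: prime_gt_0_nat)
  finally show ?thesis by (auto simp: ln_realpow dest: prime_gt_0_nat intro!: sum.cong)
qed

lemma multiplicity_fact_sum: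
  fixes p :: nat
  assumes "prime p"
  shows "multiplicity p (fact n :: nat) = (\<Sum>m=1..n. multiplicity p m)"
proof (induction n)
  case (Suc n)
  have "multiplicity p (fact (Suc n) :: nat) = multiplicity p (Suc n) + multiplicity p (fact n :: nat)"
    using assms by (simp only: fact_Suc of_nat_id, subst prime_elem_multiplicity_mult_distrib) auto
  then show ?case using Suc by simp
qed simp

lemma card_multiples: 
  assumes "d > 0" shows "card {m\<in>{1..n}. d dvd m} = n div (d::nat)"
proof -
  have "{m\<in>{1..n}. d dvd m} = (\<lambda>k. d * k) ` {1..n div d}"
    using assms by (auto simp: div_greater_zero_iff less_eq_div_iff_mult_less_eq mult.commute elim!: dvdE intro!: image_eqI)
  then show ?thesis using assms by (simp add: card_image inj_on_def)
qed

lemma multiplicity_fact_lower: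
  fixes p :: nat
  assumes "prime p"
  shows "real n / real p - 1 \<le> real (multiplicity p (fact n :: nat))"
proof -
  have p: "p > 0" using assms prime_gt_0_nat by blast
  have "n div p = (\<Sum>m=1..n. if p dvd m then 1 else 0)"
    using card_multiples[OF p, of n] by (simp add: sum.If_cases Int_def)
  also have "\<dots> \<le> (\<Sum>m=1..n. multiplicity p m)"
    using assms by (intro sum_mono) (auto simp: prime_multiplicity_gt_zero_iff Suc_le_eq)
  finally have "n div p \<le> multiplicity p (fact n :: nat)" by (simp add: multiplicity_fact_sum[OF assms])
  moreover have "real n / real p - 1 \<le> real (n div p)"
  proof -
    have "n < p * (n div p + 1)" using p by (metis Suc_eq_plus1 dividend_less_times_div mult_Suc_right add.commute)
    then have "real n < real (p * (n div p + 1))" by (simp only: of_nat_less_iff)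
    then show ?thesis using p by (simp add: field_simps)
  qed
  ultimately show ?thesis by (smt (verit) of_nat_mono)
qed

text \<open>
  Legendre's formula: the exponent is the sum of \<open>n div p ^ j\<close> over \<open>j \<ge> 1\<close>, a sum dominated by a
  geometric series.
\<close>

lemma multiplicity_fact_upper:
  fixes p :: nat
  assumes "prime p"
  shows "real (multiplicity p (fact n :: nat)) \<le> real n / (real p - 1)"
proof -
  have p: "p \<ge> 2" using assms prime_ge_2_nat by blast
  have "multiplicity p m = (\<Sum>j=1..n. if p ^ j dvd m then 1 else 0)" if "m \<in> {1..n}" for m
  proof -
    have "{j\<in>{1..n}. p ^ j dvd m} = {1..multiplicity p m}"
    proof -
      have iff: "p ^ j dvd m \<longleftrightarrow> j \<le> multiplicity p m" for j
        using that assms by (intro power_dvd_iff_le_multiplicity) (auto dest: not_prime_unit)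
      have "j \<le> n" if "p ^ j dvd m" for j
      proof -
        have "j < 2 ^ j" by (rule less_exp)
        also have "(2::nat) ^ j \<le> p ^ j" using p by (intro power_mono) auto
        also have "\<dots> \<le> m" using that \<open>m \<in> {1..n}\<close> by (intro dvd_imp_le) auto
        also have "\<dots> \<le> n" using \<open>m \<in> {1..n}\<close> by simp
        finally show ?thesis by simp
      qed
      then have "j \<in> {j\<in>{1..n}. p ^ j dvd m} \<longleftrightarrow> j \<in> {1..multiplicity p m}" for j
        unfolding iff[symmetric] mem_Collect_eq atLeastAtMost_iff by blast
      then show ?thesis by blast
    qed
    then have "card {j\<in>{1..n}. p ^ j dvd m} = multiplicity p m" by simp
    then show ?thesis by (simp add: sum.If_cases Int_def)
  qed
  then have "multiplicity p (fact n :: nat) = (\<Sum>m=1..n. \<Sum>j=1..n. if p ^ j dvd m then 1 else 0)"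
    by (simp add: multiplicity_fact_sum[OF assms])
  also have "\<dots> = (\<Sum>j=1..n. \<Sum>m=1..n. if p ^ j dvd m then 1 else 0)" by (rule sum.swap)
  also have "\<dots> = (\<Sum>j=1..n. n div p ^ j)"
  proof (intro sum.cong refl)
    fix j
    have "p ^ j > 0" using p by simp
    from card_multiples[OF this, of n] show "(\<Sum>m=1..n. if p ^ j dvd m then 1 else 0) = n div p ^ j"
      by (simp add: sum.If_cases Int_def)
  qed
  finally have "real (multiplicity p (fact n :: nat)) = (\<Sum>j=1..n. real (n div p ^ j))" by simp
  also have "\<dots> \<le> (\<Sum>j=1..n. real n * (1 / real p) ^ j)"
  proof (intro sum_mono)
    fix j show "real (n div p ^ j) \<le> real n * (1 / real p) ^ j"
      using of_nat_div_le_of_nat[of n "p ^ j", where 'a = real] by (simp add: power_one_over)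
  qed
  also have "\<dots> = real n * (\<Sum>j=1..n. (1 / real p) ^ j)" by (simp add: sum_distrib_left)
  also have "\<dots> \<le> real n * (1 / (real p - 1))"
  proof (intro mult_left_mono)
    define r where "r = 1 / real p"
    have r: "0 < r" "r < 1" using p by (auto simp: r_def)
    have "(\<Sum>j=1..n. r ^ j) * (1 - r) = r - r ^ Suc n"
    proof (induction n)
      case (Suc n)
      have "(\<Sum>j=1..Suc n. r ^ j) * (1 - r) = (\<Sum>j=1..n. r ^ j) * (1 - r) + r ^ Suc n * (1 - r)"
        by (simp add: distrib_right)
      also have "\<dots> = r - r ^ Suc (Suc n)" unfolding Suc by (simp add: algebra_simps)
      finally show ?case .
    qed simp
    also have "\<dots> \<le> r" using r by simp
    finally have "(\<Sum>j=1..n. (1 / real p) ^ j) \<le> (1 / real p) / (1 - 1 / real p)"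
      using r by (simp only: r_def pos_le_divide_eq diff_gt_0_iff_gt)
    also have "\<dots> = 1 / (real p - 1)" using p by (simp add: field_simps)
    finally show "(\<Sum>j=1..n. (1 / real p) ^ j) \<le> 1 / (real p - 1)" .
  qed auto
  finally show ?thesis by simp
qed

text \<open>
  The bound telescopes: the general term is at most the decrement of
  \<open>(ln m + 2) / m\<close>, because \<open>m * (ln m - ln (m - 1)) \<le> m / (m - 1) \<le> 2\<close>.  It controls the
  contribution of proper prime powers to \<open>ln (fact n)\<close>.
\<close>

lemma sum_ln_over_square_le:
  "n \<ge> 1 \<Longrightarrow> (\<Sum>m=2..n. ln (real m) / (real m * (real m - 1))) \<le> 2 - (ln (real n) + 2) / real n"
proof (induction n rule: nat_induct_at_least)
  case (Suc n)
  define y where "y = real n"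
  have y: "y \<ge> 1" using Suc(1) by (simp add: y_def)
  have "ln (y + 1) - ln y = ln (1 + 1 / y)"
    using y ln_div[of "y + 1" y] by (simp add: add_divide_distrib)
  also have "\<dots> \<le> 1 / y" using y by (intro ln_add_one_self_le_self) auto
  finally have "(y + 1) * (ln (y + 1) - ln y) \<le> (y + 1) * (1 / y)" using y by (intro mult_left_mono) auto
  also have "\<dots> \<le> 2" using y by (simp add: field_simps)
  finally have "ln (y + 1) / ((y + 1) * y) \<le> (ln (y + 1) + (2 - (y + 1) * (ln (y + 1) - ln y))) / ((y + 1) * y)"
    using y by (intro divide_right_mono) auto
  also have "\<dots> = (ln y + 2) / y - (ln (y + 1) + 2) / (y + 1)"
    using y by (simp add: divide_simps) (simp add: algebra_simps)
  finally show ?case using Suc by (simp add: y_def add.commute)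
qed simp

text \<open>
  Mertens' first theorem is a comparison of \<open>ln (fact n)\<close>, which is \<open>n * ln n + O(n)\<close>, with its prime
  factorization, in which \<open>p\<close> occurs about \<open>n / p\<close> times.
\<close>

lemma mertens_first_upper:
  assumes "n \<ge> 1"
  shows "(\<Sum>p | prime p \<and> p \<le> n. ln (real p) / real p) \<le> ln (real n) + ln 4"
proof -
  let ?P = "{p. prime p \<and> p \<le> n}"
  have "real n * (\<Sum>p\<in>?P. ln (real p) / real p) - (\<Sum>p\<in>?P. ln (real p)) = (\<Sum>p\<in>?P. (real n / real p - 1) * ln (real p))"
    by (simp add: sum_distrib_left sum_subtractf algebra_simps)
  also have "\<dots> \<le> (\<Sum>p\<in>?P. real (multiplicity p (fact n :: nat)) * ln (real p))"
    by (intro sum_mono mult_right_mono multiplicity_fact_lower) (auto dest: prime_ge_1_nat)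
  also have "\<dots> \<le> real n * ln (real n)"
    using ln_fact_upper[OF assms] by (simp add: ln_fact_prime_multiplicity)
  finally have "real n * (\<Sum>p\<in>?P. ln (real p) / real p) \<le> real n * (ln (real n) + ln 4)"
    using chebyshev_theta_le[of n] by (simp add: distrib_left)
  then show ?thesis using assms by simp
qed

lemma mertens_first_lower:
  assumes "n \<ge> 1"
  shows "ln (real n) - 3 \<le> (\<Sum>p | prime p \<and> p \<le> n. ln (real p) / real p)"
proof -
  let ?P = "{p. prime p \<and> p \<le> n}"
  have "real n * ln (real n) - real n \<le> (\<Sum>p\<in>?P. real (multiplicity p (fact n :: nat)) * ln (real p))"
    using ln_fact_lower[OF assms] by (simp add: ln_fact_prime_multiplicity)
  also have "\<dots> \<le> (\<Sum>p\<in>?P. (real n / (real p - 1)) * ln (real p))"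
    by (intro sum_mono mult_right_mono multiplicity_fact_upper) (auto dest: prime_ge_1_nat)
  also have "\<dots> = (\<Sum>p\<in>?P. real n * (ln (real p) / real p) + real n * (ln (real p) / (real p * (real p - 1))))"
  proof (intro sum.cong refl)
    fix p assume "p \<in> ?P"
    then have "real p \<ge> 2" by (auto dest: prime_ge_2_nat)
    then show "(real n / (real p - 1)) * ln (real p) = real n * (ln (real p) / real p) + real n * (ln (real p) / (real p * (real p - 1)))"
      by (simp add: divide_simps) (simp add: algebra_simps)
  qed
  also have "\<dots> = real n * (\<Sum>p\<in>?P. ln (real p) / real p) + real n * (\<Sum>p\<in>?P. ln (real p) / (real p * (real p - 1)))"
    by (simp add: sum.distrib sum_distrib_left)
  also have "(\<Sum>p\<in>?P. ln (real p) / (real p * (real p - 1))) \<le> (\<Sum>m=2..n. ln (real m) / (real m * (real m - 1)))"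
    by (intro sum_mono2) (auto dest: prime_ge_2_nat)
  also have "\<dots> \<le> 2 - (ln (real n) + 2) / real n" by (rule sum_ln_over_square_le[OF assms])
  also have "\<dots> \<le> 2" using assms by simp
  finally have "real n * ln (real n) - real n \<le> real n * (\<Sum>p\<in>?P. ln (real p) / real p) + real n * 2"
    by (simp add: mult_left_mono)
  then have "real n * (ln (real n) - 3) \<le> real n * (\<Sum>p\<in>?P. ln (real p) / real p)" by (simp add: algebra_simps)
  then show ?thesis using assms by simp
qed

text \<open>
  Partial summation in incremental form.  Let \<open>R n = O(1)\<close> be the error in Mertens' first theorem and
  \<open>D n\<close> the error in the second one, corrected by \<open>R n / ln n\<close>.  The increments of \<open>D\<close> are then
  bounded by those of \<open>- 4 / ln n\<close>, hence summable, and \<open>D\<close> is bounded.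
\<close>

lemma mertens_second:
  obtains C where "C > 0"
    "\<And>n. n \<ge> 2 \<Longrightarrow> \<bar>(\<Sum>p | prime p \<and> p \<le> n. 1 / real p) - ln (ln (real n))\<bar> \<le> C"
proof -
  define A where "A n = (\<Sum>p | prime p \<and> p \<le> n. ln (real p) / real p)" for n :: nat
  define M where "M n = (\<Sum>p | prime p \<and> p \<le> n. 1 / real p)" for n :: nat
  define R where "R n = A n - ln (real n)" for n
  define D where "D n = M n - ln (ln (real n)) - R n / ln (real n)" for n
  have R: "\<bar>R n\<bar> \<le> 3" if "n \<ge> 1" for n
    using mertens_first_upper[OF that] mertens_first_lower[OF that] ln_realpow[of 2 2] ln_2_less_1
    unfolding R_def A_def by simp
  have set: "{p. prime p \<and> p \<le> Suc n} = (if prime (Suc n) then insert (Suc n) {p. prime p \<and> p \<le> n} else {p. prime p \<and> p \<le> n})" for n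
    by (auto simp: le_Suc_eq)
  have step: "(M (Suc n) - M n) * ln (real (Suc n)) = A (Suc n) - A n" for n
    unfolding M_def A_def set by simp
  have D: "\<bar>D n - D 2\<bar> \<le> 4 * (1 / ln 2 - 1 / ln (real n))" if "n \<ge> 2" for n
    using that
  proof (induction n rule: nat_induct_at_least)
    case (Suc n)
    define a b where "a = ln (real n)" and "b = ln (real (Suc n))"
    have a: "a > 0" "b > a" using Suc(1) by (auto simp: a_def b_def)
    have ba: "b - a \<le> 1"
    proof -
      have "b - a = ln (1 + 1 / real n)"
        using Suc(1) ln_div[of "real (Suc n)" "real n"] by (simp add: add_divide_distrib add.commute a_def b_def)
      also have "\<dots> \<le> 1 / real n" using Suc(1) by (intro ln_add_one_self_le_self) auto
      also have "\<dots> \<le> 1" using Suc(1) by simp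
      finally show ?thesis .
    qed
    have l1: "ln b - ln a \<le> (b - a) / a"
    proof -
      have "ln b - ln a = ln (b / a)" using a by (simp add: ln_div)
      also have "\<dots> \<le> b / a - 1" using a by (intro ln_le_minus_one) auto
      finally show ?thesis using a by (simp add: diff_divide_distrib)
    qed
    have l2: "(b - a) / b \<le> ln b - ln a"
    proof -
      have "ln a - ln b = ln (a / b)" using a by (simp add: ln_div)
      also have "\<dots> \<le> a / b - 1" using a by (intro ln_le_minus_one) auto
      finally show ?thesis using a by (simp add: diff_divide_distrib)
    qed
    have Ms: "M (Suc n) - M n = (b - a) / b + (R (Suc n) - R n) / b"
    proof -
      have "(M (Suc n) - M n) * b = (b - a) + (R (Suc n) - R n)"
        unfolding R_def b_def step by (simp add: a_def)
      then have "M (Suc n) - M n = ((b - a) + (R (Suc n) - R n)) / b" using a by (simp add: field_simps)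
      then show ?thesis by (simp only: add_divide_distrib)
    qed
    have "D (Suc n) - D n = ((b - a) / b - (ln b - ln a)) + R n * (1 / a - 1 / b)"
      using Ms unfolding D_def a_def[symmetric] b_def[symmetric]
      by (simp add: algebra_simps diff_divide_distrib)
    also have "\<bar>\<dots>\<bar> \<le> \<bar>(b - a) / b - (ln b - ln a)\<bar> + \<bar>R n * (1 / a - 1 / b)\<bar>" by (rule abs_triangle_ineq)
    also have "\<bar>(b - a) / b - (ln b - ln a)\<bar> \<le> (b - a) * (1 / a - 1 / b)"
      using l1 l2 by (simp add: algebra_simps)
    also have "(b - a) * (1 / a - 1 / b) \<le> 1 * (1 / a - 1 / b)"
      using ba a by (intro mult_right_mono) (auto simp: frac_le)
    also have "\<bar>R n * (1 / a - 1 / b)\<bar> \<le> 3 * (1 / a - 1 / b)"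
    proof -
      have "1 / a - 1 / b \<ge> 0" using a by (simp add: frac_le)
      moreover have "\<bar>R n\<bar> \<le> 3" using R Suc(1) by simp
      ultimately show ?thesis unfolding abs_mult by (simp only: abs_of_nonneg mult_right_mono)
    qed
    finally have "\<bar>D (Suc n) - D n\<bar> \<le> 4 * (1 / a - 1 / b)" by simp
    moreover have "\<bar>D n - D 2\<bar> \<le> 4 * (1 / ln 2 - 1 / a)" using Suc(2) by (simp only: a_def)
    ultimately have "\<bar>D (Suc n) - D 2\<bar> \<le> 4 * (1 / ln 2 - 1 / b)" by (simp only: right_diff_distrib)
    then show ?case by (simp only: b_def)
  qed simp
  define C where "C = \<bar>D 2\<bar> + 7 / ln 2"
  show ?thesis
  proof (rule that[of C])
    have "ln (2::real) > 0" by simp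
    then show "C > 0" by (simp add: C_def add_nonneg_pos)
    fix n :: nat assume n: "n \<ge> 2"
    have l: "ln (real n) \<ge> ln 2" using n by simp
    have l0: "ln (real n) > 0" using n by simp
    have "\<bar>D n - D 2\<bar> \<le> 4 * (1 / ln 2)"
    proof -
      have "0 \<le> 1 / ln (real n)" using l0 by simp
      then show ?thesis using D[OF n] by (simp only: right_diff_distrib)
    qed
    moreover have "\<bar>R n / ln (real n)\<bar> \<le> 3 / ln 2"
      unfolding abs_divide using R[of n] n l l0 by (intro frac_le) auto
    moreover have "M n - ln (ln (real n)) = D n + R n / ln (real n)" by (simp add: D_def)
    ultimately have "\<bar>M n - ln (ln (real n))\<bar> \<le> C" unfolding C_def by linarith
    then show "\<bar>(\<Sum>p | prime p \<and> p \<le> n. 1 / real p) - ln (ln (real n))\<bar> \<le> C" unfolding M_def .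
  qed
qed

text \<open>
  By Mertens' first theorem the sum of \<open>ln p / p\<close> over the interval is at least
  \<open>ln (exp 13) = 13\<close> minus the error bounds 3 and \<open>ln 4\<close> and a rounding loss of \<open>ln 2\<close>.  So it
  is at least 1, while each term is at most \<open>exp 13 * ln y / y\<close>.
\<close>

lemma prime_counting_interval_lower:
  fixes y :: real
  assumes "y \<ge> exp 13"
  shows "y / (exp 13 * ln y) \<le> real (card {p. prime p \<and> y / exp 13 < real p \<and> real p \<le> y})"
proof -
  let ?S = "{p. prime p \<and> y / exp 13 < real p \<and> real p \<le> y}"
  define K where "K = exp (13::real)"
  define a b where "a = nat \<lfloor>y / K\<rfloor>" and "b = nat \<lfloor>y\<rfloor>"
  have K: "K > 0" "K \<ge> 14" using exp_ge_add_one_self[of 13] by (auto simp: K_def)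
  have y1: "y / K \<ge> 1" "y \<ge> 14" using assms K by (auto simp: K_def)
  have a1: "a \<ge> 1" "real a \<le> y / K" using y1 by (auto simp: a_def le_nat_floor)
  have b1: "b \<ge> 1" "real b \<ge> y / 2" using y1 unfolding b_def by linarith+
  have S: "?S = {p. prime p \<and> p \<le> b} - {p. prime p \<and> p \<le> a}"
  proof -
    have "y / K < real p \<longleftrightarrow> \<not> p \<le> a" for p using y1 unfolding a_def by linarith
    moreover have "real p \<le> y \<longleftrightarrow> p \<le> b" for p using y1 unfolding b_def by linarith
    ultimately show ?thesis by (auto simp: K_def)
  qed
  have ab: "a \<le> b"
  proof -
    have "y / K \<le> y" using K y1 by (simp add: field_simps)
    then show ?thesis unfolding a_def b_def by (intro nat_mono floor_mono)
  qed
  have "1 \<le> (ln (real b) - 3) - (ln (real a) + ln 4)"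
  proof -
    have "ln (y / 2) \<le> ln (real b)" using b1 y1 by (intro ln_mono) auto
    moreover have "ln (real a) \<le> ln (y / K)" using a1 by (intro ln_mono) auto
    moreover have "ln (y / K) = ln y - 13" using K y1 by (subst ln_div) (auto simp: K_def)
    moreover have "ln (y / 2) = ln y - ln 2" using y1 by (simp add: ln_div)
    ultimately show ?thesis using ln_realpow[of 2 2] ln_2_less_1 by simp
  qed
  also have "\<dots> \<le> (\<Sum>p | prime p \<and> p \<le> b. ln (real p) / real p) - (\<Sum>p | prime p \<and> p \<le> a. ln (real p) / real p)"
    using mertens_first_lower[OF b1(1)] mertens_first_upper[OF a1(1)] by linarith
  also have "\<dots> = (\<Sum>p\<in>?S. ln (real p) / real p)"
    unfolding S using ab by (subst sum_diff) auto
  also have "\<dots> \<le> (\<Sum>p\<in>?S. ln y / (y / K))"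
  proof (rule sum_mono)
    fix p assume p: "p \<in> ?S"
    have "y / K < real p" "real p \<le> y" using p by (auto simp: K_def)
    then show "ln (real p) / real p \<le> ln y / (y / K)"
    proof (intro frac_le ln_mono)
      have "0 < y / K" using y1 by linarith
      then show "0 < real p" "0 < y / K" using \<open>y / K < real p\<close> by linarith+
    qed (use \<open>real p \<le> y\<close> \<open>y / K < real p\<close> y1 in auto)
  qed
  also have "\<dots> = real (card ?S) * (ln y * K / y)" by simp
  finally have "1 \<le> real (card ?S) * (ln y * K / y)" .
  moreover have "ln y > 0" using y1 by simp
  ultimately show ?thesis using y1 K unfolding K_def by (simp add: field_simps)
qed

text \<open>
  Abel summation: a set that is nowhere denser than \<open>K\<close> in initial segments cannot beat \<open>K\<close> times the
  full sum of a decreasing function.  The term \<open>g N * (\<dots>)\<close> in the proof is the boundary term that makes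
  the induction work.
\<close>

lemma sum_antitone_le_of_counting_bound:
  fixes g :: "nat \<Rightarrow> real" and K :: real
  assumes "\<And>t. real (card {n\<in>S. n \<le> t}) \<le> K * real t"
    and "\<And>n. g (Suc n) \<le> g n" "\<And>n. g n \<ge> 0" "0 \<notin> S"
  shows "(\<Sum>n | n \<in> S \<and> n \<le> N. g n) \<le> K * (\<Sum>n=1..N. g n)"
proof -
  have "(\<Sum>n | n \<in> S \<and> n \<le> N. g n) \<le> K * (\<Sum>n=1..N. g n) + g N * (real (card {n\<in>S. n \<le> N}) - K * real N)"
  proof (induction N)
    case 0
    have "{n \<in> S. n = 0} = {}" using assms(4) by auto
    then have "{n \<in> S. n \<le> 0} = {}" by simp
    then show ?case by (simp only: sum.empty card.empty) simp
  next
    case (Suc N)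
    have set: "{n\<in>S. n \<le> Suc N} = (if Suc N \<in> S then insert (Suc N) {n\<in>S. n \<le> N} else {n\<in>S. n \<le> N})"
      by (auto simp: le_Suc_eq)
    have "g N * (real (card {n\<in>S. n \<le> N}) - K * real N) \<le> g (Suc N) * (real (card {n\<in>S. n \<le> N}) - K * real N)"
      using assms(1)[of N] assms(2)[of N] by (intro mult_right_mono_neg) auto
    then show ?case using Suc unfolding set by (auto simp: algebra_simps)
  qed
  also have "g N * (real (card {n\<in>S. n \<le> N}) - K * real N) \<le> 0"
    using assms(1)[of N] assms(3)[of N] by (simp add: mult_nonneg_nonpos)
  finally show ?thesis by simp
qed

lemma sum_inverse_max_square_le:
  fixes y :: real
  assumes "y > 0"
  shows "(\<Sum>n=1..N. 1 / (max (real n) y)\<^sup>2) \<le> 4 / y"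
proof -
  have "(\<Sum>n=1..N. 1 / (max (real n) y)\<^sup>2) \<le> 4 / y - 4 / (real N + y)"
  proof (induction N)
    case (Suc N)
    define m where "m = real (Suc N)"
    have m: "m \<ge> 1" "real N = m - 1" by (auto simp: m_def)
    have "((m + y) / 2)\<^sup>2 \<le> (max m y)\<^sup>2" using assms m by (intro power_mono) auto
    then have "1 / (max m y)\<^sup>2 \<le> 1 / ((m + y) / 2)\<^sup>2"
      using assms m by (intro divide_left_mono mult_pos_pos zero_less_power) auto
    also have "\<dots> = 4 / ((m + y) * (m + y))" by (simp add: power2_eq_square)
    also have "\<dots> \<le> 4 / ((m - 1 + y) * (m + y))"
      using assms m by (intro divide_left_mono mult_right_mono mult_pos_pos) auto
    also have "\<dots> = 4 / (m - 1 + y) - 4 / (m + y)"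
      using assms m by (simp add: divide_simps)
    finally have "1 / (max m y)\<^sup>2 \<le> 4 / (m - 1 + y) - 4 / (m + y)" .
    moreover have "(\<Sum>n=1..N. 1 / (max (real n) y)\<^sup>2) \<le> 4 / y - 4 / (m - 1 + y)"
      using Suc unfolding m(2) .
    moreover have "(\<Sum>n=1..Suc N. 1 / (max (real n) y)\<^sup>2) = (\<Sum>n=1..N. 1 / (max (real n) y)\<^sup>2) + 1 / (max m y)\<^sup>2"
      by (simp add: m_def)
    ultimately have "(\<Sum>n=1..Suc N. 1 / (max (real n) y)\<^sup>2) \<le> 4 / y - 4 / (m + y)" by linarith
    then show ?case unfolding m_def .
  qed simp
  also have "\<dots> \<le> 4 / y" using assms by simp
  finally show ?thesis .
qed

text \<open>
  Primes beyond \<open>z\<close> have density at most \<open>7 / ln z\<close> in every initial segment; the saving \<open>1 / ln z\<close>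
  is what compensates the number of divisors in the energy estimate.
\<close>

lemma sum_primes_inverse_max_square_le:
  fixes y z :: real
  assumes "y > 0" "z > 1" "finite S" "\<And>p. p \<in> S \<Longrightarrow> prime p \<and> z \<le> real p"
  shows "(\<Sum>p\<in>S. 1 / (max (real p) y)\<^sup>2) \<le> 28 / (y * ln z)"
proof -
  obtain N where N: "\<And>p. p \<in> S \<Longrightarrow> p \<le> N" using assms(3) by (meson finite_nat_set_iff_bounded_le)
  have lz: "ln z > 0" using assms by simp
  have "(\<Sum>p\<in>S. 1 / (max (real p) y)\<^sup>2) = (\<Sum>p | p \<in> S \<and> p \<le> N. 1 / (max (real p) y)\<^sup>2)"
    using N by (intro sum.cong) blast+
  also have "\<dots> \<le> (7 / ln z) * (\<Sum>n=1..N. 1 / (max (real n) y)\<^sup>2)"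
  proof (rule sum_antitone_le_of_counting_bound)
    fix t
    show "real (card {n \<in> S. n \<le> t}) \<le> 7 / ln z * real t"
    proof (cases "z \<le> real t")
      case False
      then have "\<not> n \<le> t" if "n \<in> S" for n using assms(4)[OF that] by linarith
      then have "{n \<in> S. n \<le> t} = {}" by blast
      then show ?thesis using lz by (simp only: card.empty) simp
    next
      case True
      have "card {n \<in> S. n \<le> t} \<le> card {p. prime p \<and> real p \<le> real t}"
      proof (rule card_mono)
        show "finite {p. prime p \<and> real p \<le> real t}" by (rule finite_subset[of _ "{..t}"]) auto
      qed (use assms(4) in auto)
      then have "real (card {n \<in> S. n \<le> t}) * ln z \<le> real (card {p. prime p \<and> real p \<le> real t}) * ln (real t)"
        using True assms(2) by (intro mult_mono ln_mono) auto
      also have "\<dots> \<le> 7 * real t" using True assms(2) by (intro prime_counting_upper) auto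
      finally show ?thesis unfolding times_divide_eq_left by (subst pos_le_divide_eq[OF lz])
    qed
  next
    fix n show "1 / (max (real (Suc n)) y)\<^sup>2 \<le> 1 / (max (real n) y)\<^sup>2"
      using assms(1) by (intro divide_left_mono power_mono mult_pos_pos zero_less_power) auto
  qed (use assms(4)[of 0] in auto)
  also have "\<dots> \<le> (7 / ln z) * (4 / y)"
    using lz assms(1) by (intro mult_left_mono sum_inverse_max_square_le) auto
  finally show ?thesis by (simp add: mult.commute)
qed

section \<open>Products of primes under a ballot condition\<close>

text \<open>
  Normalised so that \<open>ln p\<close> has order \<open>4 powr (prime_scale p)\<close>: a unit step on this scale multiplies
  \<open>ln p\<close> by about 4.
\<close>

definition prime_scale :: "nat \<Rightarrow> real" where
  "prime_scale n = (\<Sum>p | prime p \<and> p \<le> n. 1 / real p) / ln 4"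

abbreviation mset_value :: "nat multiset \<Rightarrow> real" where
  "mset_value M \<equiv> real (prod_mset M)"

text \<open>
  Multisets of primes stand for integers; multiplication is addition of multisets, and common divisors
  are intersections.  The last condition equivalently says that the \<open>j\<close>-th smallest element has scale
  at least \<open>j\<close>.
\<close>

definition ballots :: "nat \<Rightarrow> nat \<Rightarrow> nat multiset set" where
  "ballots k n = {M. size M = k \<and> (\<forall>p\<in>#M. prime p \<and> p \<le> n) \<and>
     (\<forall>i. size (filter_mset (\<lambda>p. prime_scale p < real i + 1) M) \<le> i)}"

definition ballot_sum :: "nat \<Rightarrow> nat \<Rightarrow> real" where
  "ballot_sum k n = (\<Sum>M\<in>ballots k n. 1 / mset_value M)"

lemma prime_scale_Suc:
  "prime_scale (Suc n) = prime_scale n + (if prime (Suc n) then 1 / (real (Suc n) * ln 4) else 0)"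
proof -
  have set: "{p. prime p \<and> p \<le> Suc n} = (if prime (Suc n) then insert (Suc n) {p. prime p \<and> p \<le> n} else {p. prime p \<and> p \<le> n})"
    by (auto simp: le_Suc_eq)
  show ?thesis unfolding prime_scale_def set by (simp add: add_divide_distrib)
qed

lemma prime_scale_mono: "m \<le> n \<Longrightarrow> prime_scale m \<le> prime_scale n"
  unfolding prime_scale_def by (intro divide_right_mono sum_mono2) (auto dest: prime_gt_0_nat)

lemma ln_4_ge_1: "ln (4::real) \<ge> 1"
  using exp_le ln_ge_iff[of 4 1] by simp

text \<open>
  A prime \<open>n\<close> adds \<open>1 / (n * ln 4)\<close>, where \<open>n \<ge> 2\<close> and \<open>ln 4 \<ge> 1\<close>.  Jumps shorter than 1 ensure that
  every unit block of the scale contains primes.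
\<close>

lemma prime_scale_step: 
  "prime_scale (Suc n) \<le> prime_scale n + 1 / 2"
proof (cases "prime (Suc n)")
  case True
  then have "real (Suc n) \<ge> 2" using prime_ge_2_nat[OF True] by simp
  then have "2 * 1 \<le> real (Suc n) * ln 4" using ln_4_ge_1 by (intro mult_mono) auto
  then have "1 / (real (Suc n) * ln 4) \<le> 1 / 2" by (intro divide_left_mono) auto
  then show ?thesis using True by (simp add: prime_scale_Suc del: of_nat_Suc)
qed (simp add: prime_scale_Suc)

lemma prime_scale_bounds:
  obtains C where "C > 0"
    "\<And>n y. n \<ge> 2 \<Longrightarrow> y \<le> prime_scale n \<Longrightarrow> 4 powr y \<le> C * ln (real n)"
    "\<And>n y. n \<ge> 2 \<Longrightarrow> prime_scale n \<le> y \<Longrightarrow> ln (real n) \<le> C * 4 powr y"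
proof -
  obtain D where D: "D > 0"
    "\<And>n. n \<ge> 2 \<Longrightarrow> \<bar>(\<Sum>p | prime p \<and> p \<le> n. 1 / real p) - ln (ln (real n))\<bar> \<le> D"
    using mertens_second by blast
  have l: "ln (real n) > 0" if "n \<ge> 2" for n :: nat using that by simp
  have D': "\<bar>prime_scale n * ln 4 - ln (ln (real n))\<bar> \<le> D" if "n \<ge> 2" for n
    using D(2)[OF that] by (simp add: prime_scale_def)
  show ?thesis
  proof (rule that[of "exp D"])
    fix n :: nat and y :: real assume n: "n \<ge> 2" and y: "y \<le> prime_scale n"
    have "y * ln 4 \<le> prime_scale n * ln 4" using y by (intro mult_right_mono) auto
    then have "y * ln 4 \<le> D + ln (ln (real n))" using D'[OF n] by linarith
    then have "exp (y * ln 4) \<le> exp (D + ln (ln (real n)))" by simp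
    then show "4 powr y \<le> exp D * ln (real n)" using l[OF n] by (simp add: powr_def exp_add)
  next
    fix n :: nat and y :: real assume n: "n \<ge> 2" and y: "prime_scale n \<le> y"
    have "prime_scale n * ln 4 \<le> y * ln 4" using y by (intro mult_right_mono) auto
    then have "ln (ln (real n)) \<le> D + y * ln 4" using D'[OF n] by linarith
    then have "exp (ln (ln (real n))) \<le> exp (D + y * ln 4)" by simp
    then show "ln (real n) \<le> exp D * 4 powr y" using l[OF n] by (simp add: powr_def exp_add)
  qed simp
qed

lemma prime_scale_unbounded: "\<exists>n. prime_scale n > y"
proof -
  obtain C where C: "C > 0" "\<And>n y. n \<ge> 2 \<Longrightarrow> prime_scale n \<le> y \<Longrightarrow> ln (real n) \<le> C * 4 powr y"
    using prime_scale_bounds by metis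
  obtain n :: nat where n: "real n > exp (C * 4 powr y) + 2" using reals_Archimedean2 by blast
  have "n \<ge> 2" using n exp_gt_zero[of "C * 4 powr y"] by linarith
  have "C * 4 powr y < ln (real n)"
    using n exp_gt_zero[of "C * 4 powr y"] ln_exp[of "C * 4 powr y"] ln_less_cancel_iff[of "exp (C * 4 powr y)" "real n"]
    by linarith
  then have "\<not> prime_scale n \<le> y" using C(2)[OF \<open>n \<ge> 2\<close>] by fastforce
  then show ?thesis by (intro exI[of _ n]) simp
qed

definition scale_cutoff :: "real \<Rightarrow> nat" where
  "scale_cutoff y = (GREATEST n. prime_scale n < y)"

text \<open>
  The defining property of the cutoff turns the condition \<open>prime_scale p < y\<close> into an upper bound for
  \<open>p\<close>; small jumps ensure that the cutoff almost reaches \<open>y\<close>.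
\<close>

lemma scale_cutoff:
  assumes "y > 0"
  shows "n \<le> scale_cutoff y \<longleftrightarrow> prime_scale n < y"
    and "y - 1 / 2 \<le> prime_scale (scale_cutoff y)"
proof -
  obtain m where m: "prime_scale m > y" using prime_scale_unbounded by blast
  have b: "n \<le> m" if "prime_scale n < y" for n
    using prime_scale_mono[of m n] that m by (cases "n \<le> m") auto
  have 0: "prime_scale 0 < y" using assms by (simp add: prime_scale_def)
  have G: "prime_scale (scale_cutoff y) < y"
    unfolding scale_cutoff_def by (rule GreatestI_nat[of _ 0 m]) (use 0 b in auto)
  have G2: "n \<le> scale_cutoff y" if "prime_scale n < y" for n
    unfolding scale_cutoff_def by (rule Greatest_le_nat[of _ n m]) (use that b in auto)
  show "n \<le> scale_cutoff y \<longleftrightarrow> prime_scale n < y"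
    using G G2 prime_scale_mono[of n "scale_cutoff y"] by fastforce
  have "\<not> prime_scale (Suc (scale_cutoff y)) < y" using G2[of "Suc (scale_cutoff y)"] by auto
  then show "y - 1 / 2 \<le> prime_scale (scale_cutoff y)" using prime_scale_step[of "scale_cutoff y"] by linarith
qed

lemma finite_ballots: "finite (ballots k n)"
proof (rule finite_subset)
  show "ballots k n \<subseteq> multisets_of_size {..n} k"
    by (auto simp: ballots_def multisets_of_size_def)
qed (intro finite_multisets_of_size finite_atMost)

lemma prod_mset_primes_pos:
  fixes M :: "nat multiset"
  shows "(\<And>p. p \<in># M \<Longrightarrow> prime p) \<Longrightarrow> prod_mset M > 0"
  by (metis gr0I not_prime_0 prod_mset_zero_iff)

lemma ballots_pos: "M \<in> ballots k n \<Longrightarrow> prod_mset M > 0"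
  by (rule prod_mset_primes_pos) (auto simp: ballots_def)

lemma ballots_Suc:
  "ballots (Suc j) n \<subseteq> ballots (Suc j) (Suc n)"
  by (auto simp: ballots_def)

text \<open>
  A new largest prime of scale at least \<open>j + 1\<close> is counted only by conditions that allow \<open>j + 1\<close> or
  more elements.
\<close>

lemma add_mset_ballot:
  assumes "M \<in> ballots j n" "prime n" "real (Suc j) \<le> prime_scale n"
  shows "add_mset n M \<in> ballots (Suc j) n"
proof -
  have "size (filter_mset (\<lambda>p. prime_scale p < real i + 1) (add_mset n M)) \<le> i" for i
  proof (cases "prime_scale n < real i + 1")
    case True
    then have "real j < real i" using assms(3) by simp
    then have "Suc j \<le> i" by simp
    have "size (filter_mset (\<lambda>p. prime_scale p < real i + 1) (add_mset n M)) \<le> size (add_mset n M)"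
      by (intro size_mset_mono multiset_filter_subset)
    also have "\<dots> = Suc j" using assms(1) by (simp add: ballots_def)
    finally show ?thesis using \<open>Suc j \<le> i\<close> by simp
  next
    case False
    then show ?thesis using assms(1) by (simp add: ballots_def)
  qed
  then show ?thesis using assms by (auto simp: ballots_def)
qed

text \<open>
  The volume of the region \<open>u_1 \<le> \<dots> \<le> u_j \<le> x\<close> with \<open>i \<le> u_i\<close> for all \<open>i\<close>, for \<open>x \<ge> j\<close>: these are
  the Abel polynomials \<open>(x - j) * x ^ (j - 1) / fact j\<close>, which vanish at \<open>x = j\<close> and satisfy
  the recursion for iterated integrals proved below.
\<close>

fun ballot_volume :: "nat \<Rightarrow> real \<Rightarrow> real" where
  "ballot_volume 0 x = 1"
| "ballot_volume (Suc j) x = (x - real (Suc j)) * x ^ j / fact (Suc j)"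

lemma ballot_volume_nonneg: "x \<ge> real j \<Longrightarrow> ballot_volume j x \<ge> 0"
  by (cases j) (auto intro!: divide_nonneg_pos mult_nonneg_nonneg)

lemma ballot_volume_mono: "x \<ge> real j \<Longrightarrow> x \<le> y \<Longrightarrow> ballot_volume j x \<le> ballot_volume j y"
  by (cases j) (auto intro!: divide_right_mono mult_mono power_mono)

lemma ballot_volume_deriv:
  "(ballot_volume (Suc j) has_real_derivative ballot_volume j x) (at x)"
proof (cases j)
  case 0
  have "((\<lambda>x. (x - 1) * x ^ 0 / fact 1) has_real_derivative 1) (at x)"
    by (auto intro!: derivative_eq_intros)
  moreover have "ballot_volume (Suc 0) = (\<lambda>x. (x - 1) * x ^ 0 / fact 1)" by (rule ext) simp
  moreover have "ballot_volume 0 x = 1" by simp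
  ultimately show ?thesis unfolding 0 by (simp only:)
next
  case (Suc i)
  have "((\<lambda>x. (x - real (Suc (Suc i))) * x ^ Suc i / fact (Suc (Suc i))) has_real_derivative
     (x ^ Suc i + (x - real (Suc (Suc i))) * (real (Suc i) * x ^ i)) / fact (Suc (Suc i))) (at x)"
    by (rule derivative_eq_intros refl | simp)+
  also have "(x ^ Suc i + (x - real (Suc (Suc i))) * (real (Suc i) * x ^ i)) = real (Suc (Suc i)) * ((x - real (Suc i)) * x ^ i)"
    by (simp add: algebra_simps)
  also have "(real (Suc (Suc i)) * ((x - real (Suc i)) * x ^ i)) / fact (Suc (Suc i)) = ballot_volume j x"
    unfolding Suc by (subst fact_Suc) (simp add: field_simps del: fact_Suc of_nat_Suc)
  finally have "((\<lambda>x. (x - real (Suc (Suc i))) * x ^ Suc i / fact (Suc (Suc i))) has_real_derivative ballot_volume j x) (at x)" .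
  moreover have "ballot_volume (Suc j) = (\<lambda>x. (x - real (Suc (Suc i))) * x ^ Suc i / fact (Suc (Suc i)))"
    unfolding Suc by (rule ext) simp
  ultimately show ?thesis by simp
qed

lemma ballot_volume_increment:
  assumes "real (Suc j) \<le> u" "u \<le> v"
  shows "ballot_volume (Suc j) v - ballot_volume (Suc j) u \<le> (v - u) * ballot_volume j v"
proof (cases "u = v")
  case False
  then have "u < v" using assms by simp
  from MVT2[OF this ballot_volume_deriv] obtain z where z: "u < z" "z < v"
    "ballot_volume (Suc j) v - ballot_volume (Suc j) u = (v - u) * ballot_volume j z" by blast
  have "ballot_volume j z \<le> ballot_volume j v" using z assms by (intro ballot_volume_mono) auto
  then show ?thesis using z(3) assms by (simp add: mult_left_mono)
qed simp

text \<open>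
  The sum over the largest element of the multiset is a Riemann sum of an increasing function with
  right endpoints: the prime \<open>n\<close> contributes \<open>1 / n\<close>, that is \<open>ln 4\<close> times the length of the interval of
  the scale ending at \<open>prime_scale n\<close>.  Such a sum dominates the integral, without any error
  term.  Repeated primes are allowed in the multisets for this reason.
\<close>

lemma ballot_sum_lower:
  assumes "real j \<le> prime_scale n"
  shows "ln 4 ^ j * ballot_volume j (prime_scale n) \<le> ballot_sum j n"
  using assms
proof (induction j arbitrary: n)
  case 0
  have "ballots 0 n = {{#}}" by (auto simp: ballots_def)
  then show ?case by (simp add: ballot_sum_def)
next
  case (Suc j)
  note IHj = Suc.IH
  show ?case using Suc.prems
  proof (induction n)
    case 0
    then show ?case by (simp add: prime_scale_def)
  next
    case (Suc n)
    note IHn = Suc.IH and prems = Suc.prems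
    let ?u = "prime_scale n" and ?v = "prime_scale (Suc n)"
    show ?case
    proof (cases "prime (Suc n)")
      case False
      then have "?v = ?u" by (simp add: prime_scale_Suc)
      moreover have "ballot_sum (Suc j) n \<le> ballot_sum (Suc j) (Suc n)"
        unfolding ballot_sum_def by (intro sum_mono2 finite_ballots ballots_Suc) auto
      ultimately show ?thesis using IHn prems by simp
    next
      case True
      have uv: "?v - ?u = 1 / (real (Suc n) * ln 4)" using True by (simp add: prime_scale_Suc)
      have uv0: "?u \<le> ?v" by (rule prime_scale_mono) simp
      \<comment> \<open>The region starts at \<open>j + 1\<close>; the first interval may stick out on the left, which only helps.\<close>
      define u' where "u' = max ?u (real (Suc j))"
      have u': "real (Suc j) \<le> u'" "u' \<le> ?v" "?v - u' \<le> ?v - ?u" using uv0 prems by (auto simp: u'_def)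
      have vol0: "ballot_volume j ?v \<ge> 0" using prems by (intro ballot_volume_nonneg) simp
      have base: "ln 4 ^ Suc j * ballot_volume (Suc j) u' \<le> ballot_sum (Suc j) n"
      proof (cases "real (Suc j) \<le> ?u")
        case True
        then show ?thesis using IHn by (simp add: u'_def max_def)
      next
        case False
        then have "u' = real (Suc j)" by (simp add: u'_def)
        then have "ballot_volume (Suc j) u' = 0" by simp
        then show ?thesis by (simp add: ballot_sum_def sum_nonneg del: ballot_volume.simps)
      qed
      let ?A = "ballots (Suc j) n" and ?B = "add_mset (Suc n) ` ballots j (Suc n)"
      have disj: "?A \<inter> ?B = {}" by (auto simp: ballots_def)
      have sub: "?A \<union> ?B \<subseteq> ballots (Suc j) (Suc n)"
        using ballots_Suc add_mset_ballot[OF _ True] prems by blast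
      have "(1 / real (Suc n)) * ballot_sum j (Suc n) = (\<Sum>M\<in>?B. 1 / mset_value M)"
        by (subst sum.reindex) (auto simp: inj_on_def ballot_sum_def sum_distrib_left simp del: of_nat_Suc mult_Suc)
      then have "ballot_sum (Suc j) n + (1 / real (Suc n)) * ballot_sum j (Suc n) = (\<Sum>M\<in>?A \<union> ?B. 1 / mset_value M)"
        unfolding ballot_sum_def[of "Suc j" n]
        by (subst sum.union_disjoint[OF finite_ballots _ disj]) (auto simp: finite_ballots)
      also have "\<dots> \<le> ballot_sum (Suc j) (Suc n)" unfolding ballot_sum_def
        by (intro sum_mono2 finite_ballots sub) auto
      finally have rec: "ballot_sum (Suc j) n + (1 / real (Suc n)) * ballot_sum j (Suc n) \<le> ballot_sum (Suc j) (Suc n)" .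
      have "ballot_volume (Suc j) ?v \<le> ballot_volume (Suc j) u' + (?v - u') * ballot_volume j ?v"
        using ballot_volume_increment[OF u'(1,2)] by linarith
      also have "\<dots> \<le> ballot_volume (Suc j) u' + (?v - ?u) * ballot_volume j ?v"
        using u'(3) vol0 by (intro add_left_mono mult_right_mono)
      finally have "ln 4 ^ Suc j * ballot_volume (Suc j) ?v \<le> ln 4 ^ Suc j * (ballot_volume (Suc j) u' + (?v - ?u) * ballot_volume j ?v)"
        by (intro mult_left_mono) auto
      also have "\<dots> = ln 4 ^ Suc j * ballot_volume (Suc j) u' + (1 / real (Suc n)) * (ln 4 ^ j * ballot_volume j ?v)"
        unfolding uv by (simp add: distrib_left del: ballot_volume.simps of_nat_Suc)
      also have "\<dots> \<le> ballot_sum (Suc j) n + (1 / real (Suc n)) * ballot_sum j (Suc n)"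
        by (intro add_mono mult_left_mono base IHj) (use prems in auto)
      finally show ?thesis using rec by linarith
    qed
  qed
qed

section \<open>The reduced energy sum of ballot multisets\<close>

lemma finite_card_submultisets: "finite {B. B \<subseteq># M} \<and> card {B. B \<subseteq># M} \<le> 2 ^ size M"
proof (induction M)
  case empty
  then show ?case by simp
next
  case (add x M)
  have sub: "{B. B \<subseteq># add_mset x M} \<subseteq> {B. B \<subseteq># M} \<union> add_mset x ` {B. B \<subseteq># M}"
  proof
    fix B assume "B \<in> {B. B \<subseteq># add_mset x M}"
    then have B: "B \<subseteq># add_mset x M" by simp
    show "B \<in> {B. B \<subseteq># M} \<union> add_mset x ` {B. B \<subseteq># M}"
    proof (cases "x \<in># B")
      case True
      then obtain B' where "B = add_mset x B'" by (meson mset_add)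
      then show ?thesis using B by simp
    next
      case False
      have "count B y \<le> count M y" for y
        using mset_subset_eq_count[OF B, of y] False by (cases "y = x") (auto simp: not_in_iff)
      then show ?thesis by (simp add: subseteq_mset_def)
    qed
  qed
  then have "card {B. B \<subseteq># add_mset x M} \<le> card ({B. B \<subseteq># M} \<union> add_mset x ` {B. B \<subseteq># M})"
    using add by (intro card_mono) auto
  also have "\<dots> \<le> card {B. B \<subseteq># M} + card (add_mset x ` {B. B \<subseteq># M})" by (rule card_Un_le)
  also have "\<dots> \<le> card {B. B \<subseteq># M} + card {B. B \<subseteq># M}" using card_image_le[of "{B. B \<subseteq># M}" "add_mset x"] add by simp
  also have "\<dots> \<le> 2 ^ size (add_mset x M)" using add by simp
  finally have "card {B. B \<subseteq># add_mset x M} \<le> 2 ^ size (add_mset x M)" .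
  moreover have "finite {B. B \<subseteq># add_mset x M}" by (rule finite_subset[OF sub]) (use add in simp)
  ultimately show ?case by blast
qed

text \<open>
  The multiset form of: if \<open>m1 m2 = m3 m4\<close>, then \<open>m1 = a b\<close>, \<open>m3 = a c\<close>, \<open>m2 = c e\<close>, \<open>m4 = b e\<close>, with
  \<open>a\<close> the greatest common divisor of \<open>m1\<close> and \<open>m3\<close>.
\<close>

lemma multiset_sum_eq_parametrization:
  fixes m1 m2 m3 m4 :: "'a multiset"
  assumes "m1 + m2 = m3 + m4"
  shows "m3 - m1 \<subseteq># m2" "m4 = (m2 - (m3 - m1)) + (m1 - m3)"
    "m1 = (m1 \<inter># m3) + (m1 - m3)" "m3 = (m1 \<inter># m3) + (m3 - m1)"
proof -
  have c: "count m1 x + count m2 x = count m3 x + count m4 x" for x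
    using assms by (metis count_union)
  have c': "count m3 x - count m1 x \<le> count m2 x"
    "count m4 x = (count m2 x - (count m3 x - count m1 x)) + (count m1 x - count m3 x)" for x
    using c[of x] by auto
  show "m3 - m1 \<subseteq># m2" using c' by (simp add: subseteq_mset_def)
  show "m4 = (m2 - (m3 - m1)) + (m1 - m3)" using c' by (intro multiset_eqI) simp
  show "m1 = (m1 \<inter># m3) + (m1 - m3)" "m3 = (m1 \<inter># m3) + (m3 - m1)"
    by (auto intro!: multiset_eqI)
qed

definition scale_block :: "nat \<Rightarrow> nat set" where
  "scale_block i = {P. prime P \<and> real i \<le> prime_scale P \<and> prime_scale P < real i + 1}"

lemma finite_scale_block: "finite (scale_block i)"
proof (rule finite_subset)
  show "scale_block i \<subseteq> {..scale_cutoff (real i + 1)}"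
    using scale_cutoff(1)[of "real i + 1"] by (auto simp: scale_block_def)
qed simp

text \<open>
  The block occupies an interval of the scale of length at least \<open>1 - 1 / 2\<close>, and \<open>ln 4 \<ge> 1\<close>.
\<close>

lemma scale_block_sum_lower:
  assumes "i \<ge> 1"
  shows "1 / 2 \<le> (\<Sum>P\<in>scale_block i. 1 / real P)"
proof -
  define a where "a = scale_cutoff (real i)"
  define b where "b = scale_cutoff (real i + 1)"
  have ai: "n \<le> a \<longleftrightarrow> prime_scale n < real i" for n
    unfolding a_def using assms by (intro scale_cutoff(1)) simp
  have bi: "n \<le> b \<longleftrightarrow> prime_scale n < real i + 1" for n
    unfolding b_def by (intro scale_cutoff(1)) simp
  have b2: "real i + 1 / 2 \<le> prime_scale b"
    using scale_cutoff(2)[of "real i + 1"] unfolding b_def by simp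
  have "prime_scale a < real i" using ai by blast
  with b2 have "1 / 2 * 1 \<le> (prime_scale b - prime_scale a) * ln 4"
    using ln_4_ge_1 by (intro mult_mono) auto
  also have "\<dots> = (\<Sum>p | prime p \<and> p \<le> b. 1 / real p) - (\<Sum>p | prime p \<and> p \<le> a. 1 / real p)"
    by (simp add: prime_scale_def left_diff_distrib)
  also have "\<dots> = (\<Sum>p\<in>{p. prime p \<and> p \<le> b} - {p. prime p \<and> p \<le> a}. 1 / real p)"
    using ai bi by (intro sum_diff[symmetric]) fastforce+
  also have "{p. prime p \<and> p \<le> b} - {p. prime p \<and> p \<le> a} = scale_block i"
    using ai bi by (fastforce simp: scale_block_def)
  finally show ?thesis by simp
qed

definition ballot_predecessors :: "nat \<Rightarrow> nat \<Rightarrow> nat \<Rightarrow> nat multiset set" where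
  "ballot_predecessors k n i = {M. \<exists>P\<in>scale_block i. add_mset P M \<in> ballots k n}"

lemma finite_ballot_predecessors: "finite (ballot_predecessors k n i)"
proof (rule finite_subset)
  show "ballot_predecessors k n i \<subseteq> (\<Union>P\<in>scale_block i. (\<lambda>M. M - {#P#}) ` ballots k n)"
    by (force simp: ballot_predecessors_def)
qed (intro finite_UN_I finite_scale_block finite_imageI finite_ballots)

text \<open>
  The ballot condition depends only on the blocks of the elements, so the removed prime may be replaced
  by any other prime of its block.
\<close>

lemma ballot_predecessors_add:
  assumes "M \<in> ballot_predecessors k (scale_cutoff y) i" "real i + 1 \<le> y" "P \<in> scale_block i"
  shows "add_mset P M \<in> ballots k (scale_cutoff y)"
proof -
  obtain Q where Q: "Q \<in> scale_block i" "add_mset Q M \<in> ballots k (scale_cutoff y)"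
    using assms(1) by (auto simp: ballot_predecessors_def)
  have "P \<le> scale_cutoff y" using assms(2,3) by (subst scale_cutoff(1)) (auto simp: scale_block_def)
  have iff: "prime_scale R < real j + 1 \<longleftrightarrow> i \<le> j" if "R \<in> scale_block i" for R j
    using that by (auto simp: scale_block_def)
  have "prime_scale P < real j + 1 \<longleftrightarrow> prime_scale Q < real j + 1" for j
    using iff[OF assms(3)] iff[OF Q(1)] by simp
  then have "size (filter_mset (\<lambda>p. prime_scale p < real j + 1) (add_mset P M)) =
     size (filter_mset (\<lambda>p. prime_scale p < real j + 1) (add_mset Q M))" for j
    by simp
  then show ?thesis using Q \<open>P \<le> scale_cutoff y\<close> assms(3)
    by (auto simp: ballots_def scale_block_def)
qed

text \<open>
  Multiplying the sum over predecessors by the sum of \<open>1 / P\<close> over the block, which is at least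
  \<open>1 / 2\<close>, counts ballot multisets together with a distinguished prime; each has at most \<open>k\<close> of these.
\<close>

lemma ballot_predecessors_sum_le:
  assumes "real k + 2 \<le> y"
  shows "(\<Sum>i=1..k+1. \<Sum>M\<in>ballot_predecessors k (scale_cutoff y) i. 1 / mset_value M)
     \<le> 2 * real k * ballot_sum k (scale_cutoff y)"
proof -
  let ?n = "scale_cutoff y" and ?V = "ballots k (scale_cutoff y)"
  let ?V' = "ballot_predecessors k (scale_cutoff y)"
  let ?T = "SIGMA i:{1..k+1}. ?V' i \<times> scale_block i"
  let ?g = "\<lambda>(i, M, P). (add_mset P M, P)"
  have inj: "inj_on ?g ?T"
  proof (rule inj_onI)
    fix u v assume uv: "u \<in> ?T" "v \<in> ?T" "?g u = ?g v"
    obtain i M P where u: "u = (i, M, P)" by (cases u)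
    obtain j M' P' where v: "v = (j, M', P')" by (cases v)
    have "P' = P" "M' = M" using uv(3) by (auto simp: u v)
    have "P \<in> scale_block i" "P \<in> scale_block j" using uv by (auto simp: u v)
    then have "real i < real j + 1" "real j < real i + 1" unfolding scale_block_def by auto
    then have "i = j" by linarith
    then show "u = v" using \<open>P' = P\<close> \<open>M' = M\<close> by (simp add: u v)
  qed
  have "(\<Sum>i=1..k+1. \<Sum>M\<in>?V' i. 1 / mset_value M) * (1 / 2) =
    (\<Sum>i=1..k+1. (\<Sum>M\<in>?V' i. 1 / mset_value M) * (1 / 2))"
    by (rule sum_distrib_right)
  also have "\<dots> \<le> (\<Sum>i=1..k+1. (\<Sum>M\<in>?V' i. 1 / mset_value M) * (\<Sum>P\<in>scale_block i. 1 / real P))"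
    by (intro sum_mono mult_left_mono scale_block_sum_lower sum_nonneg) auto
  also have "\<dots> = (\<Sum>i=1..k+1. \<Sum>(M, P)\<in>?V' i \<times> scale_block i. 1 / mset_value (add_mset P M))"
    by (intro sum.cong refl) (simp only: sum_product sum.cartesian_product split_def, simp add: mult.commute)
  also have "\<dots> = (\<Sum>(i, M, P)\<in>?T. 1 / mset_value (add_mset P M))"
    by (subst sum.Sigma) (auto simp: finite_ballot_predecessors finite_scale_block split_def)
  also have "\<dots> = (\<Sum>(M, P)\<in>?g ` ?T. 1 / mset_value M)"
    by (subst sum.reindex[OF inj]) (simp add: split_def)
  also have "\<dots> \<le> (\<Sum>(M, P)\<in>(SIGMA M:?V. set_mset M). 1 / mset_value M)"
  proof (rule sum_mono2)
    show "?g ` ?T \<subseteq> (SIGMA M:?V. set_mset M)"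
    proof
      fix z assume "z \<in> ?g ` ?T"
      then obtain i M P where z: "z = (add_mset P M, P)" "i \<in> {1..k+1}" "M \<in> ?V' i" "P \<in> scale_block i" by auto
      then have "add_mset P M \<in> ?V" using assms by (intro ballot_predecessors_add[of M k y i P]) auto
      then show "z \<in> (SIGMA M:?V. set_mset M)" using z by simp
    qed
  qed (auto simp: finite_ballots)
  also have "\<dots> = (\<Sum>M\<in>?V. \<Sum>P\<in>set_mset M. 1 / mset_value M)"
    by (rule sum.Sigma[symmetric]) (auto simp: finite_ballots)
  also have "\<dots> \<le> (\<Sum>M\<in>?V. real k * (1 / mset_value M))"
  proof (rule sum_mono)
    fix M assume "M \<in> ?V"
    then have "size M = k" by (simp add: ballots_def)
    moreover have "size (mset_set (set_mset M)) \<le> size M"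
      by (intro size_mset_mono mset_set_set_mset_msubset)
    ultimately have "card (set_mset M) \<le> k" by simp
    then show "(\<Sum>P\<in>set_mset M. 1 / mset_value M) \<le> real k * (1 / mset_value M)"
      by (simp add: divide_right_mono)
  qed
  also have "\<dots> = real k * ballot_sum k ?n" by (simp add: ballot_sum_def sum_distrib_left)
  finally show ?thesis by simp
qed

lemma sum_Sigma_le:
  fixes f :: "'a \<times> 'b \<Rightarrow> real"
  assumes "finite A" "\<And>x. x \<in> A \<Longrightarrow> finite (B x)"
    "\<And>x. x \<in> A \<Longrightarrow> (\<Sum>y\<in>B x. f (x, y)) \<le> g x"
  shows "(\<Sum>z\<in>Sigma A B. f z) \<le> (\<Sum>x\<in>A. g x)"
proof -
  have "(\<Sum>z\<in>Sigma A B. f z) = (\<Sum>x\<in>A. \<Sum>y\<in>B x. f (x, y))"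
    using assms(1,2) by (subst sum.Sigma) auto
  also have "\<dots> \<le> (\<Sum>x\<in>A. g x)" by (rule sum_mono) (rule assms(3))
  finally show ?thesis .
qed

type_synonym quadruple = "nat multiset \<times> nat multiset \<times> nat multiset \<times> nat multiset"

type_synonym pivot_record = "nat \<times> nat multiset \<times> nat multiset \<times> nat multiset \<times> nat multiset \<times> nat"

definition ballot_quadruples :: "nat \<Rightarrow> nat \<Rightarrow> quadruple set" where
  "ballot_quadruples k n = {(m1, m2, m3, m4). {m1, m2, m3, m4} \<subseteq> ballots k n \<and> m1 + m2 = m3 + m4}"

definition quadruple_weight :: "quadruple \<Rightarrow> real" where
  "quadruple_weight = (\<lambda>(m1, m2, m3, m4). 1 /
     (max (mset_value m1) (mset_value m3) * max (mset_value m2) (mset_value m4)))"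

lemma finite_ballot_quadruples: "finite (ballot_quadruples k n)"
proof (rule finite_subset)
  let ?V = "ballots k n"
  show "ballot_quadruples k n \<subseteq> ?V \<times> ?V \<times> ?V \<times> ?V" by (auto simp: ballot_quadruples_def)
qed (intro finite_cartesian_product finite_ballots)

lemma quadruple_weight_nonneg: "quadruple_weight q \<ge> 0"
  by (auto simp: quadruple_weight_def split_def intro!: mult_nonneg_nonneg)

text \<open>
  Off-diagonal quadruples in which the largest unshared prime occurs more often in \<open>m1\<close> than in \<open>m3\<close>;
  exchanging the two sides of the equation maps the other ones here.
\<close>

definition ballot_quadruples_left :: "nat \<Rightarrow> nat \<Rightarrow> quadruple set" where
  "ballot_quadruples_left k n = {(m1, m2, m3, m4) \<in> ballot_quadruples k n. m1 \<noteq> m3 \<and>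
     Max (set_mset ((m1 - m3) + (m3 - m1))) \<in># m1 - m3}"

definition low_submultisets :: "nat \<Rightarrow> nat multiset \<Rightarrow> nat multiset set" where
  "low_submultisets i M = {B. B \<subseteq># filter_mset (\<lambda>p. prime_scale p < real i + 1) M}"

lemma finite_low_submultisets: "finite (low_submultisets i M)"
  unfolding low_submultisets_def using finite_card_submultisets by blast

lemma card_low_submultisets:
  assumes "size (filter_mset (\<lambda>p. prime_scale p < real i + 1) M) \<le> j"
  shows "real (card (low_submultisets i M)) \<le> 2 ^ j"
proof -
  have "card (low_submultisets i M) \<le> 2 ^ size (filter_mset (\<lambda>p. prime_scale p < real i + 1) M)"
    unfolding low_submultisets_def using finite_card_submultisets by blast
  also have "\<dots> \<le> 2 ^ j" using assms by (intro power_increasing) auto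
  finally show ?thesis by (metis of_nat_le_iff of_nat_numeral of_nat_power)
qed

text \<open>
  Records for \<open>(i, m, m2, b, c, P)\<close>: \<open>P\<close> is the pivot prime, in block \<open>i\<close>; \<open>m\<close> is \<open>m1\<close> without \<open>P\<close>;
  \<open>b\<close> and \<open>c\<close> are the parts of \<open>m1\<close> (without \<open>P\<close>) and of \<open>m2\<close> that get exchanged.
\<close>

definition pivot_data :: "nat \<Rightarrow> nat \<Rightarrow> pivot_record set" where
  "pivot_data k n = (SIGMA i:{1..k+1}. SIGMA m:ballot_predecessors k n i. SIGMA m2:ballots k n.
     SIGMA b:low_submultisets i m. SIGMA c:low_submultisets i m2. scale_block i)"

definition pivot_weight :: "pivot_record \<Rightarrow> real" where
  "pivot_weight = (\<lambda>(i, m, m2, b, c, P). mset_value b * mset_value c /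
     (mset_value m * mset_value m2 * (max (mset_value b * real P) (mset_value c))\<^sup>2))"

lemma pivot_weight_nonneg: "pivot_weight z \<ge> 0"
  by (auto simp: pivot_weight_def split_def)

lemma finite_pivot_data: "finite (pivot_data k n)"
  unfolding pivot_data_def
  by (intro finite_SigmaI finite_ballot_predecessors finite_ballots finite_low_submultisets finite_scale_block) auto

definition pivot_of :: "quadruple \<Rightarrow>
    pivot_record" where
  "pivot_of = (\<lambda>(m1, m2, m3, m4). let P = Max (set_mset ((m1 - m3) + (m3 - m1))) in
     (nat \<lfloor>prime_scale P\<rfloor>, m1 - {#P#}, m2, (m1 - m3) - {#P#}, m3 - m1, P))"

lemma pivot_of_eq:
  assumes "P = Max (set_mset ((m1 - m3) + (m3 - m1)))"
  shows "pivot_of (m1, m2, m3, m4) = (nat \<lfloor>prime_scale P\<rfloor>, m1 - {#P#}, m2, (m1 - m3) - {#P#}, m3 - m1, P)"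
  unfolding pivot_of_def assms by (simp only: prod.case Let_def)

lemma pivot_of_inj: "inj_on pivot_of (ballot_quadruples_left k n)"
proof (rule inj_onI)
  fix q q' assume q: "q \<in> ballot_quadruples_left k n" "q' \<in> ballot_quadruples_left k n" "pivot_of q = pivot_of q'"
  obtain m1 m2 m3 m4 where m: "q = (m1, m2, m3, m4)" by (cases q)
  obtain n1 n2 n3 n4 where n: "q' = (n1, n2, n3, n4)" by (cases q')
  define P where "P = Max (set_mset ((m1 - m3) + (m3 - m1)))"
  define P' where "P' = Max (set_mset ((n1 - n3) + (n3 - n1)))"
  have P: "P \<in># m1 - m3" and ms: "m1 + m2 = m3 + m4"
    using q(1) by (auto simp: m ballot_quadruples_left_def ballot_quadruples_def P_def)
  have P': "P' \<in># n1 - n3" and ns: "n1 + n2 = n3 + n4"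
    using q(2) by (auto simp: n ballot_quadruples_left_def ballot_quadruples_def P'_def)
  have e: "m1 - {#P#} = n1 - {#P'#}" "m2 = n2" "(m1 - m3) - {#P#} = (n1 - n3) - {#P'#}"
    "m3 - m1 = n3 - n1" "P = P'"
  proof -
    note eq = q(3)[unfolded m n pivot_of_eq[OF P_def] pivot_of_eq[OF P'_def] prod.inject]
    show "m1 - {#P#} = n1 - {#P'#}" "m2 = n2" "(m1 - m3) - {#P#} = (n1 - n3) - {#P'#}"
      "m3 - m1 = n3 - n1" "P = P'"
      using eq by blast+
  qed
  have "m1 = n1" using e P P' by (metis in_diffD insert_DiffM)
  have b: "m1 - m3 = n1 - n3" using e P P' by (metis insert_DiffM)
  \<comment> \<open>The shared part is recovered from \<open>m1\<close> and its exchanged part, and then \<open>m3\<close> and \<open>m4\<close> follow.\<close>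
  have "m1 \<inter># m3 = m1 - (m1 - m3)" "n1 \<inter># n3 = n1 - (n1 - n3)" by (auto intro!: multiset_eqI)
  then have "m1 \<inter># m3 = n1 \<inter># n3" using b \<open>m1 = n1\<close> by simp
  then have "m3 = n3" using multiset_sum_eq_parametrization(4)[OF ms] multiset_sum_eq_parametrization(4)[OF ns] e(4) by metis
  then have "m4 = n4" using ms ns e(2) \<open>m1 = n1\<close> by simp
  then show "q = q'" using \<open>m1 = n1\<close> \<open>m3 = n3\<close> e(2) by (simp add: m n)
qed

lemma ballots_scale_ge_1:
  assumes "M \<in> ballots k n" "p \<in># M"
  shows "1 \<le> prime_scale p"
proof (rule ccontr)
  assume "\<not> 1 \<le> prime_scale p"
  then have "p \<in># filter_mset (\<lambda>p. prime_scale p < real 0 + 1) M" using assms(2) by simp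
  moreover have "size (filter_mset (\<lambda>p. prime_scale p < real 0 + 1) M) \<le> 0"
    using assms(1) unfolding ballots_def by blast
  ultimately show False by (metis (no_types, lifting) le_zero_eq size_eq_0_iff_empty empty_iff set_mset_empty)
qed

text \<open>
  All unshared primes are at most \<open>P\<close>, hence lie in blocks up to \<open>i\<close>; this is what confines \<open>b\<close> and
  \<open>c\<close> to few submultisets.
\<close>

lemma pivot_of_in:
  assumes "q \<in> ballot_quadruples_left k (scale_cutoff (real k + 2))"
  shows "pivot_of q \<in> pivot_data k (scale_cutoff (real k + 2))"
proof -
  let ?n = "scale_cutoff (real k + 2)"
  obtain m1 m2 m3 m4 where m: "q = (m1, m2, m3, m4)" by (cases q)
  define P where "P = Max (set_mset ((m1 - m3) + (m3 - m1)))"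
  define i where "i = nat \<lfloor>prime_scale P\<rfloor>"
  have P: "P \<in># m1 - m3" and ms: "m1 + m2 = m3 + m4" and V: "m1 \<in> ballots k ?n" "m2 \<in> ballots k ?n"
    using assms by (auto simp: m ballot_quadruples_left_def ballot_quadruples_def P_def)
  have Pm1: "P \<in># m1" using P by (rule in_diffD)
  have Pn: "prime P" "P \<le> ?n" using V(1) Pm1 by (auto simp: ballots_def)
  have U: "1 \<le> prime_scale P" "prime_scale P < real k + 2"
    using ballots_scale_ge_1[OF V(1) Pm1] scale_cutoff(1)[of "real k + 2" P] Pn by auto
  have i: "real i \<le> prime_scale P" "prime_scale P < real i + 1" "1 \<le> i" "i \<le> k + 1"
    using U unfolding i_def by linarith+
  have PB: "P \<in> scale_block i" using i Pn by (simp add: scale_block_def)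
  have le: "R \<le> P" if "R \<in># (m1 - m3) + (m3 - m1)" for R
    unfolding P_def using that by (intro Max_ge) auto
  have Ule: "prime_scale R < real i + 1" if "R \<in># (m1 - m3) + (m3 - m1)" for R
    using prime_scale_mono[OF le[OF that]] i by linarith
  have filt: "filter_mset (\<lambda>p. prime_scale p < real i + 1) X = X" if "X \<subseteq># (m1 - m3) + (m3 - m1)" for X
    using Ule mset_subset_eqD[OF that] by (intro filter_mset_eq_conv[THEN iffD2]) auto
  have "m1 - {#P#} \<in> ballot_predecessors k ?n i"
    unfolding ballot_predecessors_def using PB V(1) Pm1 by (auto intro!: bexI[of _ P])
  moreover have "(m1 - m3) - {#P#} \<in> low_submultisets i (m1 - {#P#})"
  proof -
    have "(m1 - m3) - {#P#} \<subseteq># m1 - {#P#}" by (simp add: subseteq_mset_def diff_le_mono del: diff_diff_add_mset)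
    moreover have "(m1 - m3) - {#P#} \<subseteq># (m1 - m3) + (m3 - m1)"
      by (meson diff_subset_eq_self mset_subset_eq_add_left subset_mset.order_trans)
    ultimately show ?thesis unfolding low_submultisets_def
      using filt by (metis mem_Collect_eq multiset_filter_mono)
  qed
  moreover have "m3 - m1 \<in> low_submultisets i m2"
    using multiset_sum_eq_parametrization(1)[OF ms] filt[of "m3 - m1"] unfolding low_submultisets_def
    by (metis mem_Collect_eq mset_subset_eq_add_right multiset_filter_mono)
  ultimately show ?thesis using PB V(2) i(3,4)
    unfolding m pivot_of_eq[OF P_def] i_def[symmetric] pivot_data_def
    by (simp only: mem_Sigma_iff atLeastAtMost_iff simp_thms)
qed

lemma quadruple_weight_pivot:
  assumes "q \<in> ballot_quadruples_left k n"
  shows "quadruple_weight q = pivot_weight (pivot_of q)"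
proof -
  obtain m1 m2 m3 m4 where m: "q = (m1, m2, m3, m4)" by (cases q)
  define P where "P = Max (set_mset ((m1 - m3) + (m3 - m1)))"
  define a b c e where "a = m1 \<inter># m3" and "b = m1 - m3" and "c = m3 - m1" and "e = m2 - (m3 - m1)"
  have P: "P \<in># b" and ms: "m1 + m2 = m3 + m4"
    and V: "m1 \<in> ballots k n" "m2 \<in> ballots k n" "m3 \<in> ballots k n"
    using assms by (auto simp: m ballot_quadruples_left_def ballot_quadruples_def P_def b_def)
  define b' where "b' = b - {#P#}"
  have bb: "b = add_mset P b'" using P by (simp add: b'_def)
  have m1: "m1 = a + b" and m3: "m3 = a + c" and m4: "m4 = e + b" and m2: "m2 = e + c"
    using multiset_sum_eq_parametrization[OF ms] by (simp_all add: a_def b_def c_def e_def)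
  have m1': "m1 - {#P#} = a + b'" unfolding m1 bb by simp
  have pos: "prod_mset a > 0" "prod_mset b > 0" "prod_mset c > 0" "prod_mset e > 0"
    using V[THEN ballots_pos] unfolding m1 m2 m3 by auto
  then have pos': "prod_mset b' > 0" "P > 0" unfolding bb by auto
  define A B C E where "A = mset_value a" and "B = mset_value b" and "C = mset_value c" and "E = mset_value e"
  have p: "A > 0" "B > 0" "C > 0" "E > 0" using pos by (simp_all add: A_def B_def C_def E_def)
  have B: "B = mset_value b' * real P" unfolding B_def bb by simp
  have "quadruple_weight q = 1 / (max (A * B) (A * C) * max (E * C) (E * B))"
    unfolding m quadruple_weight_def m1 m2 m3 m4 by (simp add: A_def B_def C_def E_def)
  also have "max (A * B) (A * C) = A * max B C" using p by (simp add: max_mult_distrib_left)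
  also have "max (E * C) (E * B) = E * max B C" using p by (simp add: max_mult_distrib_left max.commute)
  also have "1 / (A * max B C * (E * max B C)) = mset_value b' * C / ((A * mset_value b') * (E * C) * (max B C)\<^sup>2)"
  proof -
    define B' M where "B' = mset_value b'" and "M = max B C"
    have "B' > 0" "M > 0" using pos' p by (simp_all only: B'_def M_def of_nat_0_less_iff less_max_iff_disj) simp
    then show ?thesis using p unfolding B'_def[symmetric] M_def[symmetric] by (simp add: power2_eq_square)
  qed
  also have "\<dots> = pivot_weight (pivot_of q)"
  proof -
    have "pivot_of q = (nat \<lfloor>prime_scale P\<rfloor>, a + b', e + c, b', c, P)"
      unfolding m pivot_of_eq[OF P_def] b_def[symmetric] c_def[symmetric] m1' b'_def[symmetric]
      using m2 by (simp only:)
    then show ?thesis unfolding pivot_weight_def B A_def C_def E_def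
      by (simp only: prod.case prod_mset_Un of_nat_mult)
  qed
  finally show ?thesis .
qed

text \<open>
  For fixed \<open>(i, m, m2, b, c)\<close> the sum over \<open>P\<close> is \<open>O(4 powr (- i) / (m * m2))\<close>, because
  \<open>ln P\<close> has order at least \<open>4 ^ i\<close>.  The ballot condition leaves at most \<open>2 ^ (i - 1)\<close> choices of \<open>b\<close>
  (\<open>P\<close> itself already counts among the \<open>i\<close> small primes of \<open>m1\<close>) and \<open>2 ^ i\<close> choices of \<open>c\<close>, which cancels
  \<open>4 powr (- i)\<close> exactly.
\<close>

lemma pivot_sum_le:
  obtains K where "K > 0"
    "\<And>k. (\<Sum>z\<in>pivot_data k (scale_cutoff (real k + 2)). pivot_weight z) \<le> K * real k * (ballot_sum k (scale_cutoff (real k + 2)))\<^sup>2"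
proof -
  obtain C where C: "C > 0" "\<And>n y. n \<ge> 2 \<Longrightarrow> y \<le> prime_scale n \<Longrightarrow> 4 powr y \<le> C * ln (real n)"
    using prime_scale_bounds by metis
  show ?thesis
  proof (rule that[of "28 * C"])
    fix k
    let ?n = "scale_cutoff (real k + 2)"
    let ?V = "ballots k ?n" and ?V' = "ballot_predecessors k ?n" and ?W = "ballot_sum k ?n"
    let ?p = "\<lambda>M. mset_value M"
    let ?u = "\<lambda>i m m2. 28 * C / (4 ^ i * (?p m * ?p m2))"
    let ?C = "\<lambda>i m2. SIGMA c:low_submultisets i m2. scale_block i"
    let ?B = "\<lambda>i m m2. SIGMA b:low_submultisets i m. ?C i m2"
    let ?M = "\<lambda>i m. SIGMA m2:?V. ?B i m m2"
    have "(\<Sum>z\<in>pivot_data k ?n. pivot_weight z) \<le> (\<Sum>i\<in>{1..k+1}. (\<Sum>m\<in>?V' i. 1 / ?p m) * (14 * C * ?W))"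
      unfolding pivot_data_def sum_distrib_right
    proof (intro sum_Sigma_le finite_SigmaI finite_ballot_predecessors finite_ballots finite_low_submultisets finite_scale_block finite_atLeastAtMost)
      fix i m assume i: "i \<in> {1..k+1}" and m: "m \<in> ?V' i"
      obtain Q where Q: "Q \<in> scale_block i" "add_mset Q m \<in> ?V" using m by (auto simp: ballot_predecessors_def)
      have m0: "prod_mset m > 0" using ballots_pos[OF Q(2)] by simp
      have sm: "size (filter_mset (\<lambda>p. prime_scale p < real i + 1) m) \<le> i - 1"
      proof -
        have "size (filter_mset (\<lambda>p. prime_scale p < real i + 1) (add_mset Q m)) \<le> i"
          using Q(2) unfolding ballots_def by blast
        then show ?thesis using Q(1) by (simp add: scale_block_def)
      qed
      have "(\<Sum>z\<in>?M i m. pivot_weight (i, m, z))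
        \<le> (\<Sum>m2\<in>?V. 14 * C / (?p m * ?p m2))"
      proof (intro sum_Sigma_le finite_SigmaI finite_ballots finite_low_submultisets finite_scale_block)
        fix m2 assume m2: "m2 \<in> ?V"
        have m20: "prod_mset m2 > 0" using ballots_pos[OF m2] .
        have sm2: "size (filter_mset (\<lambda>p. prime_scale p < real i + 1) m2) \<le> i"
          using m2 unfolding ballots_def by blast
        have "(\<Sum>z\<in>?B i m m2. pivot_weight (i, m, m2, z))
          \<le> (\<Sum>b\<in>low_submultisets i m. 2 ^ i * (?u i m m2))"
        proof (intro sum_Sigma_le finite_SigmaI finite_low_submultisets finite_scale_block)
          fix b assume b: "b \<in> low_submultisets i m"
          have "(\<Sum>z\<in>?C i m2. pivot_weight (i, m, m2, b, z))
            \<le> (\<Sum>c\<in>low_submultisets i m2. ?u i m m2)"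
          proof (intro sum_Sigma_le finite_low_submultisets finite_scale_block)
            fix c assume c: "c \<in> low_submultisets i m2"
            have "b \<subseteq># m" "c \<subseteq># m2" using b c unfolding low_submultisets_def
              by (meson mem_Collect_eq multiset_filter_subset subset_mset.order_trans)+
            then have "prod_mset b dvd prod_mset m" "prod_mset c dvd prod_mset m2"
              by (auto intro: prod_mset_subset_imp_dvd)
            then have b0: "prod_mset b > 0" and c0: "prod_mset c > 0" using dvd_pos_nat m0 m20 by blast+
            define B0 C0 M0 N0 where "B0 = ?p b" and "C0 = ?p c" and "M0 = ?p m" and "N0 = ?p m2"
            have pos: "B0 > 0" "C0 > 0" "M0 > 0" "N0 > 0"
              using b0 c0 m0 m20 by (simp_all only: B0_def C0_def M0_def N0_def of_nat_0_less_iff)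
            \<comment> \<open>Dividing by \<open>b\<close> reduces the comparison of \<open>b * P\<close> with \<open>c\<close> to one of \<open>P\<close> with \<open>y = c / b\<close>.\<close>
            define y where "y = C0 / B0"
            have y: "y > 0" using pos by (simp add: y_def)
            have mx: "max (B0 * real P) C0 = B0 * max (real P) y" for P
            proof -
              have "C0 = B0 * y" using pos by (simp add: y_def)
              then show ?thesis using pos by (simp add: max_mult_distrib_left)
            qed
            have "(\<Sum>P\<in>scale_block i. pivot_weight (i, m, m2, b, c, P)) =
              (\<Sum>P\<in>scale_block i. C0 / (M0 * N0 * B0) * (1 / (max (real P) y)\<^sup>2))"
              unfolding pivot_weight_def prod.case B0_def[symmetric] C0_def[symmetric] M0_def[symmetric] N0_def[symmetric] mx
              using pos by (intro sum.cong refl) (simp add: power_mult_distrib power2_eq_square)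
            also have "\<dots> = C0 / (M0 * N0 * B0) * (\<Sum>P\<in>scale_block i. 1 / (max (real P) y)\<^sup>2)"
              by (simp only: sum_distrib_left)
            also have "\<dots> \<le> C0 / (M0 * N0 * B0) * (28 / (y * ln (exp (4 ^ i / C))))"
            proof (intro mult_left_mono sum_primes_inverse_max_square_le y finite_scale_block)
              fix P assume P: "P \<in> scale_block i"
              then have pP: "prime P" by (simp add: scale_block_def)
              have "4 powr real i \<le> C * ln (real P)"
                using P by (intro C(2)) (auto simp: scale_block_def dest: prime_ge_2_nat)
              then have "4 ^ i / C \<le> ln (real P)" using C(1) by (simp add: powr_realpow field_simps)
              then have "exp (4 ^ i / C) \<le> exp (ln (real P))" by simp
              then show "prime P \<and> exp (4 ^ i / C) \<le> real P" using pP prime_gt_0_nat[OF pP] by simp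
            qed (use C(1) pos in auto)
            also have "\<dots> = ?u i m m2"
              unfolding M0_def[symmetric] N0_def[symmetric] using pos C(1) by (simp add: y_def field_simps)
            finally show "(\<Sum>P\<in>scale_block i. pivot_weight (i, m, m2, b, c, P)) \<le> ?u i m m2" .
          qed
          also have "\<dots> = real (card (low_submultisets i m2)) * (?u i m m2)" by simp
          also have "\<dots> \<le> 2 ^ i * (?u i m m2)"
            using C(1) by (intro mult_right_mono card_low_submultisets sm2) auto
          finally show "(\<Sum>z\<in>?C i m2. pivot_weight (i, m, m2, b, z))
            \<le> 2 ^ i * (?u i m m2)" .
        qed
        also have "\<dots> = real (card (low_submultisets i m)) * (2 ^ i * (?u i m m2))" by simp
        also have "\<dots> \<le> 2 ^ (i - 1) * (2 ^ i * (?u i m m2))"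
          using C(1) by (intro mult_right_mono card_low_submultisets sm) auto
        also have "\<dots> = 14 * C / (?p m * ?p m2)"
        proof -
          obtain j where j: "i = Suc j" using i by (cases i) auto
          have "(2::real) ^ (i - 1) * 2 ^ i = 4 ^ i / 2" unfolding j by (simp add: power_mult_distrib[symmetric])
          then have "2 ^ (i - 1) * (2 ^ i * (?u i m m2)) = (4 ^ i / 2) * (?u i m m2)"
            by (simp only: mult.assoc[symmetric])
          then show ?thesis by simp
        qed
        finally show "(\<Sum>z\<in>?B i m m2. pivot_weight (i, m, m2, z))
          \<le> 14 * C / (?p m * ?p m2)" .
      qed
      also have "\<dots> = 1 / ?p m * (14 * C * ?W)" by (simp add: ballot_sum_def sum_distrib_left mult_ac)
      finally show "(\<Sum>z\<in>?M i m. pivot_weight (i, m, z))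
        \<le> 1 / ?p m * (14 * C * ?W)" .
    qed
    also have "\<dots> = (\<Sum>i\<in>{1..k+1}. (\<Sum>m\<in>?V' i. 1 / ?p m)) * (14 * C * ?W)" by (rule sum_distrib_right[symmetric])
    also have "\<dots> \<le> (2 * real k * ?W) * (14 * C * ?W)"
      using C(1) by (intro mult_right_mono ballot_predecessors_sum_le) (auto simp: ballot_sum_def sum_nonneg)
    also have "\<dots> = 28 * C * real k * ?W\<^sup>2" by (simp add: power2_eq_square)
    finally show "(\<Sum>z\<in>pivot_data k ?n. pivot_weight z) \<le> 28 * C * real k * ?W\<^sup>2" .
  qed (use C(1) in simp)
qed

text \<open>
  The diagonal \<open>m1 = m3\<close>, \<open>m2 = m4\<close> gives the square of the ballot sum.  Off the diagonal the largest
  unshared prime lies on one of the two sides, and by symmetry each side is controlled by the pivot sum.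
\<close>

lemma ballot_quadruples_sum_le:
  obtains K where "K > 0"
    "\<And>k. k \<ge> 1 \<Longrightarrow> (\<Sum>q\<in>ballot_quadruples k (scale_cutoff (real k + 2)). quadruple_weight q)
       \<le> K * real k * (ballot_sum k (scale_cutoff (real k + 2)))\<^sup>2"
proof -
  obtain K where K: "K > 0"
    "\<And>k. (\<Sum>z\<in>pivot_data k (scale_cutoff (real k + 2)). pivot_weight z) \<le> K * real k * (ballot_sum k (scale_cutoff (real k + 2)))\<^sup>2"
    using pivot_sum_le by blast
  show ?thesis
  proof (rule that[of "1 + 2 * K"])
    fix k :: nat assume k: "k \<ge> 1"
    let ?n = "scale_cutoff (real k + 2)"
    let ?Q = "ballot_quadruples k ?n" and ?L = "ballot_quadruples_left k ?n" and ?V = "ballots k ?n" and ?W = "ballot_sum k ?n"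
    let ?sw = "\<lambda>(m1, m2, m3, m4). (m3, m4, m1, m2)"
    let ?D = "(\<lambda>(m1, m2). (m1, m2, m1, m2)) ` (?V \<times> ?V)"
    have finL: "finite ?L" by (rule finite_subset[OF _ finite_ballot_quadruples[of k ?n]]) (auto simp: ballot_quadruples_left_def)
    have "(\<Sum>q\<in>?L. quadruple_weight q) = (\<Sum>q\<in>?L. pivot_weight (pivot_of q))"
      by (intro sum.cong refl quadruple_weight_pivot)
    also have "\<dots> = (\<Sum>z\<in>pivot_of ` ?L. pivot_weight z)" by (simp add: sum.reindex[OF pivot_of_inj])
    also have "\<dots> \<le> (\<Sum>z\<in>pivot_data k ?n. pivot_weight z)"
      by (intro sum_mono2 finite_pivot_data pivot_weight_nonneg) (use pivot_of_in in blast)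
    also have "\<dots> \<le> K * real k * ?W\<^sup>2" by (rule K(2))
    finally have L: "(\<Sum>q\<in>?L. quadruple_weight q) \<le> K * real k * ?W\<^sup>2" .
    have R: "(\<Sum>q\<in>?sw ` ?L. quadruple_weight q) = (\<Sum>q\<in>?L. quadruple_weight q)"
    proof (subst sum.reindex)
      show "inj_on ?sw ?L" by (auto simp: inj_on_def)
      show "sum (quadruple_weight \<circ> ?sw) ?L = (\<Sum>q\<in>?L. quadruple_weight q)"
        by (intro sum.cong refl) (auto simp: quadruple_weight_def max.commute)
    qed
    have D: "(\<Sum>q\<in>?D. quadruple_weight q) = ?W\<^sup>2"
    proof (subst sum.reindex)
      show "inj_on (\<lambda>(m1, m2). (m1, m2, m1, m2)) (?V \<times> ?V)" by (auto simp: inj_on_def)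
      show "sum (quadruple_weight \<circ> (\<lambda>(m1, m2). (m1, m2, m1, m2))) (?V \<times> ?V) = ?W\<^sup>2"
        unfolding power2_eq_square ballot_sum_def sum_product sum.cartesian_product
        by (intro sum.cong refl) (auto simp: quadruple_weight_def)
    qed
    have sub: "?Q \<subseteq> ?D \<union> (?L \<union> ?sw ` ?L)"
    proof
      fix q assume q: "q \<in> ?Q"
      obtain m1 m2 m3 m4 where m: "q = (m1, m2, m3, m4)" by (cases q)
      have ms: "m1 + m2 = m3 + m4" and V: "m1 \<in> ?V" "m2 \<in> ?V" "m3 \<in> ?V" "m4 \<in> ?V"
        using q by (auto simp: m ballot_quadruples_def)
      show "q \<in> ?D \<union> (?L \<union> ?sw ` ?L)"
      proof (cases "m1 = m3")
        case True
        then show ?thesis using ms V by (auto simp: m)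
      next
        case False
        let ?X = "set_mset ((m1 - m3) + (m3 - m1))"
        have "?X \<noteq> {}"
        proof
          assume "?X = {}"
          then have "m1 - m3 = {#}" "m3 - m1 = {#}" by auto
          then have "m1 = m3" by (metis Diff_eq_empty_iff_mset subset_mset.antisym)
          then show False using False by simp
        qed
        then have "Max ?X \<in> ?X" by (intro Max_in) auto
        then have "Max ?X \<in># m1 - m3 \<or> Max ?X \<in># m3 - m1" by auto
        then show ?thesis
        proof
          assume "Max ?X \<in># m1 - m3"
          then have "q \<in> ?L" using q False by (auto simp: m ballot_quadruples_left_def)
          then show ?thesis by simp
        next
          assume "Max ?X \<in># m3 - m1"
          then have "Max (set_mset ((m3 - m1) + (m1 - m3))) \<in># m3 - m1" by (metis add.commute)
          then have "(m3, m4, m1, m2) \<in> ?L"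
            using V ms False by (auto simp: ballot_quadruples_left_def ballot_quadruples_def)
          then have "?sw (m3, m4, m1, m2) \<in> ?sw ` ?L" by (rule imageI)
          then show ?thesis by (simp add: m)
        qed
      qed
    qed
    have "(\<Sum>q\<in>?Q. quadruple_weight q) \<le> (\<Sum>q\<in>?D \<union> (?L \<union> ?sw ` ?L). quadruple_weight q)"
      by (intro sum_mono2 sub quadruple_weight_nonneg) (auto simp: finL finite_ballots)
    also have "\<dots> \<le> (\<Sum>q\<in>?D. quadruple_weight q) + (\<Sum>q\<in>?L \<union> ?sw ` ?L. quadruple_weight q)"
      by (subst sum_Un) (auto simp: finL finite_ballots intro!: sum_nonneg quadruple_weight_nonneg)
    also have "(\<Sum>q\<in>?L \<union> ?sw ` ?L. quadruple_weight q) \<le> (\<Sum>q\<in>?L. quadruple_weight q) + (\<Sum>q\<in>?sw ` ?L. quadruple_weight q)"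
      by (subst sum_Un) (auto simp: finL intro!: sum_nonneg quadruple_weight_nonneg)
    finally have "(\<Sum>q\<in>?Q. quadruple_weight q) \<le> 1 * ?W\<^sup>2 + 2 * (K * real k * ?W\<^sup>2)" using D L R by linarith
    also have "1 * ?W\<^sup>2 \<le> real k * ?W\<^sup>2" using k by (intro mult_right_mono) auto
    finally show "(\<Sum>q\<in>?Q. quadruple_weight q) \<le> (1 + 2 * K) * real k * ?W\<^sup>2" by (simp add: algebra_simps)
  qed (use K(1) in simp)
qed

section \<open>Size of the ballot sum\<close>

text \<open>
  The derivative of the difference is \<open>t\<^sup>2 / ((1 + t) * (2 + t)\<^sup>2)\<close>.
\<close>

lemma ln_add_one_ge_pade:
  fixes t :: real
  assumes "t \<ge> 0"
  shows "2 * t / (2 + t) \<le> ln (1 + t)"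
proof -
  let ?f = "\<lambda>s::real. ln (1 + s) - 2 * s / (2 + s)"
  have "?f 0 \<le> ?f t"
  proof (rule DERIV_nonneg_imp_nondecreasing[OF assms])
    fix s :: real assume s: "0 \<le> s" "s \<le> t"
    have "(?f has_real_derivative (1 / (1 + s) - (2 * (2 + s) - 2 * s) / (2 + s)\<^sup>2)) (at s)"
      using s by (auto intro!: derivative_eq_intros simp: power2_eq_square)
    moreover have "1 / (1 + s) - (2 * (2 + s) - 2 * s) / (2 + s)\<^sup>2 = s\<^sup>2 / ((1 + s) * (2 + s)\<^sup>2)"
      using s by (simp add: divide_simps) (simp add: power2_eq_square algebra_simps)
    moreover have "0 \<le> s\<^sup>2 / ((1 + s) * (2 + s)\<^sup>2)" using s by auto
    ultimately show "\<exists>y. (?f has_real_derivative y) (at s) \<and> 0 \<le> y" by metis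
  qed
  then show ?thesis by simp
qed

text \<open>
  The induction step is \<open>1 \<le> (k + 1 / 2) * ln (1 + 1 / k)\<close>, the Pade bound at \<open>t = 1 / k\<close>.  The exact
  exponent \<open>1 / 2\<close> of \<open>k\<close> matters for the final power of the iterated logarithm.
\<close>

lemma ln_fact_upper_stirling:
  assumes "k \<ge> 1"
  shows "ln (fact k) \<le> 1 + ln (real k) / 2 + real k * ln (real k) - real k"
  using assms
proof (induction k rule: nat_induct_at_least)
  case base
  then show ?case by simp
next
  case (Suc k)
  define x where "x = real k"
  have x: "x \<ge> 1" using Suc(1) by (simp add: x_def)
  have l: "1 \<le> (x + 1 / 2) * (ln (x + 1) - ln x)"
  proof -
    have "(x + 1 / 2) * (2 * (1 / x) / (2 + 1 / x)) \<le> (x + 1 / 2) * ln (1 + 1 / x)"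
      using x by (intro mult_left_mono ln_add_one_ge_pade) auto
    moreover have "ln (1 + 1 / x) = ln (x + 1) - ln x"
      using x ln_div[of "x + 1" x] by (simp add: add_divide_distrib)
    moreover have "(x + 1 / 2) * (2 * (1 / x) / (2 + 1 / x)) = 1"
    proof -
      have "x * 2 + 1 \<noteq> 0" using x by linarith
      then show ?thesis using x by (simp add: divide_simps)
    qed
    ultimately show ?thesis by (simp only:)
  qed
  have "ln (fact (Suc k) :: real) = ln (x + 1) + ln (fact k)"
    by (simp add: ln_mult x_def add.commute)
  then have "ln (fact (Suc k) :: real) \<le> ln (x + 1) + 1 + ln x / 2 + x * ln x - x"
    using Suc(2) by (simp add: x_def)
  also have "\<dots> \<le> 1 + ln (x + 1) / 2 + (x + 1) * ln (x + 1) - (x + 1)"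
    using l by (simp add: algebra_simps)
  finally show ?case by (simp add: x_def add.commute)
qed

text \<open>
  The last identity identifies \<open>(e * ln 4) ^ (2 * k)\<close>, the growth of the squared ballot sum, with the
  power \<open>2 - delta\<close> of \<open>4 ^ k\<close>.
\<close>

lemma delta_bounds: "0 \<le> delta" "delta \<le> 1" "(2 - delta) * ln 4 = 2 * (1 + ln (ln 4))"
proof -
  have l2: "ln (2::real) > 0" by simp
  have l4: "ln (4::real) = 2 * ln 2" using ln_realpow[of 2 2] by simp
  have "ln (ln (2::real)) \<le> ln 2 - 1" using l2 by (intro ln_le_minus_one)
  then show "0 \<le> delta" using l2 by (simp add: delta_def)
  have h: "ln (2::real) \<ge> 1 / 2" using ln_4_ge_1 l4 by simp
  have "ln (1 / 2) \<le> ln (ln (2::real))" using h by (intro ln_mono) auto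
  then have "- ln 2 \<le> ln (ln (2::real))" by (simp add: ln_div)
  then have "0 \<le> 1 + ln (ln (2::real))" using ln_2_less_1 by linarith
  then show "delta \<le> 1" using l2 by (simp add: delta_def)
  have "ln (ln (4::real)) = ln 2 + ln (ln 2)" unfolding l4 using l2 by (simp add: ln_mult)
  then show "(2 - delta) * ln 4 = 2 * (1 + ln (ln 4))"
    unfolding l4 delta_def using l2 by (simp add: field_simps)
qed

text \<open>
  At scale \<open>k + 1\<close> the Abel polynomial is \<open>(k + 1) ^ (k - 1) / fact k\<close>, of order
  \<open>exp k / k powr (3 / 2)\<close> by Stirling.
\<close>

lemma ballot_sum_cutoff_lower:
  assumes "k \<ge> 1"
  shows "ballot_sum k (scale_cutoff (real k + 2)) > 0"
    "(4 ^ k) powr (2 - delta) \<le> exp 2 * real k ^ 3 * (ballot_sum k (scale_cutoff (real k + 2)))\<^sup>2"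
proof -
  let ?n = "scale_cutoff (real k + 2)" and ?W = "ballot_sum k (scale_cutoff (real k + 2))"
  have l4: "ln (4::real) > 0" by simp
  have U: "real k + 1 \<le> prime_scale ?n" using scale_cutoff(2)[of "real k + 2"] by simp
  obtain j where j: "k = Suc j" using assms by (cases k) auto
  have "real k ^ j / fact k \<le> (real k + 1) ^ j / fact k"
    by (intro divide_right_mono power_mono) auto
  also have "\<dots> = ballot_volume k (real k + 1)" unfolding j by simp
  also have "\<dots> \<le> ballot_volume k (prime_scale ?n)" using U by (intro ballot_volume_mono) auto
  finally have "ln 4 ^ k * (real k ^ j / fact k) \<le> ln 4 ^ k * ballot_volume k (prime_scale ?n)"
    by (intro mult_left_mono) auto
  also have "\<dots> \<le> ?W" using U by (intro ballot_sum_lower) simp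
  finally have W: "ln 4 ^ k * (real k ^ j / fact k) \<le> ?W" .
  have pos: "0 < ln 4 ^ k * (real k ^ j / fact k)" using assms by simp
  then show W0: "?W > 0" using W by linarith
  have k0: "real k > 0" using assms by simp
  have "ln (ln 4 ^ k * (real k ^ j / fact k)) = real k * ln (ln 4) + (real j * ln (real k) - ln (fact k))"
  proof -
    have "ln (ln 4 ^ k * (real k ^ j / fact k)) = ln (ln 4 ^ k) + ln (real k ^ j / fact k)"
      using k0 by (intro ln_mult_pos) auto
    moreover have "ln (ln 4 ^ k) = real k * ln (ln (4::real))" by (rule ln_realpow)
    moreover have "ln (real k ^ j / fact k) = ln (real k ^ j) - ln (fact k)" using k0 by (simp add: ln_div)
    moreover have "ln (real k ^ j) = real j * ln (real k)" using k0 by (intro ln_realpow)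
    ultimately show ?thesis by simp
  qed
  moreover have "ln (ln 4 ^ k * (real k ^ j / fact k)) \<le> ln ?W" using W pos by (intro ln_mono) auto
  moreover have "real j = real k - 1" using j by simp
  ultimately have "real k * ln (ln 4) + ((real k - 1) * ln (real k) - ln (fact k)) \<le> ln ?W" by simp
  then have lnW: "real k * ln (ln 4) + real k - 1 - 3 / 2 * ln (real k) \<le> ln ?W"
    using ln_fact_upper_stirling[OF assms] by (simp add: algebra_simps)
  have "(4 ^ k) powr (2 - delta) = exp (real k * ((2 - delta) * ln 4))"
    by (simp add: powr_def ln_realpow mult_ac)
  also have "\<dots> = exp (2 * real k * (1 + ln (ln 4)))" unfolding delta_bounds(3) by (simp add: mult_ac)
  also have "\<dots> \<le> exp (2 + 3 * ln (real k) + 2 * ln ?W)" using lnW by (simp add: algebra_simps)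
  also have "\<dots> = exp 2 * exp (3 * ln (real k)) * exp (2 * ln ?W)" by (simp add: exp_add)
  also have "exp (3 * ln (real k)) = real k ^ 3" using k0 exp_of_nat_mult[of 3 "ln (real k)"] by simp
  also have "exp (2 * ln ?W) = ?W\<^sup>2" using W0 exp_of_nat_mult[of 2 "ln ?W"] by simp
  finally show "(4 ^ k) powr (2 - delta) \<le> exp 2 * real k ^ 3 * ?W\<^sup>2" .
qed

section \<open>From ballot multisets to integers\<close>

definition energy_quadruples :: "nat set \<Rightarrow> ((nat \<times> nat) \<times> (nat \<times> nat)) set" where
  "energy_quadruples A = {(z, w). z \<in> A \<times> A \<and> w \<in> A \<times> A \<and> fst z * snd z = fst w * snd w}"

lemma finite_energy_quadruples: "finite A \<Longrightarrow> finite (energy_quadruples A)"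
  by (rule finite_subset[of _ "(A \<times> A) \<times> (A \<times> A)"]) (auto simp: energy_quadruples_def)

text \<open>
  The normalised indicator function of \<open>A\<close> is an admissible weight vector.
\<close>

lemma mult_energy_le_set:
  assumes "A \<subseteq> {1..N}" "A \<noteq> {}"
  shows "mult_energy N \<le> real N ^ 2 * real (card (energy_quadruples A)) / real (card A) ^ 4"
proof -
  have fin: "finite A" using assms(1) finite_subset by blast
  define T where "T = real (card A)"
  have T: "T > 0" using assms(2) fin by (simp add: T_def card_gt_0_iff)
  define c where "c = (\<lambda>n. if n \<in> A then 1 / T else 0)"
  have c: "c \<in> unit_weights N"
  proof -
    have "(\<Sum>n=1..N. \<bar>c n\<bar>) = (\<Sum>n\<in>{1..N}. if n \<in> A then 1 / T else 0)"
      using T by (intro sum.cong) (auto simp: c_def)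
    also have "\<dots> = (\<Sum>n\<in>{1..N} \<inter> A. 1 / T)" by (rule sum.inter_restrict[symmetric]) simp
    also have "{1..N} \<inter> A = A" using assms(1) by blast
    finally have "(\<Sum>n=1..N. \<bar>c n\<bar>) = 1" using T by (simp add: T_def)
    then show ?thesis using T by (auto simp: unit_weights_def c_def)
  qed
  define R where "R n = {z \<in> A \<times> A. fst z * snd z = n}" for n
  have finR: "finite (R n)" for n using fin by (auto simp: R_def)
  have inner: "(\<Sum>(d, t)\<in>{(d, t). d \<in> {1..N} \<and> t \<in> {1..N} \<and> d * t = n}. c d * c t) = real (card (R n)) / T ^ 2" for n
  proof -
    let ?S = "{(d, t). d \<in> {1..N} \<and> t \<in> {1..N} \<and> d * t = n}"
    have "finite ?S" by (rule finite_subset[of _ "{1..N} \<times> {1..N}"]) auto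
    then have "(\<Sum>(d, t)\<in>?S. c d * c t) = (\<Sum>(d, t)\<in>R n. c d * c t)"
      using assms(1) by (intro sum.mono_neutral_right) (auto simp: R_def c_def split: if_splits)
    also have "\<dots> = (\<Sum>z\<in>R n. 1 / T ^ 2)"
      by (intro sum.cong refl) (auto simp: R_def c_def power2_eq_square)
    finally show ?thesis by simp
  qed
  have "mult_energy N \<le> real N ^ 2 * (\<Sum>n=1..N^2. (\<Sum>(d, t)\<in>{(d, t). d \<in> {1..N} \<and> t \<in> {1..N} \<and> d * t = n}. c d * c t) ^ 2)"
    unfolding mult_energy_def
    by (rule cINF_lower[OF bdd_belowI2[of _ 0] c]) (rule mult_nonneg_nonneg, simp, rule sum_nonneg, simp)
  also have "\<dots> = real N ^ 2 * ((\<Sum>n=1..N^2. real (card (R n)) ^ 2) / T ^ 4)"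
    unfolding inner by (simp add: power_divide sum_divide_distrib flip: power_mult)
  also have "(\<Sum>n=1..N^2. real (card (R n)) ^ 2) = real (\<Sum>n=1..N^2. card (R n \<times> R n))"
    by (simp add: card_cartesian_product power2_eq_square)
  also have "(\<Sum>n=1..N^2. card (R n \<times> R n)) = card (\<Union>n\<in>{1..N^2}. R n \<times> R n)"
    by (rule card_UN_disjoint[symmetric]) (auto simp: finR, auto simp: R_def)
  also have "\<dots> \<le> card (energy_quadruples A)"
    by (intro card_mono finite_energy_quadruples fin) (auto simp: R_def energy_quadruples_def)
  finally have "mult_energy N \<le> real N ^ 2 * (real (card (energy_quadruples A)) / T ^ 4)"
    using T by (simp add: divide_right_mono mult_left_mono)
  then show ?thesis by (simp add: T_def)
qed

text \<open>
  The pair \<open>(M, P)\<close> stands for the integer \<open>P * prod_mset M\<close>, whose largest prime factor is \<open>P\<close>; the pair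
  can be read off from this integer.
\<close>

definition ballot_pairs :: "nat \<Rightarrow> nat \<Rightarrow> nat \<Rightarrow> (nat multiset \<times> nat) set" where
  "ballot_pairs k n N = (SIGMA M:ballots k n. {P. prime P \<and> n < P \<and> P * prod_mset M \<le> N})"

definition pair_value :: "nat multiset \<times> nat \<Rightarrow> nat" where
  "pair_value z = snd z * prod_mset (fst z)"

lemma doubleton_mset_eq:
  assumes "{#a, b#} = {#c, d#}"
  shows "a = c \<and> b = d \<or> a = d \<and> b = c"
proof -
  have "a \<in># {#a, b#}" by simp
  then have "a \<in># {#c, d#}" using assms by (simp only:)
  then consider "a = c" | "a = d" by auto
  then show ?thesis
  proof cases
    case 1
    then show ?thesis using assms by simp
  next
    case 2
    then have "add_mset a {#b#} = add_mset a {#c#}" using assms by (simp add: add_mset_commute)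
    then show ?thesis using 2 by simp
  qed
qed

lemma finite_primes_with_bounded_multiple:
  fixes m :: nat
  assumes "m > 0"
  shows "finite {P. prime P \<and> n < P \<and> P * m \<le> N}"
proof (rule finite_subset)
  show "{P. prime P \<and> n < P \<and> P * m \<le> N} \<subseteq> {..N}"
  proof clarify
    fix P assume "P * m \<le> N"
    moreover have "P * 1 \<le> P * m" using assms by (intro mult_le_mono2) simp
    ultimately show "P \<le> N" by linarith
  qed
qed simp

text \<open>
  Unique factorization: the primes up to \<open>n\<close> and those beyond \<open>n\<close> can be compared separately.
\<close>

lemma ballot_pairs_product_eq:
  assumes z: "(M1, P1) \<in> ballot_pairs k n N" "(M2, P2) \<in> ballot_pairs k n N"
    "(M3, P3) \<in> ballot_pairs k n N" "(M4, P4) \<in> ballot_pairs k n N"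
    and eq: "pair_value (M1, P1) * pair_value (M2, P2) = pair_value (M3, P3) * pair_value (M4, P4)"
  shows "M1 + M2 = M3 + M4" "P1 = P3 \<and> P2 = P4 \<or> P1 = P4 \<and> P2 = P3"
proof -
  let ?X = "{#P1, P2#} + (M1 + M2)" and ?Y = "{#P3, P4#} + (M3 + M4)"
  have pr: "prime p" "p \<le> n" if "p \<in># M1 + M2 + (M3 + M4)" for p
    using z that by (auto simp: ballot_pairs_def ballots_def)
  have prP: "prime p" "\<not> p \<le> n" if "p \<in># {#P1, P2#} + {#P3, P4#}" for p
    using z that by (auto simp: ballot_pairs_def)
  have "prime_factorization (prod_mset ?X) = ?X"
    by (rule prime_factorization_prod_mset_primes) (use pr(1) prP(1) in auto)
  moreover have "prime_factorization (prod_mset ?Y) = ?Y"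
    by (rule prime_factorization_prod_mset_primes) (use pr(1) prP(1) in auto)
  moreover have "prod_mset ?X = prod_mset ?Y" using eq by (simp add: pair_value_def mult_ac)
  ultimately have XY: "?X = ?Y" by metis
  have fl: "filter_mset (\<lambda>p. p \<le> n) (M1 + M2) = M1 + M2" "filter_mset (\<lambda>p. p \<le> n) (M3 + M4) = M3 + M4"
    by (simp_all only: filter_mset_eq_conv) (use pr(2) in auto)
  have fP: "filter_mset (\<lambda>p. p \<le> n) {#P1, P2#} = {#}" "filter_mset (\<lambda>p. p \<le> n) {#P3, P4#} = {#}"
    using prP(2) by auto
  have "filter_mset (\<lambda>p. p \<le> n) ?X = filter_mset (\<lambda>p. p \<le> n) ?Y" using XY by (rule arg_cong)
  then show M: "M1 + M2 = M3 + M4" unfolding filter_union_mset fl[unfolded filter_union_mset] fP by simp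
  then have "{#P1, P2#} = {#P3, P4#}" using XY by (metis add_right_cancel)
  then show "P1 = P3 \<and> P2 = P4 \<or> P1 = P4 \<and> P2 = P3" by (rule doubleton_mset_eq)
qed

lemma pair_value_inj: "inj_on pair_value (ballot_pairs k n N)"
proof (rule inj_onI)
  fix z w assume zw: "z \<in> ballot_pairs k n N" "w \<in> ballot_pairs k n N" "pair_value z = pair_value w"
  obtain M P where z: "z = (M, P)" by (cases z)
  obtain M' P' where w: "w = (M', P')" by (cases w)
  have "M + M = M' + M'" "P = P' \<and> P = P' \<or> P = P' \<and> P = P'"
    using ballot_pairs_product_eq[of M P k n N M P M' P' M' P'] zw by (auto simp: z w)
  moreover have "M = M'"
  proof (rule multiset_eqI)
    fix x
    have "count (M + M) x = count (M' + M') x" using \<open>M + M = M' + M'\<close> by simp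
    then show "count M x = count M' x" by simp
  qed
  ultimately show "z = w" by (simp add: z w)
qed

lemma pair_value_image_subset: "pair_value ` ballot_pairs k n N \<subseteq> {1..N}"
proof
  fix d assume "d \<in> pair_value ` ballot_pairs k n N"
  then obtain M P where M: "M \<in> ballots k n" "prime P" "P * prod_mset M \<le> N" "d = P * prod_mset M"
    by (auto simp: ballot_pairs_def pair_value_def)
  then show "d \<in> {1..N}" using ballots_pos[OF M(1)] prime_gt_0_nat[OF M(2)] by simp
qed

definition quotient_primes :: "nat \<Rightarrow> real \<Rightarrow> nat set" where
  "quotient_primes N X = {P. prime P \<and> real P \<le> real N / X}"

abbreviation matched_primes ::
    "nat \<Rightarrow> quadruple \<Rightarrow> (nat \<times> nat) set" where
  "matched_primes N q \<equiv> (case q of (m1, m2, m3, m4) \<Rightarrow>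
     quotient_primes N (max (mset_value m1) (mset_value m3)) \<times>
     quotient_primes N (max (mset_value m2) (mset_value m4)))"

lemma finite_quotient_primes: "finite (quotient_primes N X)"
  unfolding quotient_primes_def
  by (rule finite_subset[of _ "{..nat \<lfloor>real N / X\<rfloor>}"]) (auto simp: le_nat_floor)

text \<open>
  The large primes on both sides agree up to order.  Either order determines the solution from an
  equation between ballot multisets and two primes \<open>P1\<close>, \<open>P2\<close>, each paired with two multisets, whence
  the maximum in the range of the primes.
\<close>

lemma card_energy_quadruples_le:
  fixes k n N :: nat
  defines "S \<equiv> SIGMA q:ballot_quadruples k n. matched_primes N q"
  shows "card (energy_quadruples (pair_value ` ballot_pairs k n N)) \<le> 2 * card S"
proof -
  note finp = finite_quotient_primes
  have finS: "finite S" unfolding S_def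
    by (intro finite_SigmaI finite_ballot_quadruples) (auto simp: finp)
  define f1 where "f1 = (\<lambda>((m1, m2, m3, m4), (P1, P2)).
     ((pair_value (m1, P1), pair_value (m2, P2)), (pair_value (m3, P1), pair_value (m4, P2))))"
  define f2 where "f2 = (\<lambda>((m1, m2, m3, m4), (P1, P2)).
     ((pair_value (m1, P1), pair_value (m2, P2)), (pair_value (m4, P2), pair_value (m3, P1))))"
  have pp: "P \<in> quotient_primes N (max (mset_value M) (mset_value M'))"
    if "(M, P) \<in> ballot_pairs k n N" "(M', P) \<in> ballot_pairs k n N" for M M' P
  proof -
    have *: "real P * mset_value X \<le> real N \<and> mset_value X > 0" if "(X, P) \<in> ballot_pairs k n N" for X
    proof -
      have "X \<in> ballots k n" "P * prod_mset X \<le> N" using that by (auto simp: ballot_pairs_def)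
      then show ?thesis using ballots_pos by (metis of_nat_0_less_iff of_nat_le_iff of_nat_mult)
    qed
    have "prime P" using that by (auto simp: ballot_pairs_def)
    moreover have "real P \<le> real N / max (mset_value M) (mset_value M')"
      using *[OF that(1)] *[OF that(2)] by (auto simp: max_def field_simps)
    ultimately show ?thesis by (simp add: quotient_primes_def)
  qed
  have V: "M \<in> ballots k n" if "(M, P) \<in> ballot_pairs k n N" for M P
    using that by (auto simp: ballot_pairs_def)
  have "energy_quadruples (pair_value ` ballot_pairs k n N) \<subseteq> f1 ` S \<union> f2 ` S"
  proof
    fix u assume u: "u \<in> energy_quadruples (pair_value ` ballot_pairs k n N)"
    obtain M1 P1 M2 P2 M3 P3 M4 P4 where
      z: "(M1, P1) \<in> ballot_pairs k n N" "(M2, P2) \<in> ballot_pairs k n N"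
        "(M3, P3) \<in> ballot_pairs k n N" "(M4, P4) \<in> ballot_pairs k n N"
      and ueq: "u = ((pair_value (M1, P1), pair_value (M2, P2)), (pair_value (M3, P3), pair_value (M4, P4)))"
      and eq: "pair_value (M1, P1) * pair_value (M2, P2) = pair_value (M3, P3) * pair_value (M4, P4)"
      using u by (auto simp: energy_quadruples_def)
    note * = ballot_pairs_product_eq[OF z eq]
    from *(2) show "u \<in> f1 ` S \<union> f2 ` S"
    proof
      assume P: "P1 = P3 \<and> P2 = P4"
      have "((M1, M2, M3, M4), (P1, P2)) \<in> S"
        unfolding S_def using z P *(1) by (auto simp: ballot_quadruples_def intro!: V pp)
      moreover have "u = f1 ((M1, M2, M3, M4), (P1, P2))" using P by (simp add: f1_def ueq)
      ultimately show ?thesis by blast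
    next
      assume P: "P1 = P4 \<and> P2 = P3"
      have "((M1, M2, M4, M3), (P1, P2)) \<in> S"
        unfolding S_def using z P *(1) by (auto simp: ballot_quadruples_def add.commute intro!: V pp)
      moreover have "u = f2 ((M1, M2, M4, M3), (P1, P2))" using P by (simp add: f2_def ueq)
      ultimately show ?thesis by blast
    qed
  qed
  then have "card (energy_quadruples (pair_value ` ballot_pairs k n N)) \<le> card (f1 ` S \<union> f2 ` S)"
    using finS by (intro card_mono) auto
  also have "\<dots> \<le> card (f1 ` S) + card (f2 ` S)" by (rule card_Un_le)
  also have "\<dots> \<le> card S + card S" by (intro add_mono card_image_le finS)
  finally show "card (energy_quadruples (pair_value ` ballot_pairs k n N)) \<le> 2 * card S" by simp
qed

lemma card_quotient_primes_le:
  assumes "X \<ge> 1" "X\<^sup>2 \<le> real N" "N \<ge> 2"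
  shows "real (card (quotient_primes N X)) \<le> 14 * real N / ln (real N) * (1 / X)"
proof -
  have lN: "ln (real N) > 0" using assms(3) by simp
  have "X * 1 \<le> X * X" using assms(1) by (intro mult_left_mono) auto
  then have XN: "X \<le> real N" using assms(2) by (simp add: power2_eq_square)
  have "2 * ln X = ln (X\<^sup>2)" using assms(1) by (simp add: ln_realpow)
  also have "\<dots> \<le> ln (real N)" using assms by (intro ln_mono) auto
  finally have "ln (real N) / 2 \<le> ln (real N / X)" using assms by (simp add: ln_div)
  then have "real (card (quotient_primes N X)) * (ln (real N) / 2) \<le> real (card (quotient_primes N X)) * ln (real N / X)"
    by (intro mult_left_mono) auto
  also have "\<dots> \<le> 7 * (real N / X)" unfolding quotient_primes_def
    using assms(1) XN by (intro prime_counting_upper) simp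
  finally show ?thesis using lN assms(1) by (simp add: field_simps)
qed

text \<open>
  The number of primes up to \<open>N / X\<close> is \<open>O(N / (X * ln N))\<close> for \<open>X \<le> sqrt N\<close>, so counting \<open>P1\<close> and
  \<open>P2\<close> leaves the reduced energy sum.
\<close>

lemma card_energy_quadruples_bound:
  assumes "\<And>M. M \<in> ballots k n \<Longrightarrow> (prod_mset M)\<^sup>2 \<le> N" "N \<ge> 2"
  shows "real (card (energy_quadruples (pair_value ` ballot_pairs k n N))) \<le>
     2 * (14 * real N / ln (real N))\<^sup>2 * (\<Sum>q\<in>ballot_quadruples k n. quadruple_weight q)"
proof -
  define D where "D = 14 * real N / ln (real N)"
  let ?S = "SIGMA q:ballot_quadruples k n. matched_primes N q"
  have pb: "real (card (quotient_primes N (max (mset_value m) (mset_value m')))) \<le>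
     D * (1 / max (mset_value m) (mset_value m'))"
    if "m \<in> ballots k n" "m' \<in> ballots k n" for m m'
    unfolding D_def
  proof (rule card_quotient_primes_le)
    show "1 \<le> max (mset_value m) (mset_value m')"
      using ballots_pos[OF that(1)] by (simp add: le_max_iff_disj Suc_le_eq del: prod_mset_zero_iff)
    have "mset_value m ^ 2 \<le> real N" "mset_value m' ^ 2 \<le> real N"
      using assms(1)[OF that(1)] assms(1)[OF that(2)] by (metis of_nat_le_iff of_nat_power)+
    then show "(max (mset_value m) (mset_value m'))\<^sup>2 \<le> real N" by (simp add: max_def)
  qed fact
  have "real (card ?S) = (\<Sum>q\<in>ballot_quadruples k n. real (card (matched_primes N q)))"
  proof -
    note finp = finite_quotient_primes
    show ?thesis by (subst card_SigmaI) (auto simp: finite_ballot_quadruples finp)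
  qed
  also have "\<dots> \<le> (\<Sum>q\<in>ballot_quadruples k n. D\<^sup>2 * quadruple_weight q)"
  proof (rule sum_mono)
    fix q assume q: "q \<in> ballot_quadruples k n"
    obtain m1 m2 m3 m4 where m: "q = (m1, m2, m3, m4)" by (cases q)
    have V: "m1 \<in> ballots k n" "m2 \<in> ballots k n" "m3 \<in> ballots k n" "m4 \<in> ballots k n"
      using q by (auto simp: m ballot_quadruples_def)
    let ?X = "max (mset_value m1) (mset_value m3)" and ?Y = "max (mset_value m2) (mset_value m4)"
    have "real (card (quotient_primes N ?X)) * real (card (quotient_primes N ?Y)) \<le> (D * (1 / ?X)) * (D * (1 / ?Y))"
    proof (rule mult_mono)
      show "0 \<le> D * (1 / ?X)" using pb[OF V(1,3)] by linarith
    qed (use pb V in auto)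
    also have "\<dots> = D\<^sup>2 * quadruple_weight q" by (simp add: m quadruple_weight_def power2_eq_square)
    finally show "real (card (matched_primes N q)) \<le> D\<^sup>2 * quadruple_weight q"
      by (simp add: m card_cartesian_product)
  qed
  also have "\<dots> = D\<^sup>2 * (\<Sum>q\<in>ballot_quadruples k n. quadruple_weight q)" by (rule sum_distrib_left[symmetric])
  finally have "2 * real (card ?S) \<le> 2 * D\<^sup>2 * (\<Sum>q\<in>ballot_quadruples k n. quadruple_weight q)" by simp
  moreover have "real (card (energy_quadruples (pair_value ` ballot_pairs k n N))) \<le> 2 * real (card ?S)"
    using of_nat_mono[OF card_energy_quadruples_le[of k n N], where 'a = real] by simp
  ultimately show ?thesis unfolding D_def by linarith
qed

text \<open>
  Already the primes \<open>P\<close> within a constant factor of \<open>N / m\<close> suffice, and these exceed \<open>n\<close>.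
\<close>

lemma card_ballot_pairs_lower:
  assumes "\<And>M. M \<in> ballots k n \<Longrightarrow> (prod_mset M)\<^sup>2 \<le> N"
    "exp 26 \<le> real N" "real n * exp 13 \<le> sqrt (real N)"
  shows "real N / (exp 13 * ln (real N)) * ballot_sum k n \<le> real (card (ballot_pairs k n N))"
proof -
  have N0: "real N > 0" using assms(2) exp_gt_zero[of 26] by linarith
  have sN: "exp 13 \<le> sqrt (real N)"
  proof (rule real_le_rsqrt)
    show "(exp 13)\<^sup>2 \<le> real N" using assms(2) by (simp add: power2_eq_square flip: exp_add)
  qed
  have each: "real N / (exp 13 * ln (real N)) * (1 / mset_value M) \<le> real (card {P. prime P \<and> n < P \<and> P * prod_mset M \<le> N})"
    if M: "M \<in> ballots k n" for M
  proof -
    define m where "m = mset_value M"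
    have m1: "m \<ge> 1" using ballots_pos[OF M] by (simp add: m_def Suc_le_eq del: prod_mset_zero_iff)
    have "m\<^sup>2 \<le> real N" using assms(1)[OF M] unfolding m_def by (metis of_nat_le_iff of_nat_power)
    then have ms: "m \<le> sqrt (real N)" by (rule real_le_rsqrt)
    define y where "y = real N / m"
    have "sqrt (real N) * m \<le> sqrt (real N) * sqrt (real N)" using ms by (intro mult_left_mono) auto
    then have ys: "sqrt (real N) \<le> y" using m1 N0 by (simp add: y_def field_simps)
    have y13: "exp 13 \<le> y" using sN ys by linarith
    have y0: "y > 0" using y13 exp_gt_zero[of 13] by linarith
    have yN: "y \<le> real N" using m1 N0 by (simp add: y_def field_simps)
    have "exp (13::real) > 1" by simp
    then have y1: "y > 1" using y13 by linarith
    have ly: "ln y > 0" "ln y \<le> ln (real N)" using y1 yN by (auto intro!: ln_mono)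
    have "ln (real N) > 0" using ly by linarith
    then have "y / (exp 13 * ln (real N)) \<le> y / (exp 13 * ln y)"
      by (intro divide_left_mono mult_left_mono mult_pos_pos ly less_imp_le[OF y0]) simp_all
    also have "\<dots> \<le> real (card {p. prime p \<and> y / exp 13 < real p \<and> real p \<le> y})"
      by (rule prime_counting_interval_lower[OF y13])
    also have "\<dots> \<le> real (card {P. prime P \<and> n < P \<and> P * prod_mset M \<le> N})"
    proof -
      have "{p. prime p \<and> y / exp 13 < real p \<and> real p \<le> y} \<subseteq> {P. prime P \<and> n < P \<and> P * prod_mset M \<le> N}"
      proof clarify
        fix p :: nat assume p: "prime p" "y / exp 13 < real p" "real p \<le> y"
        have "real n * exp 13 \<le> y" using assms(3) ys by linarith
        then have "real n \<le> y / exp 13" by (simp add: field_simps)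
        then have "n < p" using p(2) by linarith
        moreover have "real p * m \<le> real N" using p(3) m1 by (simp add: y_def field_simps)
        then have "p * prod_mset M \<le> N" unfolding m_def by (metis of_nat_le_iff of_nat_mult)
        ultimately show "n < p \<and> p * prod_mset M \<le> N" by blast
      qed
      moreover have "finite {P. prime P \<and> n < P \<and> P * prod_mset M \<le> N}"
        by (intro finite_primes_with_bounded_multiple ballots_pos[OF M])
      ultimately show ?thesis by (intro of_nat_mono card_mono)
    qed
    finally show ?thesis by (simp add: y_def m_def mult_ac)
  qed
  have "real N / (exp 13 * ln (real N)) * ballot_sum k n = (\<Sum>M\<in>ballots k n. real N / (exp 13 * ln (real N)) * (1 / mset_value M))"
    unfolding ballot_sum_def by (rule sum_distrib_left)
  also have "\<dots> \<le> (\<Sum>M\<in>ballots k n. real (card {P. prime P \<and> n < P \<and> P * prod_mset M \<le> N}))"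
    by (intro sum_mono each)
  also have "\<dots> = real (card (ballot_pairs k n N))"
    unfolding ballot_pairs_def
  proof (subst card_SigmaI)
    show "\<forall>M\<in>ballots k n. finite {P. prime P \<and> n < P \<and> P * prod_mset M \<le> N}"
      by (intro ballI finite_primes_with_bounded_multiple ballots_pos)
  qed (auto simp: finite_ballots)
  finally show ?thesis .
qed

section \<open>Upper bound for the multiplicative energy\<close>

lemma mult_energy_le_ballot_sum:
  assumes "\<And>M. M \<in> ballots k n \<Longrightarrow> (prod_mset M)\<^sup>2 \<le> N"
    "exp 26 \<le> real N" "real n * exp 13 \<le> sqrt (real N)" "ballot_sum k n > 0"
    "(\<Sum>q\<in>ballot_quadruples k n. quadruple_weight q) \<le> K * real k * (ballot_sum k n)\<^sup>2"
  shows "mult_energy N \<le> 392 * exp 52 * K * (real k * ln (real N) ^ 2 / (ballot_sum k n)\<^sup>2)"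
proof -
  define W L where "W = ballot_sum k n" and "L = ln (real N)"
  define A where "A = pair_value ` ballot_pairs k n N"
  have "exp (26::real) \<ge> 1 + 26" by (rule exp_ge_add_one_self)
  then have N: "real N \<ge> 27" using assms(2) by linarith
  then have L: "L > 0" by (simp add: L_def)
  have W: "W > 0" using assms(4) by (simp add: W_def)
  have cardA: "real N / (exp 13 * L) * W \<le> real (card A)"
    unfolding A_def card_image[OF pair_value_inj] L_def W_def
    by (rule card_ballot_pairs_lower) fact+
  have low: "0 < real N / (exp 13 * L) * W" using N L W by simp
  have "card A \<noteq> 0" using low cardA by (intro notI) simp
  then have "A \<noteq> {}" by auto
  moreover have "A \<subseteq> {1..N}" unfolding A_def by (rule pair_value_image_subset)
  ultimately have "mult_energy N \<le> real N ^ 2 * real (card (energy_quadruples A)) / real (card A) ^ 4"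
    by (rule mult_energy_le_set[rotated])
  also have "\<dots> \<le> real N ^ 2 * (2 * (14 * real N / L)\<^sup>2 * (K * real k * W\<^sup>2)) / (real N / (exp 13 * L) * W) ^ 4"
  proof (intro frac_le mult_left_mono power_mono cardA)
    have "real (card (energy_quadruples A)) \<le> 2 * (14 * real N / L)\<^sup>2 * (\<Sum>q\<in>ballot_quadruples k n. quadruple_weight q)"
      unfolding A_def L_def by (rule card_energy_quadruples_bound[OF assms(1)]) (use N in auto)
    also have "\<dots> \<le> 2 * (14 * real N / L)\<^sup>2 * (K * real k * W\<^sup>2)"
      using assms(5) by (intro mult_left_mono) (auto simp: W_def)
    finally show "real (card (energy_quadruples A)) \<le> 2 * (14 * real N / L)\<^sup>2 * (K * real k * W\<^sup>2)" .
    then have "0 \<le> 2 * (14 * real N / L)\<^sup>2 * (K * real k * W\<^sup>2)" by (rule order_trans[OF of_nat_0_le_iff])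
    then show "0 \<le> real N ^ 2 * (2 * (14 * real N / L)\<^sup>2 * (K * real k * W\<^sup>2))"
      by (rule mult_nonneg_nonneg[OF zero_le_power2])
  qed (use low N in auto)
  also have "\<dots> = 392 * exp 13 ^ 4 * K * (real k * L ^ 2 / W\<^sup>2)"
    using N L W by (simp add: field_simps power2_eq_square power4_eq_xxxx)
  also have "exp (13::real) ^ 4 = exp 52" by (simp flip: exp_of_nat_mult)
  finally show ?thesis by (simp add: L_def W_def)
qed

lemma prod_mset_le_power:
  fixes M :: "nat multiset"
  assumes "\<And>p. p \<in># M \<Longrightarrow> p \<le> n"
  shows "prod_mset M \<le> n ^ size M"
  using assms
proof (induction M)
  case (add p M)
  then have "p * prod_mset M \<le> n * n ^ size M" by (intro mult_le_mono) auto
  then show ?case by simp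
qed simp

text \<open>
  The largest \<open>k\<close> with \<open>4 * D * k * 4 ^ k \<le> L\<close>; for \<open>k + 1\<close> the inequality fails, and the left-hand side
  grows by a factor of at most 8.
\<close>

lemma exists_balanced_exponent:
  fixes D L :: real
  assumes "D \<ge> 1" "16 * D \<le> L"
  obtains k :: nat where "k \<ge> 1" "4 * D * real k * 4 ^ k \<le> L" "L < 32 * D * real k * 4 ^ k"
proof -
  let ?P = "\<lambda>k::nat. k \<ge> 1 \<and> 4 * D * real k * 4 ^ k \<le> L"
  have b: "k \<le> nat \<lceil>L\<rceil>" if "?P k" for k
  proof -
    have "real k * 1 \<le> (4 * D * 4 ^ k) * real k"
    proof -
      have "1 * 1 \<le> 4 * D * 4 ^ k" using assms(1) by (intro mult_mono) auto
      then show ?thesis using mult_right_mono[of 1 "4 * D * 4 ^ k" "real k"] by simp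
    qed
    also have "(4 * D * 4 ^ k) * real k = 4 * D * real k * 4 ^ k" by (simp only: mult_ac)
    finally have "real k \<le> L" using that by linarith
    then show ?thesis by linarith
  qed
  have "?P 1" using assms by simp
  define k where "k = Greatest ?P"
  have kP: "?P k" unfolding k_def by (rule GreatestI_nat[of ?P, OF \<open>?P 1\<close>]) (rule b)
  have kmax: "j \<le> k" if "?P j" for j unfolding k_def by (rule Greatest_le_nat[of ?P, OF that]) (rule b)
  note k = kP kmax
  have "\<not> ?P (Suc k)" using k(2)[of "Suc k"] by auto
  then have "L < 4 * D * real (Suc k) * 4 ^ Suc k" by simp
  also have "\<dots> \<le> 4 * D * (2 * real k) * 4 ^ Suc k"
    using k(1) assms(1) by (intro mult_right_mono mult_left_mono) auto
  also have "\<dots> = 32 * D * real k * 4 ^ k" by simp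
  finally show ?thesis using that k(1) by blast
qed

text \<open>
  Choose \<open>k\<close> maximal with \<open>4 * D * k * 4 ^ k \<le> ln N\<close>.  Then products of \<open>k\<close> primes of scale below
  \<open>k + 2\<close> are at most \<open>N powr (1 / 4)\<close>, and \<open>4 ^ k\<close> has order \<open>ln N / k\<close>.  The energy is \<open>O(k * (ln N)\<^sup>2 / W\<^sup>2)\<close> with
  \<open>W\<^sup>2\<close> at least of order \<open>(4 ^ k) powr (2 - delta) / k ^ 3\<close>.  Inserting the size of \<open>4 ^ k\<close> gives
  \<open>k powr (6 - delta) * ln N powr delta\<close>, and \<open>k \<le> ln (ln N)\<close>.
\<close>

lemma mult_energy_upper_bound:
  obtains K N0 where "K > 0" "N0 \<ge> 16"
    "\<And>N. N \<ge> N0 \<Longrightarrow> mult_energy N \<le> K * (ln (real N) powr delta * ln (ln (real N)) ^ 6)"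
proof -
  obtain C where C: "C > 0"
    "\<And>n y. n \<ge> 2 \<Longrightarrow> prime_scale n \<le> y \<Longrightarrow> ln (real n) \<le> C * 4 powr y"
    using prime_scale_bounds by metis
  obtain Q where Q: "Q > 0"
    "\<And>k. k \<ge> 1 \<Longrightarrow> (\<Sum>q\<in>ballot_quadruples k (scale_cutoff (real k + 2)). quadruple_weight q)
       \<le> Q * real k * (ballot_sum k (scale_cutoff (real k + 2)))\<^sup>2"
    using ballot_quadruples_sum_le by blast
  define D where "D = max 1 (16 * C)"
  have D: "D \<ge> 1" "16 * C \<le> D" by (auto simp: D_def)
  define K0 where "K0 = 392 * exp 52 * Q"
  have K0: "K0 > 0" using Q(1) by (simp add: K0_def)
  define K where "K = K0 * exp 2 * (32 * D) ^ 2"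
  have K: "K > 0" using K0 D(1) by (simp add: K_def)
  \<comment> \<open>\<open>ln N \<ge> 16 * D\<close> lets \<open>k = 1\<close> qualify; \<open>ln N \<ge> 52\<close> gives \<open>exp 13 \<le> N powr (1 / 4)\<close>.\<close>
  define N0 where "N0 = nat \<lceil>exp (max (16 * D) 52)\<rceil> + 16"
  have main: "mult_energy N \<le> K * (ln (real N) powr delta * ln (ln (real N)) ^ 6)" if "N \<ge> N0" for N
  proof -
    define L where "L = ln (real N)"
    have "exp (max (16 * D) 52) \<le> real N" using that unfolding N0_def by linarith
    then have "ln (exp (max (16 * D) 52)) \<le> L" unfolding L_def
      by (intro ln_mono) (auto intro: less_le_trans[OF exp_gt_zero])
    then have L: "16 * D \<le> L" "52 \<le> L" by auto
    have N0: "real N > 0" using that by (simp add: N0_def)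
    have NL: "real N = exp L" using N0 by (simp add: L_def)
    obtain k :: nat where k: "k \<ge> 1" "4 * D * real k * 4 ^ k \<le> L" "L < 32 * D * real k * 4 ^ k"
      using exists_balanced_exponent[OF D(1) L(1)] by blast
    define n where "n = scale_cutoff (real k + 2)"
    define W where "W = ballot_sum k n"
    have W: "W > 0" "(4 ^ k) powr (2 - delta) \<le> exp 2 * real k ^ 3 * W\<^sup>2"
      unfolding W_def n_def by (rule ballot_sum_cutoff_lower[OF k(1)])+
    have ln_n: "ln (real n) \<le> D * 4 ^ k" if "n \<ge> 2"
    proof -
      have "prime_scale n \<le> real k + 2" unfolding n_def using scale_cutoff(1)[of "real k + 2" n] n_def by simp
      then have "ln (real n) \<le> C * 4 powr (real k + 2)" using that by (intro C(2))
      also have "4 powr (real k + 2) = 16 * 4 ^ k" by (simp add: powr_add powr_realpow)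
      also have "C * (16 * 4 ^ k) \<le> D * 4 ^ k" using mult_right_mono[OF D(2), of "4 ^ k"] by simp
      finally show ?thesis .
    qed
    have n: "real n \<le> exp (D * 4 ^ k)"
    proof (cases "n \<ge> 2")
      case True
      have "exp (ln (real n)) \<le> exp (D * 4 ^ k)" using ln_n[OF True] by simp
      then show ?thesis using True by simp
    next
      case False
      then have "real n \<le> 1" by simp
      also have "1 \<le> exp (D * 4 ^ k)" using D(1) by simp
      finally show ?thesis .
    qed
    have Dk: "D * 4 ^ k * real k \<le> L / 4" using k(2) by (simp add: mult_ac)
    have Dk1: "D * 4 ^ k \<le> L / 4"
    proof -
      have "D * 4 ^ k * 1 \<le> D * 4 ^ k * real k" using k(1) D(1) by (intro mult_left_mono) auto
      then show ?thesis using Dk by simp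
    qed
    have prods: "(prod_mset M)\<^sup>2 \<le> N" if M: "M \<in> ballots k n" for M
    proof -
      have "prod_mset M \<le> n ^ size M" using M by (intro prod_mset_le_power) (auto simp: ballots_def)
      then have "prod_mset M \<le> n ^ k" using M by (simp add: ballots_def)
      then have "mset_value M \<le> real n ^ k" by (metis of_nat_le_iff of_nat_power)
      also have "\<dots> \<le> exp (D * 4 ^ k) ^ k" using n by (intro power_mono) auto
      also have "\<dots> = exp (D * 4 ^ k * real k)" by (simp add: exp_of_nat_mult[symmetric] mult_ac)
      also have "\<dots> \<le> exp (L / 4)" using Dk by simp
      finally have "mset_value M ^ 2 \<le> exp (L / 4) ^ 2" by (intro power_mono) auto
      also have "\<dots> = exp (L / 2)" by (simp flip: exp_of_nat_mult)
      also have "\<dots> \<le> exp L" using L(2) by simp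
      finally have "real ((prod_mset M)\<^sup>2) \<le> real N" using NL by simp
      then show ?thesis by (simp only: of_nat_le_iff)
    qed
    have e26: "exp 26 \<le> real N" unfolding NL using L(2) by simp
    have ncut: "real n * exp 13 \<le> sqrt (real N)"
    proof -
      have "real n * exp 13 \<le> exp (L / 4) * exp (L / 4)"
      proof (intro mult_mono)
        show "real n \<le> exp (L / 4)" using n Dk1 by (meson exp_le_cancel_iff order_trans)
        show "exp 13 \<le> exp (L / 4)" using L(2) by simp
      qed auto
      also have "\<dots> = exp (L / 2)" by (simp flip: exp_add)
      also have "\<dots> = sqrt (real N)" unfolding NL
        by (rule real_sqrt_unique[symmetric]) (auto simp flip: exp_of_nat_mult)
      finally show ?thesis .
    qed
    have "mult_energy N \<le> 392 * exp 52 * Q * (real k * ln (real N) ^ 2 / (ballot_sum k n)\<^sup>2)"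
      using W(1) Q(2)[OF k(1)] prods e26 ncut unfolding n_def[symmetric] W_def
      by (intro mult_energy_le_ballot_sum) auto
    then have E: "mult_energy N \<le> K0 * (real k * L\<^sup>2 / W\<^sup>2)" by (simp add: K0_def L_def W_def)
    have kp: "real k > 0" using k(1) by simp
    have d: "0 \<le> delta" "delta \<le> 1" by (rule delta_bounds)+
    have Lk: "L / (32 * D * real k) \<le> 4 ^ k" using k(3) kp D(1) by (simp add: field_simps)
    have L0: "L > 0" using L(2) by simp
    \<comment> \<open>The loss \<open>(32 * D * k) powr (2 - delta)\<close> is rounded up to \<open>k\<^sup>2\<close>, using \<open>delta \<ge> 0\<close>.\<close>
    have "L powr (2 - delta) = (L / (32 * D * real k)) powr (2 - delta) * (32 * D * real k) powr (2 - delta)"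
      using L0 D(1) kp by (subst powr_mult[symmetric]) auto
    also have "\<dots> \<le> (4 ^ k) powr (2 - delta) * (32 * D * real k) powr 2"
    proof (intro mult_mono powr_mono2 powr_mono Lk)
      have "1 * 1 \<le> (32 * D) * real k" using D(1) k(1) by (intro mult_mono) auto
      then show "1 \<le> 32 * D * real k" by simp
    qed (use d L0 D(1) kp in auto)
    also have "(32 * D * real k) powr 2 = (32 * D) ^ 2 * real k ^ 2"
      using D(1) kp by (simp add: powr_numeral power_mult_distrib)
    also have "(4 ^ k) powr (2 - delta) * ((32 * D) ^ 2 * real k ^ 2) \<le> (exp 2 * real k ^ 3 * W\<^sup>2) * ((32 * D) ^ 2 * real k ^ 2)"
      using W(2) by (intro mult_right_mono) auto
    finally have "L powr (2 - delta) \<le> (exp 2 * (32 * D) ^ 2) * (real k ^ 5 * W\<^sup>2)"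
      by (simp add: power_add[symmetric] mult_ac numeral_eq_Suc)
    then have "L powr delta * L powr (2 - delta) \<le> L powr delta * ((exp 2 * (32 * D) ^ 2) * (real k ^ 5 * W\<^sup>2))"
      by (intro mult_left_mono) auto
    moreover have "L powr delta * L powr (2 - delta) = L\<^sup>2"
      using L0 by (simp add: powr_add[symmetric] powr_numeral)
    ultimately have "L\<^sup>2 \<le> L powr delta * ((exp 2 * (32 * D) ^ 2) * (real k ^ 5 * W\<^sup>2))" by simp
    then have "L\<^sup>2 / W\<^sup>2 \<le> L powr delta * ((exp 2 * (32 * D) ^ 2) * real k ^ 5)"
      using W(1) by (simp add: field_simps)
    then have "K0 * (real k * (L\<^sup>2 / W\<^sup>2)) \<le> K0 * (real k * (L powr delta * ((exp 2 * (32 * D) ^ 2) * real k ^ 5)))"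
      using K0 by (intro mult_left_mono) auto
    also have "\<dots> = K * (L powr delta * real k ^ 6)" by (simp add: K_def numeral_eq_Suc mult_ac)
    also have "\<dots> \<le> K * (L powr delta * ln L ^ 6)"
    proof (intro mult_left_mono power_mono)
      have "1 * 4 ^ k \<le> (4 * D * real k) * 4 ^ k"
      proof (intro mult_right_mono)
        have "1 * 1 \<le> (4 * D) * real k" using D(1) k(1) by (intro mult_mono) auto
        then show "1 \<le> 4 * D * real k" by simp
      qed auto
      then have "4 ^ k \<le> L" using k(2) by linarith
      then have "ln (4 ^ k) \<le> ln L" by (intro ln_mono) auto
      then have "real k * ln 4 \<le> ln L" by (simp add: ln_realpow)
      moreover have "real k * 1 \<le> real k * ln 4" using ln_4_ge_1 by (intro mult_left_mono) auto
      ultimately show "real k \<le> ln L" by simp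
    qed (use K in auto)
    finally show ?thesis using E by (simp add: L_def)
  qed
  show ?thesis
    by (rule that[OF K _ main, of N0]) (auto simp: N0_def)
qed

section \<open>Nonvanishing of theta values\<close>

theorem theorem1p4:
  fixes x :: real
  assumes "x > 0"
  shows "\<exists>K\<^sub>1>0. \<exists>K\<^sub>2>0. \<exists>p\<^sub>0::nat. \<forall>p\<ge>p\<^sub>0. prime p \<longrightarrow>
    (let q = nat \<lfloor>sqrt (real p / 3)\<rfloor> in
       real (card {\<chi> \<in> even_characters p. theta p x \<chi> \<noteq> 0}) \<ge> K\<^sub>1 * (real p / mult_energy q) \<and>
       real p / mult_energy q \<ge>
         K\<^sub>2 * (real p / (ln (real p) powr delta * ln (ln (real p)) ^ 6)))"
proof -
  obtain K N0 where K: "K > 0" "N0 \<ge> 16"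
    "\<And>N. N \<ge> N0 \<Longrightarrow> mult_energy N \<le> K * (ln (real N) powr delta * ln (ln (real N)) ^ 6)"
    using mult_energy_upper_bound by blast
  define K1 where "K1 = exp (- 4 * pi * x / 3) * (1 - exp (- pi * x)) ^ 4 / 576"
  have K1: "K1 > 0" using assms by (simp add: K1_def)
  have "\<forall>p\<ge>3 * (N0 + 1) ^ 2. prime p \<longrightarrow>
    (let q = nat \<lfloor>sqrt (real p / 3)\<rfloor> in
       real (card {\<chi> \<in> even_characters p. theta p x \<chi> \<noteq> 0}) \<ge> K1 * (real p / mult_energy q) \<and>
       real p / mult_energy q \<ge>
         (1 / K) * (real p / (ln (real p) powr delta * ln (ln (real p)) ^ 6)))"
  proof (intro allI impI)
    fix p :: nat assume pN: "3 * (N0 + 1) ^ 2 \<le> p" and p: "prime p"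
    define r where "r = sqrt (real p / 3)"
    define q where "q = nat \<lfloor>r\<rfloor>"
    have "(real N0 + 1) ^ 2 \<le> real p / 3"
    proof -
      have "real (3 * (N0 + 1) ^ 2) \<le> real p" using pN by (simp only: of_nat_le_iff)
      then show ?thesis by (simp add: add.commute)
    qed
    then have r: "real N0 + 1 \<le> r" unfolding r_def by (rule real_le_rsqrt)
    have r2: "r\<^sup>2 = real p / 3" by (simp add: r_def)
    have q: "N0 \<le> q" "real q \<le> r" "r \<le> 2 * real q" using r K(2) unfolding q_def by linarith+
    have q16: "q \<ge> 16" using q(1) K(2) by simp
    have "real q ^ 2 \<le> r\<^sup>2" using q(2) by (intro power_mono) auto
    then have a: "real (3 * q ^ 2) \<le> real p" unfolding r2 by simp
    have "r\<^sup>2 \<le> (2 * real q) ^ 2" using q(3) r by (intro power_mono) auto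
    then have b: "real p \<le> real (12 * q ^ 2)" unfolding r2 by (simp add: power_mult_distrib)
    have ab: "3 * q ^ 2 \<le> p" "p \<le> 12 * q ^ 2" using a b by (simp_all only: of_nat_le_iff)
    have "q \<le> q ^ 2" by (simp add: power2_eq_square)
    then have qp: "q \<le> p" "p > 2" using ab q16 by linarith+
    let ?N = "real (card {\<chi> \<in> even_characters p. theta p x \<chi> \<noteq> 0})"
    have count: "K1 * real p \<le> ?N * mult_energy q"
      unfolding K1_def using theta_nonvanishing_count_energy[OF assms p qp(2) ab] by simp
    have "0 < ?N * mult_energy q" using count K1 qp(2) by (intro less_le_trans[OF _ count]) auto
    then have E: "mult_energy q > 0" by (simp add: zero_less_mult_iff)
    have 1: "?N \<ge> K1 * (real p / mult_energy q)" using count E by (simp add: field_simps)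
    define B where "B = ln (real p) powr delta * ln (ln (real p)) ^ 6"
    have "exp 1 \<le> (3::real)" by (rule exp_le)
    then have "exp 1 \<le> real q" using q16 by linarith
    then have "ln (exp 1) \<le> ln (real q)" by (intro ln_mono) (use q16 in auto)
    then have lq: "1 \<le> ln (real q)" by simp
    have lqp: "ln (real q) \<le> ln (real p)" using qp q16 by (intro ln_mono) auto
    have "mult_energy q \<le> K * (ln (real q) powr delta * ln (ln (real q)) ^ 6)" by (rule K(3)[OF q(1)])
    also have "\<dots> \<le> K * B" unfolding B_def
      using lq lqp K(1) delta_bounds(1) qp q16
      by (intro mult_left_mono mult_mono powr_mono2 power_mono ln_mono) auto
    finally have EB: "mult_energy q \<le> K * B" .
    then have B: "B > 0" using E K(1) by (smt (verit) mult_nonneg_nonpos)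
    have "real p / (K * B) \<le> real p / mult_energy q"
      using EB E by (intro divide_left_mono) auto
    then have 2: "real p / mult_energy q \<ge> (1 / K) * (real p / B)" by simp
    show "let q = nat \<lfloor>sqrt (real p / 3)\<rfloor> in
       real (card {\<chi> \<in> even_characters p. theta p x \<chi> \<noteq> 0}) \<ge> K1 * (real p / mult_energy q) \<and>
       real p / mult_energy q \<ge>
         (1 / K) * (real p / (ln (real p) powr delta * ln (ln (real p)) ^ 6))"
      using 1 2 unfolding Let_def B_def q_def r_def by blast
  qed
  then show ?thesis using K1 K(1) by (intro exI[of _ K1] conjI exI[of _ "1 / K"] exI[of _ "3 * (N0 + 1) ^ 2"]) auto
qed

end
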